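(* Let $(\mathbb M^{n+m},\mathcal F,g_0)$ be a smooth, connected, complete manifold with a Riemannian foliation $\mathcal F$ having $m$-dimensional totally geodesic leaves and bundle-like metric $g_0=g_{\mathcal H,0}\oplus g_{\mathcal V,0}$. Let $g(t)=g_{\mathcal H}(t)\oplus g_{\mathcal V}$ be a solution of the transverse flow $\frac{\partial}{\partial t} g_{\mathcal H}(t)=h(t)$, $\frac{\partial}{\partial t}g_{\mathcal V}=0$, $g(0)=g_0$, where $h(t)$ is a symmetric $(0,2)$ tensor with $h(X,Z)=0$ whenever $X$ or $Z$ is vertical. Let $\varepsilon>0$. Then for every $f\in C^\infty(\mathbb M)$ and every time $t$, $$dL^tf=\square_\varepsilon^t\, df,$$ and, for $\eta=df$, $$\frac12 L^t\|\eta\|_\varepsilon^2-\langle\square_\varepsilon^t\eta,\eta\rangle_\varepsilon\ \ge\ \frac1n\big(\mathrm{Tr}_{\mathcal H}\nabla^{t,\sharp}_{g_{\mathcal H}(t)}\eta\big)^2-\frac14\mathrm{Tr}_{\mathcal H}(\mathbf J^2_\eta)+\langle\mathfrak{Ric}_{g_{\mathcal H}(t)}(\eta),\eta\rangle_{\mathcal H}-\langle\delta_{\mathcal H}T(\eta),\eta\rangle_{\mathcal V}+\frac1\varepsilon\langle\mathbf J^2(\eta),\eta\rangle_{\mathcal H}.$$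
   Context: Foliation: $\mathcal V\subset T\mathbb M$ is the bundle of vectors tangent to the leaves (rank $m$, vertical) and $\mathcal H=\mathcal V^\perp$ (rank $n$, horizontal), assumed bracket generating. A vector field $X$ is foliate if $[X,Z]$ is vertical for every vertical $Z$; $g$ is bundle-like if for all open $U$ and all horizontal foliate $X,Y$ on $U$ one has $Z\,g(X,Y)=0$ for all vertical $Z$. Along the flow $\mathcal H,\mathcal V$ are fixed and orthogonal for every $g(t)$. All objects below are computed at time $t$ with $g(t)$. With $\nabla^R$ the Levi-Civita connection of $g(t)$ and $\pi_{\mathcal H},\pi_{\mathcal V}$ the orthogonal projections, the Bott connection $\nabla^t=\nabla$ is: $\nabla_XY=\pi_{\mathcal H}(\nabla^R_XY)$ for $X,Y$ horizontal; $\pi_{\mathcal H}([X,Y])$ for $X$ vertical, $Y$ horizontal; $\pi_{\mathcal V}([X,Y])$ for $X$ horizontal, $Y$ vertical; $\pi_{\mathcal V}(\nabla^R_XY)$ for $X,Y$ vertical. $T$ is its torsion. $X_1(t),\dots,X_n(t)$ and $Z_1,\dots,Z_m$ denote local orthonormal horizontal and vertical frames. Horizontal Laplacian: $L^t=-\nabla_{\mathcal H}^*\nabla_{\mathcal H}=\sum_{i=1}^n\big(\nabla_{X_i}\nabla_{X_i}-\nabla_{\nabla_{X_i}X_i}\big)$, which acts on functions. For vertical $Z$, $J_Z$ is the skew-symmetric endomorphism of $\mathcal H$ with $g_{\mathcal H}(J_ZX,Y)=g_{\mathcal V}(Z,T(X,Y))$ for $X,Y$ horizontal, extended by $0$ on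 $\mathcal V$ (and $J_Y=0$ for $Y$ horizontal). $\mathbf J^2=\sum_{j=1}^mJ_{Z_j}J_{Z_j}$. For a one-form $\eta$, $\mathbf J_\eta=J_Z$, where $Z$ is the vertical vector dual (via $g_{\mathcal V}$) to the vertical part of $\eta$, and $\mathrm{Tr}_{\mathcal H}(\mathbf J_\eta^2)$ is the trace of $J_Z^2$ on $\mathcal H$. $\delta_{\mathcal H}T(X)=-\sum_{i=1}^n(\nabla_{X_i}T)(X_i,X)$. The $(1,1)$ tensors $\mathbf J^2$ and $\delta_{\mathcal H}T$ act on one-forms by identifying vectors and one-forms through $g(t)$ (so $\delta_{\mathcal H}T$ sends horizontal forms to vertical ones and kills vertical ones). $\mathfrak{Ric}_{g_{\mathcal H}(t)}=\mathfrak{Ric}_{\mathcal H}$ is the fiberwise symmetric linear map on one-forms with $\langle\mathfrak{Ric}_{\mathcal H}(df),dg\rangle=\mathbf{Ric}(\nabla_{\mathcal H}f,\nabla_{\mathcal H}g)$, where $\mathbf{Ric}$ is the Ricci curvature of the Bott connection and $\nabla_{\mathcal H}f$ is the horizontal gradient. Metrics $g_\varepsilon(t)=g_{\mathcal H}(t)\oplus\frac1\varepsilon g_{\mathcal V}$; on one-forms $\|\eta\|_\varepsilon^2=\|\eta\|_{\mathcal H}^2+\varepsilon\|\eta\|_{\mathcal V}^2$, where $\|\cdot\|_{\mathcal H},\|\cdot\|_{\mathcal V}$ are the $g(t)$-norms of the horizontal and vertical parts; $\langle\cdot,\cdot\rangle_{\varepsilon},\langle\cdot,\cdot\rangle_{\mathcal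 H},\langle\cdot,\cdot\rangle_{\mathcal V}$ are the corresponding inner products. $\mathfrak T^\varepsilon_XY=T(X,Y)-\frac1\varepsilon J_YX$, acting on one-forms by duality, $(\mathfrak T^\varepsilon_X\eta)(Y)=-\eta(\mathfrak T^\varepsilon_XY)$; the subscript $g_{\mathcal H}(t)$ in $\nabla_{g_{\mathcal H}(t)}-\mathfrak T^\varepsilon_{g_{\mathcal H}(t)}$ means only horizontal directions $X$ are used, and $-(\nabla_{g_{\mathcal H}(t)}-\mathfrak T^\varepsilon_{g_{\mathcal H}(t)})^*(\nabla_{g_{\mathcal H}(t)}-\mathfrak T^\varepsilon_{g_{\mathcal H}(t)})=\sum_i\big[(\nabla_{X_i}-\mathfrak T^\varepsilon_{X_i})^2-(\nabla_{\nabla_{X_i}X_i}-\mathfrak T^\varepsilon_{\nabla_{X_i}X_i})\big]$. On one-forms, $$\square_\varepsilon^t=-(\nabla_{g_{\mathcal H}(t)}-\mathfrak T^\varepsilon_{g_{\mathcal H}(t)})^*(\nabla_{g_{\mathcal H}(t)}-\mathfrak T^\varepsilon_{g_{\mathcal H}(t)})-\frac1\varepsilon\mathbf J^2+\frac1\varepsilon\delta_{\mathcal H}T-\mathfrak{Ric}_{g_{\mathcal H}(t)}.$$ $\nabla^{t,\sharp}_{g_{\mathcal H}(t)}\eta$ is the symmetrization of the horizontal bilinear form $(X,Y)\mapsto(\nabla_X\eta)(Y)$, $X,Y$ horizontal; its horizontal trace is $\mathrm{Tr}_{\mathcal H}\nabla^{t,\sharp}_{g_{\mathcal H}(t)}\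eta=\sum_i(\nabla_{X_i}\eta)(X_i)$.
   Formalization: Two corrections: every metric g(t) along the flow is assumed bundle-like (not only g_0), and δ_H T is taken as +Σ(∇_{X_i}T)(X_i,X), with plus instead of minus sign; without either one the identity dL^t f = □_ε^t df fails. *)

theory Defs
  imports "HOL-Analysis.Analysis"
begin

section \<open>Smooth functions, charts, tangent vectors and vector fields\<close>

text \<open>The set argument is meant to be open.\<close>

primrec cont_diff :: "nat \<Rightarrow> 'e::euclidean_space set \<Rightarrow> ('e \<Rightarrow> real) \<Rightarrow> bool" where
  "cont_diff 0 S f \<longleftrightarrow> continuous_on S f"
| "cont_diff (Suc k) S f \<longleftrightarrow>
     (\<forall>x\<in>S. f differentiable (at x)) \<and>
     (\<forall>v. cont_diff k S (\<lambda>x. frechet_derivative f (at x) v))"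

definition smooth :: "'e::euclidean_space set \<Rightarrow> ('e \<Rightarrow> real) \<Rightarrow> bool" where
  "smooth S f \<longleftrightarrow> (\<forall>k. cont_diff k S f)"

type_synonym ('a, 'e) chart = "'a set \<times> ('a \<Rightarrow> 'e)"

definition smooth_atlas ::
  "('a::topological_space, 'e::euclidean_space) chart set \<Rightarrow> bool" where
  "smooth_atlas A \<longleftrightarrow>
     (\<Union>(U, \<phi>)\<in>A. U) = UNIV \<and>
     (\<forall>(U, \<phi>)\<in>A. open U \<and> open (\<phi> ` U) \<and> homeomorphism U (\<phi> ` U) \<phi> (inv_into U \<phi>)) \<and>
     (\<forall>(U, \<phi>)\<in>A. \<forall>(U', \<phi>')\<in>A. \<forall>b\<in>Basis.
        smooth (\<phi> ` (U \<inter> U')) (\<lambda>x. \<phi>' (inv_into U \<phi> x) \<bullet> b))"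

text \<open>
  A foliation is given by foliated charts: the coordinates with index in \<open>B\<close> are the
  transverse ones, and the plaques of a chart are the sets on which these coordinates are
  constant.  Changes of charts have to map plaques into plaques locally, that is, they are
  locally of the form \<open>(x, y) \<mapsto> (\<tau> x, \<sigma> (x, y))\<close> with \<open>x\<close> the transverse coordinates.
  The leaves have dimension \<open>card (Basis - B)\<close>.
\<close>

definition foliated_atlas ::
  "('a::topological_space, 'e::euclidean_space) chart set \<Rightarrow> 'e set \<Rightarrow> bool" where
  "foliated_atlas A B \<longleftrightarrow>
     smooth_atlas A \<and> B \<subseteq> Basis \<and>
     (\<forall>(U, \<phi>)\<in>A. \<forall>(U', \<phi>')\<in>A. \<forall>p \<in> U \<inter> U'.
        \<exists>W. open W \<and> p \<in> W \<and> W \<subseteq> U \<inter> U' \<and>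
          (\<forall>q\<in>W. \<forall>r\<in>W. (\<forall>b\<in>B. \<phi> q \<bullet> b = \<phi> r \<bullet> b) \<longrightarrow> (\<forall>b\<in>B. \<phi>' q \<bullet> b = \<phi>' r \<bullet> b)))"

definition smooth_fun ::
  "('a::topological_space, 'e::euclidean_space) chart set \<Rightarrow> 'a set \<Rightarrow> ('a \<Rightarrow> real) \<Rightarrow> bool" where
  "smooth_fun A W f \<longleftrightarrow> open W \<and> (\<forall>(U, \<phi>)\<in>A. smooth (\<phi> ` (U \<inter> W)) (f \<circ> inv_into U \<phi>))"

definition smooth_near ::
  "('a::topological_space, 'e::euclidean_space) chart set \<Rightarrow> 'a \<Rightarrow> ('a \<Rightarrow> real) \<Rightarrow> bool" where
  "smooth_near A p f \<longleftrightarrow> (\<exists>W. p \<in> W \<and> smooth_fun A W f)"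

text \<open>
  Tangent vectors at \<open>p\<close> are the derivations at \<open>p\<close> of the functions that are smooth near \<open>p\<close>.
  Their value on all other functions is fixed to be \<open>0\<close>, so that a derivation is represented
  by exactly one HOL function.
\<close>

type_synonym 'a tvec = "('a \<Rightarrow> real) \<Rightarrow> real"
type_synonym 'a vfield = "'a \<Rightarrow> 'a tvec"

definition tangent ::
  "('a::topological_space, 'e::euclidean_space) chart set \<Rightarrow> 'a \<Rightarrow> 'a tvec set" where
  "tangent A p =
     {v. (\<forall>f h. smooth_near A p f \<longrightarrow> smooth_near A p h \<longrightarrow>
            (\<forall>a b. v (\<lambda>x. a * f x + b * h x) = a * v f + b * v h) \<and>
            v (\<lambda>x. f x * h x) = f p * v h + h p * v f) \<and>
         (\<forall>f. \<not> smooth_near A p f \<longrightarrow> v f = 0)}"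

definition vector_field ::
  "('a::topological_space, 'e::euclidean_space) chart set \<Rightarrow> 'a set \<Rightarrow> 'a vfield \<Rightarrow> bool" where
  "vector_field A U X \<longleftrightarrow>
     (\<forall>p\<in>U. X p \<in> tangent A p) \<and>
     (\<forall>W f. W \<subseteq> U \<longrightarrow> smooth_fun A W f \<longrightarrow> smooth_fun A W (\<lambda>p. X p f))"

definition lie ::
  "('a::topological_space, 'e::euclidean_space) chart set \<Rightarrow> 'a vfield \<Rightarrow> 'a vfield \<Rightarrow> 'a vfield" where
  "lie A X Y = (\<lambda>p f. if smooth_near A p f
                      then X p (\<lambda>q. Y q f) - Y p (\<lambda>q. X q f) else 0)"

section \<open>Riemannian metrics, completeness, Levi-Civita connection\<close>

type_synonym 'a tensor2 = "'a \<Rightarrow> 'a tvec \<Rightarrow> 'a tvec \<Rightarrow> real"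

definition symmetric_tensor ::
  "('a::topological_space, 'e::euclidean_space) chart set \<Rightarrow> 'a tensor2 \<Rightarrow> bool" where
  "symmetric_tensor A h \<longleftrightarrow>
     (\<forall>p. \<forall>u\<in>tangent A p. \<forall>v\<in>tangent A p. h p u v = h p v u) \<and>
     (\<forall>p. \<forall>u\<in>tangent A p. \<forall>v\<in>tangent A p. \<forall>w\<in>tangent A p. \<forall>a b.
        h p (\<lambda>f. a * u f + b * v f) w = a * h p u w + b * h p v w) \<and>
     (\<forall>U X Y. open U \<longrightarrow> vector_field A U X \<longrightarrow> vector_field A U Y \<longrightarrow>
        smooth_fun A U (\<lambda>p. h p (X p) (Y p)))"

definition riemannian_metric ::
  "('a::topological_space, 'e::euclidean_space) chart set \<Rightarrow> 'a tensor2 \<Rightarrow> bool" where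
  "riemannian_metric A g \<longleftrightarrow>
     symmetric_tensor A g \<and> (\<forall>p. \<forall>v\<in>tangent A p. v \<noteq> (\<lambda>_. 0) \<longrightarrow> 0 < g p v v)"

definition smooth_curve ::
  "('a::topological_space, 'e::euclidean_space) chart set \<Rightarrow> (real \<Rightarrow> 'a) \<Rightarrow> bool" where
  "smooth_curve A \<gamma> \<longleftrightarrow>
     continuous_on UNIV \<gamma> \<and> (\<forall>W f. smooth_fun A W f \<longrightarrow> smooth (\<gamma> -` W) (f \<circ> \<gamma>))"

definition velocity ::
  "('a::topological_space, 'e::euclidean_space) chart set \<Rightarrow> (real \<Rightarrow> 'a) \<Rightarrow> real \<Rightarrow> 'a tvec" where
  "velocity A \<gamma> s = (\<lambda>f. if smooth_near A (\<gamma> s) f then deriv (f \<circ> \<gamma>) s else 0)"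

definition curve_length ::
  "('a::topological_space, 'e::euclidean_space) chart set \<Rightarrow> 'a tensor2 \<Rightarrow> (real \<Rightarrow> 'a) \<Rightarrow> real" where
  "curve_length A g \<gamma> =
     integral {0..1} (\<lambda>s. sqrt (g (\<gamma> s) (velocity A \<gamma> s) (velocity A \<gamma> s)))"

text \<open>
  Curves are not required to be regular, so a piecewise smooth curve can be reparametrised
  to a smooth one of the same length (with vanishing velocity at the corners and ends);
  the infimum is the usual Riemannian distance.
\<close>

definition riemannian_dist ::
  "('a::topological_space, 'e::euclidean_space) chart set \<Rightarrow> 'a tensor2 \<Rightarrow> 'a \<Rightarrow> 'a \<Rightarrow> real" where
  "riemannian_dist A g p q =
     Inf {curve_length A g \<gamma> | \<gamma>. smooth_curve A \<gamma> \<and> \<gamma> 0 = p \<and> \<gamma> 1 = q}"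

definition complete_riemannian ::
  "('a::topological_space, 'e::euclidean_space) chart set \<Rightarrow> 'a tensor2 \<Rightarrow> bool" where
  "complete_riemannian A g \<longleftrightarrow>
     (\<forall>\<sigma> :: nat \<Rightarrow> 'a.
        (\<forall>e>0. \<exists>N. \<forall>i\<ge>N. \<forall>j\<ge>N. riemannian_dist A g (\<sigma> i) (\<sigma> j) < e) \<longrightarrow>
        (\<exists>l. (\<lambda>i. riemannian_dist A g (\<sigma> i) l) \<longlonglongrightarrow> 0))"

text \<open>
  Affine connections operate on vector fields defined on arbitrary open sets; the axioms for
  all open \<open>U\<close> make them local.  The Levi-Civita connection is the torsion-free metric one.
\<close>

definition affine_connection ::
  "('a::topological_space, 'e::euclidean_space) chart set
     \<Rightarrow> ('a vfield \<Rightarrow> 'a vfield \<Rightarrow> 'a vfield) \<Rightarrow> bool" where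
  "affine_connection A D \<longleftrightarrow>
     (\<forall>U X Y W u. open U \<longrightarrow> vector_field A U X \<longrightarrow> vector_field A U Y \<longrightarrow>
        vector_field A U W \<longrightarrow> smooth_fun A U u \<longrightarrow>
        vector_field A U (D X Y) \<and>
        (\<forall>p\<in>U. \<forall>f.
           D (\<lambda>q k. u q * X q k + W q k) Y p f = u p * D X Y p f + D W Y p f \<and>
           D X (\<lambda>q k. Y q k + W q k) p f = D X Y p f + D X W p f \<and>
           D X (\<lambda>q k. u q * Y q k) p f = u p * D X Y p f + X p u * Y p f))"

definition levi_civita ::
  "('a::topological_space, 'e::euclidean_space) chart set \<Rightarrow> 'a tensor2
     \<Rightarrow> ('a vfield \<Rightarrow> 'a vfield \<Rightarrow> 'a vfield) \<Rightarrow> bool" where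
  "levi_civita A g D \<longleftrightarrow>
     affine_connection A D \<and>
     (\<forall>U X Y W. open U \<longrightarrow> vector_field A U X \<longrightarrow> vector_field A U Y \<longrightarrow> vector_field A U W \<longrightarrow>
        (\<forall>p\<in>U.
           (\<forall>f. D X Y p f - D Y X p f = lie A X Y p f) \<and>
           X p (\<lambda>q. g q (Y q) (W q)) = g p (D X Y p) (W p) + g p (Y p) (D X W p)))"

section \<open>Riemannian foliations\<close>

definition vert ::
  "('a::topological_space, 'e::euclidean_space) chart set \<Rightarrow> 'e set \<Rightarrow> 'a \<Rightarrow> 'a tvec set" where
  "vert A B p =
     {v \<in> tangent A p. \<forall>(U, \<phi>)\<in>A. p \<in> U \<longrightarrow> (\<forall>b\<in>B. v (\<lambda>q. \<phi> q \<bullet> b) = 0)}"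

definition horiz ::
  "('a::topological_space, 'e::euclidean_space) chart set \<Rightarrow> 'e set \<Rightarrow> 'a tensor2
     \<Rightarrow> 'a \<Rightarrow> 'a tvec set" where
  "horiz A B g p = {v \<in> tangent A p. \<forall>w\<in>vert A B p. g p v w = 0}"

definition vertical_field ::
  "('a::topological_space, 'e::euclidean_space) chart set \<Rightarrow> 'e set \<Rightarrow> 'a set \<Rightarrow> 'a vfield \<Rightarrow> bool" where
  "vertical_field A B U Z \<longleftrightarrow> vector_field A U Z \<and> (\<forall>p\<in>U. Z p \<in> vert A B p)"

definition horizontal_field ::
  "('a::topological_space, 'e::euclidean_space) chart set \<Rightarrow> 'e set \<Rightarrow> 'a tensor2
     \<Rightarrow> 'a set \<Rightarrow> 'a vfield \<Rightarrow> bool" where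
  "horizontal_field A B g U X \<longleftrightarrow> vector_field A U X \<and> (\<forall>p\<in>U. X p \<in> horiz A B g p)"

definition foliate_field ::
  "('a::topological_space, 'e::euclidean_space) chart set \<Rightarrow> 'e set \<Rightarrow> 'a set \<Rightarrow> 'a vfield \<Rightarrow> bool" where
  "foliate_field A B U X \<longleftrightarrow>
     vector_field A U X \<and> (\<forall>Z. vertical_field A B U Z \<longrightarrow> vertical_field A B U (lie A X Z))"

definition bundle_like ::
  "('a::topological_space, 'e::euclidean_space) chart set \<Rightarrow> 'e set \<Rightarrow> 'a tensor2 \<Rightarrow> bool" where
  "bundle_like A B g \<longleftrightarrow>
     (\<forall>U X Y Z. open U \<longrightarrow>
        horizontal_field A B g U X \<longrightarrow> foliate_field A B U X \<longrightarrow>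
        horizontal_field A B g U Y \<longrightarrow> foliate_field A B U Y \<longrightarrow>
        vertical_field A B U Z \<longrightarrow> (\<forall>p\<in>U. Z p (\<lambda>q. g q (X q) (Y q)) = 0))"

text \<open>The second fundamental form of the leaves vanishes (\<open>D\<close> is the Levi-Civita connection).\<close>

definition totally_geodesic_leaves ::
  "('a::topological_space, 'e::euclidean_space) chart set \<Rightarrow> 'e set
     \<Rightarrow> ('a vfield \<Rightarrow> 'a vfield \<Rightarrow> 'a vfield) \<Rightarrow> bool" where
  "totally_geodesic_leaves A B D \<longleftrightarrow>
     (\<forall>U Y Z. open U \<longrightarrow> vertical_field A B U Y \<longrightarrow> vertical_field A B U Z \<longrightarrow>
        vertical_field A B U (D Y Z))"

inductive_set horizontal_lie_hull ::
  "('a::topological_space, 'e::euclidean_space) chart set \<Rightarrow> 'e set \<Rightarrow> 'a tensor2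
     \<Rightarrow> 'a set \<Rightarrow> 'a vfield set"
  for A B g U where
  "horizontal_field A B g U X \<Longrightarrow> X \<in> horizontal_lie_hull A B g U"
| "X \<in> horizontal_lie_hull A B g U \<Longrightarrow> Y \<in> horizontal_lie_hull A B g U \<Longrightarrow>
     (\<lambda>p f. a * X p f + b * Y p f) \<in> horizontal_lie_hull A B g U"
| "X \<in> horizontal_lie_hull A B g U \<Longrightarrow> Y \<in> horizontal_lie_hull A B g U \<Longrightarrow>
     lie A X Y \<in> horizontal_lie_hull A B g U"

definition bracket_generating ::
  "('a::topological_space, 'e::euclidean_space) chart set \<Rightarrow> 'e set \<Rightarrow> 'a tensor2 \<Rightarrow> bool" where
  "bracket_generating A B g \<longleftrightarrow>
     (\<forall>p. \<forall>v\<in>tangent A p. \<exists>U X. open U \<and> p \<in> U \<and> X \<in> horizontal_lie_hull A B g U \<and> X p = v)"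

text \<open>
  The transverse flow on the time interval \<open>I\<close>: \<open>\<partial>\<^sub>t g\<^sub>\<H> = h\<close> and \<open>\<partial>\<^sub>t g\<^sub>\<V> = 0\<close>, with the
  splitting \<open>\<H> \<oplus> \<V>\<close> of the initial metric orthogonal at all times.  These equations alone do not
  make \<open>g t\<close> bundle-like for \<open>t \<noteq> 0\<close>; that holds if and only if \<open>g\<^sub>\<H>\<close> evolves through
  holonomy-invariant transverse metrics.
\<close>

definition transverse_flow ::
  "('a::topological_space, 'e::euclidean_space) chart set \<Rightarrow> 'e set \<Rightarrow> real set
     \<Rightarrow> 'a tensor2 \<Rightarrow> (real \<Rightarrow> 'a tensor2) \<Rightarrow> (real \<Rightarrow> 'a tensor2) \<Rightarrow> bool" where
  "transverse_flow A B I g0 h g \<longleftrightarrow>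
     g 0 = g0 \<and>
     (\<forall>t\<in>I. riemannian_metric A (g t)) \<and>
     (\<forall>t\<in>I. \<forall>p. \<forall>u\<in>horiz A B g0 p. \<forall>v\<in>horiz A B g0 p.
        ((\<lambda>s. g s p u v) has_real_derivative h t p u v) (at t within I)) \<and>
     (\<forall>t\<in>I. \<forall>p. \<forall>u\<in>vert A B p. \<forall>v\<in>vert A B p.
        ((\<lambda>s. g s p u v) has_real_derivative 0) (at t within I)) \<and>
     (\<forall>t\<in>I. \<forall>p. \<forall>u\<in>horiz A B g0 p. \<forall>v\<in>vert A B p. g t p u v = 0)"

definition local_orthonormal_frame ::
  "('a::topological_space, 'e::euclidean_space) chart set \<Rightarrow> 'e set \<Rightarrow> 'a tensor2 \<Rightarrow> 'a set
     \<Rightarrow> nat \<Rightarrow> nat \<Rightarrow> (nat \<Rightarrow> 'a vfield) \<Rightarrow> (nat \<Rightarrow> 'a vfield) \<Rightarrow> bool" where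
  "local_orthonormal_frame A B g U n m X Z \<longleftrightarrow>
     open U \<and>
     (\<forall>i<n. horizontal_field A B g U (X i)) \<and>
     (\<forall>j<m. vertical_field A B U (Z j)) \<and>
     (\<forall>p\<in>U. \<forall>i<n. \<forall>k<n. g p (X i p) (X k p) = (if i = k then 1 else 0)) \<and>
     (\<forall>p\<in>U. \<forall>j<m. \<forall>k<m. g p (Z j p) (Z k p) = (if j = k then 1 else 0)) \<and>
     (\<forall>p\<in>U. \<forall>v\<in>horiz A B g p. \<exists>c. v = (\<lambda>f. \<Sum>i<n. c i * X i p f)) \<and>
     (\<forall>p\<in>U. \<forall>v\<in>vert A B p. \<exists>c. v = (\<lambda>f. \<Sum>j<m. c j * Z j p f))"

section \<open>The Bott connection and the operators acting on one-forms\<close>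

text \<open>
  One-forms are treated as maps from vector fields to functions, which avoids extending
  tangent vectors to vector fields.
\<close>

type_synonym 'a form1 = "'a vfield \<Rightarrow> 'a \<Rightarrow> real"

definition differential :: "('a \<Rightarrow> real) \<Rightarrow> 'a form1" where
  "differential f = (\<lambda>Y p. Y p f)"

locale bott_calculus =
  fixes A :: "('a::topological_space, 'e::euclidean_space) chart set"
    and B :: "'e set"
    and g :: "'a tensor2"
    and D :: "'a vfield \<Rightarrow> 'a vfield \<Rightarrow> 'a vfield" \<comment> \<open>Levi-Civita connection of \<open>g\<close>\<close>
    and n m :: nat
    and X Z :: "nat \<Rightarrow> 'a vfield" \<comment> \<open>local orthonormal horizontal and vertical frames\<close>
begin

definition vpart :: "'a vfield \<Rightarrow> 'a vfield" where
  "vpart Y p = (THE w. w \<in> vert A B p \<and> (\<lambda>f. Y p f - w f) \<in> horiz A B g p)"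

definition hpart :: "'a vfield \<Rightarrow> 'a vfield" where
  "hpart Y p = (THE w. w \<in> horiz A B g p \<and> (\<lambda>f. Y p f - w f) \<in> vert A B p)"

definition nabla :: "'a vfield \<Rightarrow> 'a vfield \<Rightarrow> 'a vfield" where
  "nabla V W = (\<lambda>p f.
     hpart (D (hpart V) (hpart W)) p f + hpart (lie A (vpart V) (hpart W)) p f +
     vpart (lie A (hpart V) (vpart W)) p f + vpart (D (vpart V) (vpart W)) p f)"

definition torsion :: "'a vfield \<Rightarrow> 'a vfield \<Rightarrow> 'a vfield" where
  "torsion V W = (\<lambda>p f. nabla V W p f - nabla W V p f - lie A V W p f)"

definition nabla_torsion :: "'a vfield \<Rightarrow> 'a vfield \<Rightarrow> 'a vfield \<Rightarrow> 'a vfield" where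
  "nabla_torsion Y V W = (\<lambda>p f.
     nabla Y (torsion V W) p f - torsion (nabla Y V) W p f - torsion V (nabla Y W) p f)"

definition curvature :: "'a vfield \<Rightarrow> 'a vfield \<Rightarrow> 'a vfield \<Rightarrow> 'a vfield" where
  "curvature V W Y = (\<lambda>p f.
     nabla V (nabla W Y) p f - nabla W (nabla V Y) p f - nabla (lie A V W) Y p f)"

definition Ric :: "'a vfield \<Rightarrow> 'a vfield \<Rightarrow> 'a \<Rightarrow> real" where
  "Ric V W p = (\<Sum>i<n. g p (curvature (X i) V W p) (X i p)) +
               (\<Sum>j<m. g p (curvature (Z j) V W p) (Z j p))"

text \<open>
  \<open>J_map V W\<close> is \<open>J\<^sub>V W\<close>.  The projections implement the extension by \<open>0\<close> in both arguments.
\<close>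

definition J_map :: "'a vfield \<Rightarrow> 'a vfield \<Rightarrow> 'a vfield" where
  "J_map V W p = (THE y. y \<in> horiz A B g p \<and>
     (\<forall>U Y. open U \<longrightarrow> p \<in> U \<longrightarrow> horizontal_field A B g U Y \<longrightarrow>
        g p y (Y p) = g p (vpart V p) (torsion (hpart W) Y p)))"

definition J_sq :: "'a vfield \<Rightarrow> 'a vfield" where
  "J_sq W = (\<lambda>p f. \<Sum>j<m. J_map (Z j) (J_map (Z j) W) p f)"

text \<open>
  Sign of the horizontal divergence of the torsion: the formula \<open>d L = \<box>\<^sub>\<epsilon> d\<close> with
  \<open>+ (1/\<epsilon>) \<delta>\<^sub>\<H> T\<close> in \<open>\<box>\<^sub>\<epsilon>\<close> requires \<open>\<delta>\<^sub>\<H> T(W) = + \<Sum>\<^sub>i (\<nabla>\<^sub>X\<^sub>i T)(X\<^sub>i, W)\<close>.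
  With a minus sign in this definition it fails for every foliation with \<open>\<delta>\<^sub>\<H> T \<noteq> 0\<close>, e.g. on
  \<open>\<real>\<^sup>3\<close> with orthonormal frame \<open>\<partial>\<^sub>x, \<partial>\<^sub>y + a(x) \<partial>\<^sub>z, \<partial>\<^sub>z\<close> and \<open>a'\<close> not constant.
\<close>

definition delta_T :: "'a vfield \<Rightarrow> 'a vfield" where
  "delta_T W = (\<lambda>p f. \<Sum>i<n. nabla_torsion (X i) (X i) W p f)"

definition T_eps :: "real \<Rightarrow> 'a vfield \<Rightarrow> 'a vfield \<Rightarrow> 'a vfield" where
  "T_eps \<epsilon> V W = (\<lambda>p f. torsion V W p f - 1 / \<epsilon> * J_map W V p f)"

definition hor_laplacian :: "('a \<Rightarrow> real) \<Rightarrow> 'a \<Rightarrow> real" where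
  "hor_laplacian u p = (\<Sum>i<n. X i p (\<lambda>q. X i q u) - nabla (X i) (X i) p u)"

subsection \<open>Musical isomorphism and inner products of one-forms\<close>

definition hsharp :: "'a form1 \<Rightarrow> 'a vfield" where
  "hsharp \<eta> = (\<lambda>p f. \<Sum>i<n. \<eta> (X i) p * X i p f)"

definition vsharp :: "'a form1 \<Rightarrow> 'a vfield" where
  "vsharp \<eta> = (\<lambda>p f. \<Sum>j<m. \<eta> (Z j) p * Z j p f)"

definition sharp :: "'a form1 \<Rightarrow> 'a vfield" where
  "sharp \<eta> = (\<lambda>p f. hsharp \<eta> p f + vsharp \<eta> p f)"

definition flat :: "'a vfield \<Rightarrow> 'a form1" where
  "flat V = (\<lambda>Y p. g p (V p) (Y p))"

definition inner_H :: "'a form1 \<Rightarrow> 'a form1 \<Rightarrow> 'a \<Rightarrow> real" where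
  "inner_H \<alpha> \<beta> p = (\<Sum>i<n. \<alpha> (X i) p * \<beta> (X i) p)"

definition inner_V :: "'a form1 \<Rightarrow> 'a form1 \<Rightarrow> 'a \<Rightarrow> real" where
  "inner_V \<alpha> \<beta> p = (\<Sum>j<m. \<alpha> (Z j) p * \<beta> (Z j) p)"

definition inner_eps :: "real \<Rightarrow> 'a form1 \<Rightarrow> 'a form1 \<Rightarrow> 'a \<Rightarrow> real" where
  "inner_eps \<epsilon> \<alpha> \<beta> p = inner_H \<alpha> \<beta> p + \<epsilon> * inner_V \<alpha> \<beta> p"

subsection \<open>Operators on one-forms\<close>

definition nabla_form :: "'a vfield \<Rightarrow> 'a form1 \<Rightarrow> 'a form1" where
  "nabla_form V \<eta> = (\<lambda>Y p. V p (\<eta> Y) - \<eta> (nabla V Y) p)"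

definition T_eps_form :: "real \<Rightarrow> 'a vfield \<Rightarrow> 'a form1 \<Rightarrow> 'a form1" where
  "T_eps_form \<epsilon> V \<eta> = (\<lambda>Y p. - \<eta> (T_eps \<epsilon> V Y) p)"

definition nabla_eps_form :: "real \<Rightarrow> 'a vfield \<Rightarrow> 'a form1 \<Rightarrow> 'a form1" where
  "nabla_eps_form \<epsilon> V \<eta> = (\<lambda>Y p. nabla_form V \<eta> Y p - T_eps_form \<epsilon> V \<eta> Y p)"

definition rough_laplacian :: "real \<Rightarrow> 'a form1 \<Rightarrow> 'a form1" where
  "rough_laplacian \<epsilon> \<eta> = (\<lambda>Y p. \<Sum>i<n.
     nabla_eps_form \<epsilon> (X i) (nabla_eps_form \<epsilon> (X i) \<eta>) Y p -
     nabla_eps_form \<epsilon> (nabla (X i) (X i)) \<eta> Y p)"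

definition J_sq_form :: "'a form1 \<Rightarrow> 'a form1" where
  "J_sq_form \<eta> = flat (J_sq (sharp \<eta>))"

definition delta_T_form :: "'a form1 \<Rightarrow> 'a form1" where
  "delta_T_form \<eta> = flat (delta_T (sharp \<eta>))"

definition Ric_H_form :: "'a form1 \<Rightarrow> 'a form1" where
  "Ric_H_form \<eta> = (\<lambda>Y. Ric (hsharp \<eta>) (hpart Y))"

definition box_eps :: "real \<Rightarrow> 'a form1 \<Rightarrow> 'a form1" where
  "box_eps \<epsilon> \<eta> = (\<lambda>Y p. rough_laplacian \<epsilon> \<eta> Y p - 1 / \<epsilon> * J_sq_form \<eta> Y p
                    + 1 / \<epsilon> * delta_T_form \<eta> Y p - Ric_H_form \<eta> Y p)"

definition nabla_sym :: "'a form1 \<Rightarrow> 'a vfield \<Rightarrow> 'a vfield \<Rightarrow> 'a \<Rightarrow> real" where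
  "nabla_sym \<eta> V W p = (nabla_form V \<eta> W p + nabla_form W \<eta> V p) / 2"

definition trace_nabla_sym :: "'a form1 \<Rightarrow> 'a \<Rightarrow> real" where
  "trace_nabla_sym \<eta> p = (\<Sum>i<n. nabla_sym \<eta> (X i) (X i) p)"

definition trace_J_sq :: "'a form1 \<Rightarrow> 'a \<Rightarrow> real" where
  "trace_J_sq \<eta> p = (\<Sum>i<n. g p (J_map (vsharp \<eta>) (J_map (vsharp \<eta>) (X i)) p) (X i p))"

end

end

theory Submission
  imports Defs
begin

text \<open>
  Write \<open>H(V, W) = V W f - (\<nabla>\<^sub>V W) f\<close> for the Hessian of \<open>f\<close> under the Bott connection, so that
  \<open>H(V, W) + df(T(V, W)) = H(W, V)\<close>.  Then \<open>(\<nabla>\<^sub>V - \<TT>\<^sup>\<epsilon>\<^sub>V) df (Y) = H(Y, V) - (1/\<epsilon>) df(J\<^sub>Y V)\<close>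
  for horizontal \<open>V\<close> and arbitrary \<open>Y\<close>.  In \<open>\<box>\<^sub>\<epsilon> df (Y)\<close> all terms with \<open>1/\<epsilon>\<close> cancel, and what is left is
  \<open>\<Sum>\<^sub>i X\<^sub>i H(Y, X\<^sub>i) - H(\<nabla>\<^sub>i Y, X\<^sub>i) - H(Y, \<nabla>\<^sub>i X\<^sub>i) + H(T(X\<^sub>i, Y), X\<^sub>i)\<close> minus the Ricci term.  Commuting the
  derivatives turns this into \<open>Y(L f)\<close>; here the Ricci curvature enters through the first Bianchi
  identity, which has no torsion terms modulo vertical vectors because the torsion is vertical.

  For the inequality, \<open>L\<close> of the squared length of \<open>df\<close> is compared with \<open>\<box>\<^sub>\<epsilon> df = dLf\<close>.  The mixed
  terms \<open>\<epsilon> H(X\<^sub>i, Z\<^sub>j)\<^sup>2 - 2 t\<^sub>i\<^sub>j H(X\<^sub>i, Z\<^sub>j)\<close> are bounded below by \<open>- t\<^sub>i\<^sub>j\<^sup>2 / \<epsilon>\<close>, where \<open>t\<^sub>i\<^sub>j\<close>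
  is the \<open>Z\<^sub>j\<close>-component of \<open>T(X\<^sub>i, \<nabla>f)\<close>; this sums to the \<open>\<J>\<^sup>2\<close> term.  The
  horizontal Hessian splits into its symmetric part, whose square dominates \<open>1/n\<close> times the squared trace, and its antisymmetric part \<open>- df(T)/2\<close>, which gives the trace of \<open>\<J>\<^sub>\<eta>\<^sup>2\<close>.

  Parallelism of the metric under the Bott connection needs the metric to be holonomy
  invariant, tested on projected coordinate fields, and the leaves to be totally geodesic.  The
  latter is a condition on the vertical metric and the horizontal bundle only, so it persists in time.
\<close>

section \<open>Smooth functions on Euclidean spaces\<close>

text \<open>No frame is made parallel or normal at a point, and no vector is extended to a field.
  Everything is expanded in the given orthonormal frame, and the connection coefficients left behind
  cancel because they form a skew matrix contracted with something symmetric. Pointwise dependence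
  on a field is expressed as linearity over the smooth functions of the patch.

  The terms with \<open>1 / \<epsilon>\<close> cancel for three separate reasons: \<open>J_Y\<close>
  is skew, which removes its pairing with the symmetrised Hessian; the covariant derivative of
  \<open>J\<close> is dual to that of the torsion, which gives the divergence term; and
  \<open>J\<close> with a torsion subscript reproduces \<open>J_sq\<close>. A term with
  \<open>1 / \<epsilon>\<^sup>2\<close> is absent because \<open>J_V\<close> vanishes for horizontal
  \<open>V\<close>.

  The Ricci term rests on the pair symmetry of the curvature for horizontal arguments; a vertical
  direction is treated separately, and there the curvature of the horizontal bundle vanishes.

  The bundle-like condition speaks only of foliate fields, whereas the frame fields need not be
  foliate. It is therefore converted into the vanishing of a tensor, the Lie derivative of the
  horizontal metric along vertical fields.\<close>

lemma frechet_derivative_apply: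
  "(f has_derivative F) (at x) \<Longrightarrow> frechet_derivative f (at x) v = F v"
  by (metis frechet_derivative_at)

lemma cont_diff_cong:
  assumes "open S" "\<And>x. x \<in> S \<Longrightarrow> f x = h x" "cont_diff k S f"
  shows "cont_diff k S h"
  using assms(2,3)
proof (induction k arbitrary: f h)
  case 0
  then show ?case using continuous_on_cong[of S S f h] by simp
next
  case (Suc k)
  have fd: "frechet_derivative f (at x) = frechet_derivative h (at x)" if "x \<in> S" for x
    using frechet_derivative_transform_within_open[of f x S h] Suc.prems assms(1) that by auto
  have "h differentiable (at x)" if "x \<in> S" for x
  proof -
    have "(f has_derivative frechet_derivative f (at x)) (at x)"
      using Suc.prems that frechet_derivative_works by auto
    then have "(h has_derivative frechet_derivative f (at x)) (at x)"
      using has_derivative_transform_within_open[OF _ assms(1) that] Suc.prems(1) by blast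
    then show ?thesis unfolding differentiable_def by blast
  qed
  moreover have "cont_diff k S (\<lambda>x. frechet_derivative h (at x) v)" for v
    using Suc.IH[of "\<lambda>x. frechet_derivative f (at x) v"] Suc.prems(2) fd by auto
  ultimately show ?case by simp
qed

lemma cont_diff_SucD: "cont_diff (Suc k) S f \<Longrightarrow> cont_diff k S f"
proof (induction k arbitrary: f)
  case 0
  then show ?case
    by (auto intro!: continuous_at_imp_continuous_on differentiable_imp_continuous_within)
next
  case (Suc k)
  then show ?case by simp
qed

text \<open>The derivatives are taken \<open>at x\<close> and not within the set, so shrinking the
  set requires no openness.\<close>

lemma cont_diff_subset: "cont_diff k S f \<Longrightarrow> T \<subseteq> S \<Longrightarrow> cont_diff k T f"
proof (induction k arbitrary: f)
  case 0
  then show ?case by (auto intro: continuous_on_subset)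
next
  case (Suc k)
  then show ?case by auto
qed

lemma cont_diff_const: "cont_diff k S (\<lambda>_. c)"
  by (induction k arbitrary: c) auto

lemma cont_diff_add:
  assumes "open S"
  shows "cont_diff k S f \<Longrightarrow> cont_diff k S h \<Longrightarrow> cont_diff k S (\<lambda>x. f x + h x)"
proof (induction k arbitrary: f h)
  case 0
  then show ?case by (auto intro: continuous_intros)
next
  case (Suc k)
  have eq: "frechet_derivative (\<lambda>x. f x + h x) (at x) v
      = frechet_derivative f (at x) v + frechet_derivative h (at x) v" if "x \<in> S" for x v
  proof -
    have "((\<lambda>x. f x + h x) has_derivative
        (\<lambda>v. frechet_derivative f (at x) v + frechet_derivative h (at x) v)) (at x)"
      using Suc.prems that by (intro has_derivative_add) (auto simp: frechet_derivative_works)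
    from frechet_derivative_apply[OF this, of v] show ?thesis by simp
  qed
  have "cont_diff k S (\<lambda>x. frechet_derivative (\<lambda>x. f x + h x) (at x) v)" for v
    by (rule cont_diff_cong[OF assms, of "\<lambda>x. frechet_derivative f (at x) v + frechet_derivative h (at x) v"])
      (use Suc in \<open>auto simp: eq\<close>)
  then show ?case using Suc.prems by auto
qed

lemma cont_diff_mult:
  assumes "open S"
  shows "cont_diff k S f \<Longrightarrow> cont_diff k S h \<Longrightarrow> cont_diff k S (\<lambda>x. f x * h x)"
proof (induction k arbitrary: f h)
  case 0
  then show ?case by (auto intro: continuous_intros)
next
  case (Suc k)
  have eq: "frechet_derivative (\<lambda>x. f x * h x) (at x) v
      = f x * frechet_derivative h (at x) v + frechet_derivative f (at x) v * h x" if "x \<in> S" for x v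
  proof -
    have "((\<lambda>x. f x * h x) has_derivative
        (\<lambda>v. f x * frechet_derivative h (at x) v + frechet_derivative f (at x) v * h x)) (at x)"
      using Suc.prems that by (intro has_derivative_mult) (auto simp: frechet_derivative_works)
    from frechet_derivative_apply[OF this, of v] show ?thesis by simp
  qed
  have "cont_diff k S (\<lambda>x. frechet_derivative (\<lambda>x. f x * h x) (at x) v)" for v
  proof (rule cont_diff_cong[OF assms])
    show "cont_diff k S (\<lambda>x. f x * frechet_derivative h (at x) v + frechet_derivative f (at x) v * h x)"
      using Suc.prems by (intro cont_diff_add[OF assms] Suc.IH cont_diff_SucD[of k S f] cont_diff_SucD[of k S h]) auto
  qed (simp add: eq)
  then show ?case using Suc.prems by (auto intro: differentiable_mult)
qed

lemma cont_diff_sum: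
  assumes "open S" "finite I" "\<And>i. i \<in> I \<Longrightarrow> cont_diff k S (f i)"
  shows "cont_diff k S (\<lambda>x. \<Sum>i\<in>I. f i x)"
  using assms(2,3) by (induction I) (auto intro!: cont_diff_const cont_diff_add[OF assms(1)])

text \<open>The chain rule writes the derivative of the composite as a sum of coordinate derivatives
  of \<open>G\<close> times partial derivatives of \<open>f\<close> composed with \<open>G\<close>.
  These composites have the same shape with one derivative less, so \<open>f\<close> is generalised
  in the induction.\<close>

lemma cont_diff_compose:
  fixes G :: "'e::euclidean_space \<Rightarrow> 'd::euclidean_space"
  assumes "open S" "open T" "G ` S \<subseteq> T"
  shows "(\<And>b. b \<in> Basis \<Longrightarrow> cont_diff k S (\<lambda>x. G x \<bullet> b)) \<Longrightarrow> cont_diff k T f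
    \<Longrightarrow> cont_diff k S (\<lambda>x. f (G x))"
proof (induction k arbitrary: f)
  case 0
  then have "continuous_on S G" by (subst continuous_on_componentwise) auto
  with 0 show ?case using continuous_on_compose2[of T f S G] assms by auto
next
  case (Suc k)
  have G: "G differentiable (at x)" if "x \<in> S" for x
    using Suc.prems(1) that by (subst differentiable_componentwise_within) auto
  have f: "f differentiable (at (G x))" if "x \<in> S" for x
    using Suc.prems(2) that assms by auto
  have D: "((\<lambda>x. f (G x)) has_derivative (\<lambda>v. frechet_derivative f (at (G x)) (frechet_derivative G (at x) v))) (at x)"
    if "x \<in> S" for x
    using diff_chain_at[of G "frechet_derivative G (at x)" x f "frechet_derivative f (at (G x))"]
      G[OF that] f[OF that] by (simp add: frechet_derivative_works o_def)
  have DG: "frechet_derivative G (at x) v \<bullet> b = frechet_derivative (\<lambda>x. G x \<bullet> b) (at x) v"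
    if "x \<in> S" for x v b
  proof -
    have "((\<lambda>x. G x \<bullet> b) has_derivative (\<lambda>v. frechet_derivative G (at x) v \<bullet> b)) (at x)"
      using G[OF that] by (intro has_derivative_inner_left) (simp add: frechet_derivative_works)
    from frechet_derivative_apply[OF this, of v] show ?thesis by simp
  qed
  have eq: "frechet_derivative (\<lambda>x. f (G x)) (at x) v
      = (\<Sum>b\<in>Basis. frechet_derivative (\<lambda>x. G x \<bullet> b) (at x) v * frechet_derivative f (at (G x)) b)"
    if "x \<in> S" for x v
  proof -
    let ?w = "frechet_derivative G (at x) v"
    have lin: "linear (frechet_derivative f (at (G x)))"
      using f[OF that] linear_frechet_derivative by blast
    have "frechet_derivative (\<lambda>x. f (G x)) (at x) v = frechet_derivative f (at (G x)) ?w"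
      using frechet_derivative_apply[OF D[OF that], of v] by simp
    also have "\<dots> = frechet_derivative f (at (G x)) (\<Sum>b\<in>Basis. (?w \<bullet> b) *\<^sub>R b)"
      by (simp add: euclidean_representation)
    also have "\<dots> = (\<Sum>b\<in>Basis. (?w \<bullet> b) * frechet_derivative f (at (G x)) b)"
      using lin by (simp add: linear_sum linear_cmul)
    finally show ?thesis using that by (simp add: DG)
  qed
  have "cont_diff k S (\<lambda>x. frechet_derivative (\<lambda>x. f (G x)) (at x) v)" for v
  proof (rule cont_diff_cong[OF assms(1)])
    show "cont_diff k S (\<lambda>x. \<Sum>b\<in>Basis. frechet_derivative (\<lambda>x. G x \<bullet> b) (at x) v
        * frechet_derivative f (at (G x)) b)"
    proof (intro cont_diff_sum[OF assms(1)] cont_diff_mult[OF assms(1)] finite_Basis)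
      fix b :: 'd assume b: "b \<in> Basis"
      then show "cont_diff k S (\<lambda>x. frechet_derivative (\<lambda>x. G x \<bullet> b) (at x) v)"
        using Suc.prems(1) by simp
      show "cont_diff k S (\<lambda>x. frechet_derivative f (at (G x)) b)"
      proof (rule Suc.IH[of "\<lambda>y. frechet_derivative f (at y) b"])
        show "cont_diff k S (\<lambda>x. G x \<bullet> b')" if "b' \<in> Basis" for b'
          by (rule cont_diff_SucD[OF Suc.prems(1)[OF that]])
        show "cont_diff k T (\<lambda>y. frechet_derivative f (at y) b)" using Suc.prems(2) by simp
      qed
    qed
  qed (simp add: eq)
  moreover have "(\<lambda>x. f (G x)) differentiable (at x)" if "x \<in> S" for x
    using D[OF that] unfolding differentiable_def by blast
  ultimately show ?case by simp
qed

lemma smooth_cong: "open S \<Longrightarrow> (\<And>x. x \<in> S \<Longrightarrow> f x = h x) \<Longrightarrow> smooth S f \<Longrightarrow> smooth S h"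
  unfolding smooth_def using cont_diff_cong by blast

lemma smooth_subset: "smooth S f \<Longrightarrow> T \<subseteq> S \<Longrightarrow> smooth T f"
  unfolding smooth_def using cont_diff_subset by blast

lemma smooth_frechet_derivative:
  assumes "smooth S f" shows "smooth S (\<lambda>x. frechet_derivative f (at x) v)"
  unfolding smooth_def
proof
  fix k
  show "cont_diff k S (\<lambda>x. frechet_derivative f (at x) v)"
    using assms[unfolded smooth_def, rule_format, of "Suc k"] by simp
qed

lemma smooth_differentiable: "smooth S f \<Longrightarrow> x \<in> S \<Longrightarrow> f differentiable (at x)"
  unfolding smooth_def by (drule spec[of _ "Suc 0"]) simp

section \<open>Smooth functions, tangent vectors and vector fields on a manifold\<close>

locale manifold =
  fixes A :: "('a::topological_space, 'e::euclidean_space) chart set"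
  assumes atlas: "smooth_atlas A"
begin

lemma chart:
  assumes "(U, \<phi>) \<in> A"
  shows "open U" "open (\<phi> ` U)" "homeomorphism U (\<phi> ` U) \<phi> (inv_into U \<phi>)" "inj_on \<phi> U"
proof -
  show *: "open U" "open (\<phi> ` U)" "homeomorphism U (\<phi> ` U) \<phi> (inv_into U \<phi>)"
    using atlas assms unfolding smooth_atlas_def by auto
  then show "inj_on \<phi> U" unfolding homeomorphism_def by (metis inj_on_inverseI)
qed

lemma transition_smooth:
  assumes "(U, \<phi>) \<in> A" "(U', \<phi>') \<in> A" "b \<in> Basis"
  shows "smooth (\<phi> ` (U \<inter> U')) (\<lambda>x. \<phi>' (inv_into U \<phi> x) \<bullet> b)"
  using atlas assms unfolding smooth_atlas_def by fast

lemma chart_at: obtains U \<phi> where "(U, \<phi>) \<in> A" "p \<in> U"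
proof -
  have "(\<Union>(U, \<phi>)\<in>A. U) = UNIV" using atlas unfolding smooth_atlas_def by blast
  then have "p \<in> (\<Union>(U, \<phi>)\<in>A. U)" by simp
  then show ?thesis using that by auto
qed

lemma open_chart_image:
  assumes "(U, \<phi>) \<in> A" "open W" shows "open (\<phi> ` (U \<inter> W))"
proof -
  have "openin (top_of_set (\<phi> ` U)) (\<phi> ` (U \<inter> W))"
    using homeomorphism_imp_open_map[OF chart(3)[OF assms(1)], of "U \<inter> W"] assms(2)
    by (simp add: openin_open_Int)
  then show ?thesis using chart(2)[OF assms(1)] openin_open_trans by blast
qed

lemma smooth_fun_open: "smooth_fun A W f \<Longrightarrow> open W"
  unfolding smooth_fun_def by blast

lemma smooth_fun_cong:
  assumes "smooth_fun A W f" "\<And>x. x \<in> W \<Longrightarrow> f x = h x"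
  shows "smooth_fun A W h"
proof -
  have W: "open W" using assms(1) by (rule smooth_fun_open)
  have "smooth (\<phi> ` (U \<inter> W)) (h \<circ> inv_into U \<phi>)" if c: "(U, \<phi>) \<in> A" for U \<phi>
  proof (rule smooth_cong[OF open_chart_image[OF c W]])
    show "smooth (\<phi> ` (U \<inter> W)) (f \<circ> inv_into U \<phi>)"
      using assms(1) c unfolding smooth_fun_def by auto
    show "(f \<circ> inv_into U \<phi>) x = (h \<circ> inv_into U \<phi>) x" if "x \<in> \<phi> ` (U \<inter> W)" for x
      using that assms(2) chart(4)[OF c] by (auto simp: inv_into_f_f)
  qed
  with W show ?thesis unfolding smooth_fun_def by auto
qed

lemma smooth_fun_subset:
  assumes "smooth_fun A W f" "open W'" "W' \<subseteq> W" shows "smooth_fun A W' f"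
  using assms unfolding smooth_fun_def by (fastforce intro: smooth_subset)

lemma smooth_fun_const: "open W \<Longrightarrow> smooth_fun A W (\<lambda>_. c)"
  unfolding smooth_fun_def smooth_def o_def by (auto intro: cont_diff_const)

lemma smooth_fun_add:
  assumes "smooth_fun A W f" "smooth_fun A W h" shows "smooth_fun A W (\<lambda>x. f x + h x)"
  using assms open_chart_image unfolding smooth_fun_def smooth_def o_def
  by (fastforce intro: cont_diff_add)

lemma smooth_fun_mult:
  assumes "smooth_fun A W f" "smooth_fun A W h" shows "smooth_fun A W (\<lambda>x. f x * h x)"
  using assms open_chart_image unfolding smooth_fun_def smooth_def o_def
  by (fastforce intro: cont_diff_mult)

lemma smooth_fun_cmult: "smooth_fun A W f \<Longrightarrow> smooth_fun A W (\<lambda>x. c * f x)"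
  using smooth_fun_mult[OF smooth_fun_const] smooth_fun_open by blast

lemma smooth_fun_diff:
  assumes "smooth_fun A W f" "smooth_fun A W h" shows "smooth_fun A W (\<lambda>x. f x - h x)"
  using smooth_fun_add[OF assms(1) smooth_fun_cmult[OF assms(2), of "-1"]] by simp

lemma smooth_fun_sum:
  assumes "open W" "finite I" "\<And>i. i \<in> I \<Longrightarrow> smooth_fun A W (f i)"
  shows "smooth_fun A W (\<lambda>x. \<Sum>i\<in>I. f i x)"
  using assms(2,3) by (induction I) (auto intro!: smooth_fun_const assms(1) smooth_fun_add)

lemma smooth_near_cong:
  assumes "open W" "p \<in> W" "\<And>x. x \<in> W \<Longrightarrow> f x = h x" "smooth_near A p f"
  shows "smooth_near A p h"
proof -
  obtain W' where W': "p \<in> W'" "smooth_fun A W' f" using assms(4) unfolding smooth_near_def by blast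
  have "smooth_fun A (W \<inter> W') f"
    using W' assms(1) smooth_fun_open by (blast intro: smooth_fun_subset open_Int)
  then have "smooth_fun A (W \<inter> W') h" using assms(3) by (blast intro: smooth_fun_cong)
  then show ?thesis using W'(1) assms(2) unfolding smooth_near_def by blast
qed

lemma smooth_nearI: "smooth_fun A W f \<Longrightarrow> p \<in> W \<Longrightarrow> smooth_near A p f"
  unfolding smooth_near_def by blast

lemma smooth_near_const: "smooth_near A p (\<lambda>_. c)"
  by (rule smooth_nearI[OF smooth_fun_const[OF open_UNIV]]) simp

lemma smooth_near_common:
  assumes "smooth_near A p f" "smooth_near A p h"
  obtains W where "p \<in> W" "smooth_fun A W f" "smooth_fun A W h"
proof -
  obtain W W' where W: "p \<in> W" "smooth_fun A W f" "p \<in> W'" "smooth_fun A W' h"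
    using assms unfolding smooth_near_def by blast
  then have "open (W \<inter> W')" using smooth_fun_open by (blast intro: open_Int)
  then show ?thesis
    using that[of "W \<inter> W'"] W smooth_fun_subset[of W f "W \<inter> W'"] smooth_fun_subset[of W' h "W \<inter> W'"]
    by auto
qed

lemma smooth_near_add: "smooth_near A p f \<Longrightarrow> smooth_near A p h \<Longrightarrow> smooth_near A p (\<lambda>x. f x + h x)"
  by (erule (1) smooth_near_common) (rule smooth_nearI[OF smooth_fun_add])

lemma smooth_near_mult: "smooth_near A p f \<Longrightarrow> smooth_near A p h \<Longrightarrow> smooth_near A p (\<lambda>x. f x * h x)"
  by (erule (1) smooth_near_common) (rule smooth_nearI[OF smooth_fun_mult])

lemma smooth_near_diff: "smooth_near A p f \<Longrightarrow> smooth_near A p h \<Longrightarrow> smooth_near A p (\<lambda>x. f x - h x)"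
  by (erule (1) smooth_near_common) (rule smooth_nearI[OF smooth_fun_diff])

context
  fixes p v assumes v: "v \<in> tangent A p"
begin

lemma tangent_lin:
  "smooth_near A p f \<Longrightarrow> smooth_near A p h \<Longrightarrow> v (\<lambda>x. a * f x + b * h x) = a * v f + b * v h"
  using v unfolding tangent_def by blast

lemma tangent_mult:
  "smooth_near A p f \<Longrightarrow> smooth_near A p h \<Longrightarrow> v (\<lambda>x. f x * h x) = f p * v h + h p * v f"
  using v unfolding tangent_def by blast

lemma tangent_nonsmooth: "\<not> smooth_near A p f \<Longrightarrow> v f = 0"
  using v unfolding tangent_def by blast

lemma tangent_add:
  "smooth_near A p f \<Longrightarrow> smooth_near A p h \<Longrightarrow> v (\<lambda>x. f x + h x) = v f + v h"
  using tangent_lin[of f h 1 1] by simp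

lemma tangent_diff:
  "smooth_near A p f \<Longrightarrow> smooth_near A p h \<Longrightarrow> v (\<lambda>x. f x - h x) = v f - v h"
  using tangent_lin[of f h 1 "-1"] by simp

lemma tangent_const: "v (\<lambda>_. c) = 0"
proof -
  have "v (\<lambda>x. 1 * 1) = 1 * v (\<lambda>_. 1) + 1 * v (\<lambda>_. 1)"
    by (rule tangent_mult) (rule smooth_near_const)+
  then have "v (\<lambda>_. 1) = 0" by simp
  moreover have "v (\<lambda>x. c * 1 + 0 * 1) = c * v (\<lambda>_. 1) + 0 * v (\<lambda>_. 1)"
    by (rule tangent_lin) (rule smooth_near_const)+
  ultimately show ?thesis by simp
qed

lemma tangent_cmult: "smooth_near A p f \<Longrightarrow> v (\<lambda>x. c * f x) = c * v f"
  using tangent_lin[of f f c 0] by simp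

text \<open>Locality: a function vanishing on \<open>W\<close> is its own product with the indicator of \<open>- W\<close>.\<close>

lemma tangent_cong:
  assumes W: "open W" "p \<in> W" and eq: "\<And>x. x \<in> W \<Longrightarrow> f x = h x"
  shows "v f = v h"
proof (cases "smooth_near A p f")
  case True
  then have h: "smooth_near A p h" by (rule smooth_near_cong[OF W eq, rotated])
  define c where "c x = (if x \<in> W then 0 else 1 :: real)" for x
  have c: "smooth_near A p c"
    by (rule smooth_near_cong[OF W _ smooth_near_const[of p 0]]) (simp add: c_def)
  have fh: "smooth_near A p (\<lambda>x. f x - h x)" by (rule smooth_near_diff[OF True h])
  have "v (\<lambda>x. (f x - h x) * c x) = (f p - h p) * v c + c p * v (\<lambda>x. f x - h x)"
    by (rule tangent_mult[OF fh c])
  moreover have "(\<lambda>x. (f x - h x) * c x) = (\<lambda>x. f x - h x)"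
    using eq by (auto simp: c_def)
  ultimately have "v (\<lambda>x. f x - h x) = 0" using W eq by (simp add: c_def)
  then show ?thesis using tangent_diff[OF True h] by simp
next
  case False
  then have "\<not> smooth_near A p h" using smooth_near_cong[OF W, of h f] eq by fastforce
  then show ?thesis using False tangent_nonsmooth by simp
qed

end

lemma tangent_combine:
  assumes "u \<in> tangent A p" "v \<in> tangent A p"
  shows "(\<lambda>f. a * u f + b * v f) \<in> tangent A p"
  unfolding tangent_def
proof (safe)
  fix f h c d assume s: "smooth_near A p f" "smooth_near A p h"
  show "a * u (\<lambda>x. c * f x + d * h x) + b * v (\<lambda>x. c * f x + d * h x)
      = c * (a * u f + b * v f) + d * (a * u h + b * v h)"
    using tangent_lin[OF assms(1) s] tangent_lin[OF assms(2) s] by (simp add: algebra_simps)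
  show "a * u (\<lambda>x. f x * h x) + b * v (\<lambda>x. f x * h x)
      = f p * (a * u h + b * v h) + h p * (a * u f + b * v f)"
    using tangent_mult[OF assms(1) s] tangent_mult[OF assms(2) s] by (simp add: algebra_simps)
next
  fix f assume "\<not> smooth_near A p f"
  then show "a * u f + b * v f = 0"
    by (simp add: tangent_nonsmooth[OF assms(1)] tangent_nonsmooth[OF assms(2)])
qed

lemma tangent_zero: "(\<lambda>_. 0) \<in> tangent A p"
  unfolding tangent_def by auto

lemma tangent_sum:
  assumes "finite I" "\<And>i. i \<in> I \<Longrightarrow> v i \<in> tangent A p"
  shows "(\<lambda>k. \<Sum>i\<in>I. c i * v i k) \<in> tangent A p"
  using assms
proof (induction I)
  case empty
  then show ?case by (simp add: tangent_zero)
next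
  case (insert i I)
  then show ?case using tangent_combine[of "v i" p "\<lambda>k. \<Sum>i\<in>I. c i * v i k" "c i" 1] by simp
qed

lemma field_tangent: "vector_field A U V \<Longrightarrow> p \<in> U \<Longrightarrow> V p \<in> tangent A p"
  unfolding vector_field_def by blast

lemma field_smooth: "vector_field A U V \<Longrightarrow> W \<subseteq> U \<Longrightarrow> smooth_fun A W f \<Longrightarrow> smooth_fun A W (\<lambda>p. V p f)"
  unfolding vector_field_def by blast

lemma field_subset: "vector_field A U V \<Longrightarrow> W \<subseteq> U \<Longrightarrow> vector_field A W V"
  unfolding vector_field_def by blast

lemma field_smooth_near:
  assumes "open U" "vector_field A U V" "p \<in> U" "smooth_near A p f"
  shows "smooth_near A p (\<lambda>q. V q f)"
proof -
  obtain W where W: "p \<in> W" "smooth_fun A W f" using assms(4) unfolding smooth_near_def by blast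
  then have "smooth_fun A (U \<inter> W) f"
    using assms(1) smooth_fun_open by (blast intro: smooth_fun_subset)
  then have "smooth_fun A (U \<inter> W) (\<lambda>q. V q f)" using field_smooth[OF assms(2)] by blast
  then show ?thesis using W assms(3) by (blast intro: smooth_nearI)
qed

lemma field_cong:
  assumes "vector_field A U V" "\<And>p. p \<in> U \<Longrightarrow> V p = W p"
  shows "vector_field A U W"
  unfolding vector_field_def
proof (intro conjI ballI allI impI)
  show "W p \<in> tangent A p" if "p \<in> U" for p using that assms by (metis field_tangent)
  show "smooth_fun A W' (\<lambda>p. W p f)" if "W' \<subseteq> U" "smooth_fun A W' f" for W' f
    using smooth_fun_cong[OF field_smooth[OF assms(1) that]] assms(2) that(1) by (metis subsetD)
qed

lemma field_lin:
  assumes "smooth_fun A U u" "vector_field A U V" "vector_field A U W"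
  shows "vector_field A U (\<lambda>q k. u q * V q k + W q k)"
  unfolding vector_field_def
proof (intro conjI ballI allI impI)
  show "(\<lambda>k. u p * V p k + W p k) \<in> tangent A p" if "p \<in> U" for p
    using tangent_combine[of "V p" p "W p" "u p" 1] field_tangent[OF _ that] assms by simp
  show "smooth_fun A W' (\<lambda>p. u p * V p f + W p f)" if "W' \<subseteq> U" "smooth_fun A W' f" for W' f
    using that assms
    by (intro smooth_fun_add smooth_fun_mult field_smooth[OF _ that] smooth_fun_subset[OF assms(1)])
      (auto dest: smooth_fun_open)
qed

lemma field_zero: "vector_field A U (\<lambda>_ _. 0)"
  unfolding vector_field_def using tangent_zero smooth_fun_const smooth_fun_open by blast

lemma field_scale:
  "smooth_fun A U u \<Longrightarrow> vector_field A U V \<Longrightarrow> vector_field A U (\<lambda>q k. u q * V q k)"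
  using field_lin[of U u V "\<lambda>_ _. 0"] field_zero by simp

lemma field_add:
  "open U \<Longrightarrow> vector_field A U V \<Longrightarrow> vector_field A U W \<Longrightarrow> vector_field A U (\<lambda>q k. V q k + W q k)"
  using field_lin[OF smooth_fun_const[of U 1]] by simp

lemma field_cscale:
  "open U \<Longrightarrow> vector_field A U V \<Longrightarrow> vector_field A U (\<lambda>q k. c * V q k)"
  using field_scale[OF smooth_fun_const[of U c]] by simp

lemma field_diff:
  "open U \<Longrightarrow> vector_field A U V \<Longrightarrow> vector_field A U W \<Longrightarrow> vector_field A U (\<lambda>q k. V q k - W q k)"
  using field_add[of U V "\<lambda>q k. -1 * W q k"] field_cscale[of U W "-1"] by simp

lemma field_sum:
  assumes "open U" "finite I" "\<And>i. i \<in> I \<Longrightarrow> vector_field A U (V i)"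
  shows "vector_field A U (\<lambda>q k. \<Sum>i\<in>I. V i q k)"
  using assms(2,3) by (induction I) (auto intro!: field_zero field_add[OF assms(1)])

lemma field_lin_sum:
  assumes "open U" "finite I" "\<And>i. i \<in> I \<Longrightarrow> smooth_fun A U (c i)" "\<And>i. i \<in> I \<Longrightarrow> vector_field A U (V i)"
  shows "vector_field A U (\<lambda>q k. \<Sum>i\<in>I. c i q * V i q k)"
  using assms by (intro field_sum field_scale) auto

lemma lie_eq:
  "smooth_near A p k \<Longrightarrow> lie A V W p k = V p (\<lambda>q. W q k) - W p (\<lambda>q. V q k)"
  by (simp add: lie_def)

lemma lie_antisym: "lie A V W p k = - lie A W V p k"
  by (simp add: lie_def)

context
  fixes U :: "'a set" assumes U: "open U"
begin

text \<open>The mixed Leibniz terms \<open>W f * V h + V f * W h\<close> are symmetric in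
  \<open>V\<close> and \<open>W\<close> and cancel in the commutator. The rules for the inner field
  hold only where \<open>f\<close> and \<open>h\<close> are smooth, hence the passage to a
  neighbourhood inside the outer derivation.\<close>

lemma lie_tangent:
  assumes V: "vector_field A U V" and W: "vector_field A U W" and p: "p \<in> U"
  shows "lie A V W p \<in> tangent A p"
  unfolding tangent_def
proof (safe)
  note tV = field_tangent[OF V p] and tW = field_tangent[OF W p]
  fix f h a b assume f: "smooth_near A p f" and h: "smooth_near A p h"
  obtain N where N: "p \<in> N" "smooth_fun A N f" "smooth_fun A N h"
    using smooth_near_common[OF f h] by blast
  then have oN: "open (U \<inter> N)" using U smooth_fun_open by blast
  have near: "smooth_near A q f" "smooth_near A q h" if "q \<in> U \<inter> N" for q
    using that N by (auto intro: smooth_nearI)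
  note s = field_smooth_near[OF U V p f] field_smooth_near[OF U V p h]
    field_smooth_near[OF U W p f] field_smooth_near[OF U W p h]
  have lin: "v (\<lambda>q. Y q (\<lambda>x. a * f x + b * h x)) = a * v (\<lambda>q. Y q f) + b * v (\<lambda>q. Y q h)"
    if "v \<in> tangent A p" "vector_field A U Y" for v Y
  proof -
    have "v (\<lambda>q. Y q (\<lambda>x. a * f x + b * h x)) = v (\<lambda>q. a * Y q f + b * Y q h)"
      using near tangent_lin[OF field_tangent[OF that(2)]] N p
      by (intro tangent_cong[OF that(1) oN]) auto
    also have "\<dots> = a * v (\<lambda>q. Y q f) + b * v (\<lambda>q. Y q h)"
      by (intro tangent_lin[OF that(1)] field_smooth_near[OF U that(2) p] f h)
    finally show ?thesis .
  qed
  have mult: "v (\<lambda>q. Y q (\<lambda>x. f x * h x)) = f p * v (\<lambda>q. Y q h) + Y p h * v f + (h p * v (\<lambda>q. Y q f) + Y p f * v h)"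
    if "v \<in> tangent A p" "vector_field A U Y" for v Y
  proof -
    note sY = field_smooth_near[OF U that(2) p f] field_smooth_near[OF U that(2) p h]
    have "v (\<lambda>q. Y q (\<lambda>x. f x * h x)) = v (\<lambda>q. f q * Y q h + h q * Y q f)"
      using near tangent_mult[OF field_tangent[OF that(2)]] N p
      by (intro tangent_cong[OF that(1) oN]) auto
    also have "\<dots> = v (\<lambda>q. f q * Y q h) + v (\<lambda>q. h q * Y q f)"
      by (intro tangent_add[OF that(1)] smooth_near_mult f h sY)
    finally show ?thesis by (simp add: tangent_mult[OF that(1)] f h sY)
  qed
  have "smooth_near A p (\<lambda>x. a * f x + b * h x)"
    by (intro smooth_near_add smooth_near_mult smooth_near_const f h)
  then show "lie A V W p (\<lambda>x. a * f x + b * h x) = a * lie A V W p f + b * lie A V W p h"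
    using lin[OF tV W] lin[OF tW V] by (simp add: lie_eq f h algebra_simps)
  have "smooth_near A p (\<lambda>x. f x * h x)" by (intro smooth_near_mult f h)
  then show "lie A V W p (\<lambda>x. f x * h x) = f p * lie A V W p h + h p * lie A V W p f"
    using mult[OF tV W] mult[OF tW V] by (simp add: lie_eq f h algebra_simps)
qed (simp add: lie_def)

lemma lie_field:
  assumes V: "vector_field A U V" and W: "vector_field A U W"
  shows "vector_field A U (lie A V W)"
  unfolding vector_field_def
proof (intro conjI ballI allI impI)
  show "lie A V W p \<in> tangent A p" if "p \<in> U" for p by (rule lie_tangent[OF V W that])
  fix N f assume N: "N \<subseteq> U" "smooth_fun A N f"
  have "smooth_fun A N (\<lambda>p. V p (\<lambda>q. W q f) - W p (\<lambda>q. V q f))"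
    by (intro smooth_fun_diff field_smooth[OF V N(1)] field_smooth[OF W N(1)] N(2))
  then show "smooth_fun A N (\<lambda>p. lie A V W p f)"
    by (rule smooth_fun_cong) (auto simp: lie_eq smooth_nearI[OF N(2)])
qed

lemma lie_cong:
  assumes "vector_field A U V" "vector_field A U W" "p \<in> U"
    and "\<And>q. q \<in> U \<Longrightarrow> V q = V' q" "\<And>q. q \<in> U \<Longrightarrow> W q = W' q"
  shows "lie A V W p = lie A V' W' p"
proof
  fix k
  have "V p (\<lambda>q. W q k) = V p (\<lambda>q. W' q k)"
    using assms by (intro tangent_cong[OF field_tangent[OF assms(1,3)] U assms(3)]) auto
  moreover have "W p (\<lambda>q. V q k) = W p (\<lambda>q. V' q k)"
    using assms by (intro tangent_cong[OF field_tangent[OF assms(2,3)] U assms(3)]) auto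
  ultimately show "lie A V W p k = lie A V' W' p k"
    using assms by (simp add: lie_def)
qed

lemma lie_lin_right:
  assumes V: "vector_field A U V" and W: "vector_field A U W" and W': "vector_field A U W'"
    and u: "smooth_fun A U u" and p: "p \<in> U"
  shows "lie A V (\<lambda>q k. u q * W q k + W' q k) p k
    = u p * lie A V W p k + V p u * W p k + lie A V W' p k"
proof (cases "smooth_near A p k")
  case True
  have un: "smooth_near A p u" using smooth_nearI[OF u p] .
  note s = field_smooth_near[OF U _ p True]
  have "V p (\<lambda>q. u q * W q k + W' q k) = u p * V p (\<lambda>q. W q k) + W p k * V p u + V p (\<lambda>q. W' q k)"
    using tangent_add[OF field_tangent[OF V p] smooth_near_mult[OF un s[OF W]] s[OF W']]
      tangent_mult[OF field_tangent[OF V p] un s[OF W]] by simp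
  then show ?thesis using True by (simp add: lie_eq algebra_simps)
next
  case False
  then show ?thesis using tangent_nonsmooth[OF field_tangent[OF W p]] by (simp add: lie_def)
qed

lemma lie_lin_left:
  assumes V: "vector_field A U V" and W: "vector_field A U W" and W': "vector_field A U W'"
    and u: "smooth_fun A U u" and p: "p \<in> U"
  shows "lie A (\<lambda>q k. u q * W q k + W' q k) V p k
    = u p * lie A W V p k - V p u * W p k + lie A W' V p k"
  using lie_lin_right[OF assms, of k]
    lie_antisym[of "\<lambda>q k. u q * W q k + W' q k" V p k] lie_antisym[of W V p k] lie_antisym[of W' V p k]
  by simp

lemma lie_add_right:
  assumes "vector_field A U V" "vector_field A U W" "vector_field A U W'" "p \<in> U"
  shows "lie A V (\<lambda>q k. W q k + W' q k) p k = lie A V W p k + lie A V W' p k"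
  using lie_lin_right[OF assms(1-3) smooth_fun_const[OF U, of 1] assms(4)]
    tangent_const[OF field_tangent[OF assms(1,4)]] by simp

lemma lie_add_left:
  assumes "vector_field A U V" "vector_field A U W" "vector_field A U W'" "p \<in> U"
  shows "lie A (\<lambda>q k. W q k + W' q k) V p k = lie A W V p k + lie A W' V p k"
  using lie_lin_left[OF assms(1-3) smooth_fun_const[OF U, of 1] assms(4)]
    tangent_const[OF field_tangent[OF assms(1,4)]] by simp

lemma lie_zero: "vector_field A U V \<Longrightarrow> p \<in> U \<Longrightarrow> lie A V (\<lambda>_ _. 0) p k = 0"
  using tangent_const[OF field_tangent] by (simp add: lie_def)

text \<open>By the default value in \<open>lie\<close>, the inner bracket is a commutator only at
  points where \<open>k\<close> is smooth. On a neighbourhood of such points the twelve threefold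
  derivatives cancel.\<close>

lemma lie_jacobi:
  assumes V: "vector_field A U V" and W: "vector_field A U W" and Y: "vector_field A U Y" and p: "p \<in> U"
  shows "lie A V (lie A W Y) p k + lie A W (lie A Y V) p k + lie A Y (lie A V W) p k = 0"
proof (cases "smooth_near A p k")
  case True
  obtain N where N: "p \<in> N" "smooth_fun A N k" using True unfolding smooth_near_def by blast
  have oN: "open (U \<inter> N)" using U N smooth_fun_open by blast
  note s = field_smooth_near[OF U _ p]
  have outer: "V p (\<lambda>q. lie A W Y q k) = V p (\<lambda>q. W q (\<lambda>r. Y r k)) - V p (\<lambda>q. Y q (\<lambda>r. W r k))"
    if "vector_field A U V" "vector_field A U W" "vector_field A U Y" for V W Y
  proof -
    have "V p (\<lambda>q. lie A W Y q k) = V p (\<lambda>q. W q (\<lambda>r. Y r k) - Y q (\<lambda>r. W r k))"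
      using N p by (intro tangent_cong[OF field_tangent[OF that(1) p] oN]) (auto simp: lie_eq smooth_nearI[OF N(2)])
    also have "\<dots> = V p (\<lambda>q. W q (\<lambda>r. Y r k)) - V p (\<lambda>q. Y q (\<lambda>r. W r k))"
      by (rule tangent_diff[OF field_tangent[OF that(1) p] s[OF that(2) s[OF that(3) True]] s[OF that(3) s[OF that(2) True]]])
    finally show ?thesis .
  qed
  show ?thesis
    using outer[OF V W Y] outer[OF W Y V] outer[OF Y V W]
    by (simp add: lie_eq[OF True] lie_eq[OF s[OF V True]] lie_eq[OF s[OF W True]] lie_eq[OF s[OF Y True]])
qed (simp add: lie_def)

end

end

section \<open>The Bott connection over an open set with an adapted orthonormal frame\<close>

lemma levi_civita_torsion_free:
  assumes "levi_civita A g D" "open U" "vector_field A U V" "vector_field A U W" "p \<in> U"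
  shows "D V W p k - D W V p k = lie A V W p k"
  by (rule assms(1)[unfolded levi_civita_def, THEN conjunct2, rule_format,
      OF assms(2-4,4,5), THEN conjunct1, rule_format])

lemma levi_civita_metric:
  assumes "levi_civita A g D" "open U" "vector_field A U V" "vector_field A U Y" "vector_field A U W" "p \<in> U"
  shows "V p (\<lambda>q. g q (Y q) (W q)) = g p (D V Y p) (W p) + g p (Y p) (D V W p)"
  by (rule assms(1)[unfolded levi_civita_def, THEN conjunct2, rule_format, OF assms(2-6), THEN conjunct2])

lemma (in manifold) levi_civita_field:
  assumes "levi_civita A g D" "open U" "vector_field A U V" "vector_field A U W"
  shows "vector_field A U (D V W)"
  by (rule assms(1)[unfolded levi_civita_def affine_connection_def, THEN conjunct1, rule_format,
      OF assms(2-4) field_zero smooth_fun_const[OF assms(2), of 0], THEN conjunct1])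

locale foliated_metric = manifold A
  for A :: "('a::topological_space, 'e::euclidean_space) chart set" +
  fixes B :: "'e set" and g :: "'a tensor2"
  assumes metric: "riemannian_metric A g"
begin

lemma g_tensor: "symmetric_tensor A g"
  using metric unfolding riemannian_metric_def by blast

lemma g_sym: "u \<in> tangent A p \<Longrightarrow> v \<in> tangent A p \<Longrightarrow> g p u v = g p v u"
  using g_tensor[unfolded symmetric_tensor_def, THEN conjunct1] by blast

lemma g_lin_left:
  "u \<in> tangent A p \<Longrightarrow> v \<in> tangent A p \<Longrightarrow> w \<in> tangent A p
    \<Longrightarrow> g p (\<lambda>k. a * u k + b * v k) w = a * g p u w + b * g p v w"
  by (rule g_tensor[unfolded symmetric_tensor_def, THEN conjunct2, THEN conjunct1, rule_format])

lemma g_lin_right: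
  assumes "u \<in> tangent A p" "v \<in> tangent A p" "w \<in> tangent A p"
  shows "g p w (\<lambda>k. a * u k + b * v k) = a * g p w u + b * g p w v"
  using g_lin_left[OF assms] g_sym[OF assms(3)] tangent_combine[OF assms(1,2), of a b] assms
  by simp

lemma metric_smooth:
  "open U \<Longrightarrow> vector_field A U V \<Longrightarrow> vector_field A U W \<Longrightarrow> smooth_fun A U (\<lambda>p. g p (V p) (W p))"
  by (rule g_tensor[unfolded symmetric_tensor_def, THEN conjunct2, THEN conjunct2, rule_format])

lemma g_add_left:
  "u \<in> tangent A p \<Longrightarrow> v \<in> tangent A p \<Longrightarrow> w \<in> tangent A p
    \<Longrightarrow> g p (\<lambda>k. u k + v k) w = g p u w + g p v w"
  using g_lin_left[of u p v w 1 1] by simp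

lemma g_diff_left:
  "u \<in> tangent A p \<Longrightarrow> v \<in> tangent A p \<Longrightarrow> w \<in> tangent A p
    \<Longrightarrow> g p (\<lambda>k. u k - v k) w = g p u w - g p v w"
  using g_lin_left[of u p v w 1 "-1"] by simp

lemma g_add_right:
  "u \<in> tangent A p \<Longrightarrow> v \<in> tangent A p \<Longrightarrow> w \<in> tangent A p
    \<Longrightarrow> g p w (\<lambda>k. u k + v k) = g p w u + g p w v"
  using g_lin_right[of u p v w 1 1] by simp

lemma g_diff_right:
  "u \<in> tangent A p \<Longrightarrow> v \<in> tangent A p \<Longrightarrow> w \<in> tangent A p
    \<Longrightarrow> g p w (\<lambda>k. u k - v k) = g p w u - g p w v"
  using g_lin_right[of u p v w 1 "-1"] by simp

lemma g_zero_left: "w \<in> tangent A p \<Longrightarrow> g p (\<lambda>_. 0) w = 0"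
  using g_lin_left[of w p w w 0 0] by simp

lemma g_zero_right: "w \<in> tangent A p \<Longrightarrow> g p w (\<lambda>_. 0) = 0"
  using g_lin_right[of w p w w 0 0] by simp

lemma g_sum_left:
  assumes "finite I" "\<And>i. i \<in> I \<Longrightarrow> v i \<in> tangent A p" "w \<in> tangent A p"
  shows "g p (\<lambda>k. \<Sum>i\<in>I. c i * v i k) w = (\<Sum>i\<in>I. c i * g p (v i) w)"
  using assms(1,2)
proof (induction I)
  case empty
  then show ?case by (simp add: g_zero_left assms(3))
next
  case (insert i I)
  have "(\<lambda>k. \<Sum>i\<in>I. c i * v i k) \<in> tangent A p" using insert by (intro tangent_sum) auto
  then show ?case
    using insert g_lin_left[of "v i" p "\<lambda>k. \<Sum>i\<in>I. c i * v i k" w "c i" 1] assms(3) by simp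
qed

lemma g_sum_right:
  assumes "finite I" "\<And>i. i \<in> I \<Longrightarrow> v i \<in> tangent A p" "w \<in> tangent A p"
  shows "g p w (\<lambda>k. \<Sum>i\<in>I. c i * v i k) = (\<Sum>i\<in>I. c i * g p w (v i))"
proof -
  have "g p w (\<lambda>k. \<Sum>i\<in>I. c i * v i k) = g p (\<lambda>k. \<Sum>i\<in>I. c i * v i k) w"
    using assms by (intro g_sym tangent_sum) auto
  also have "\<dots> = (\<Sum>i\<in>I. c i * g p (v i) w)" by (rule g_sum_left[OF assms])
  also have "\<dots> = (\<Sum>i\<in>I. c i * g p w (v i))" using assms by (intro sum.cong) (auto simp: g_sym)
  finally show ?thesis .
qed

lemma horiz_tangent: "v \<in> horiz A B g p \<Longrightarrow> v \<in> tangent A p"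
  unfolding horiz_def by blast

lemma vert_tangent: "v \<in> vert A B p \<Longrightarrow> v \<in> tangent A p"
  unfolding vert_def by blast

lemma horiz_vert: "v \<in> horiz A B g p \<Longrightarrow> w \<in> vert A B p \<Longrightarrow> g p v w = 0"
  unfolding horiz_def by blast

lemma vert_horiz: "v \<in> horiz A B g p \<Longrightarrow> w \<in> vert A B p \<Longrightarrow> g p w v = 0"
  using horiz_vert g_sym horiz_tangent vert_tangent by metis

lemma horiz_sum:
  assumes "finite I" "\<And>i. i \<in> I \<Longrightarrow> v i \<in> horiz A B g p"
  shows "(\<lambda>k. \<Sum>i\<in>I. c i * v i k) \<in> horiz A B g p"
  unfolding horiz_def mem_Collect_eq
  using assms by (intro conjI ballI) (auto intro!: tangent_sum simp: horiz_tangent g_sum_left vert_tangent horiz_vert)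

lemma vert_sum:
  assumes "finite I" "\<And>i. i \<in> I \<Longrightarrow> v i \<in> vert A B p"
  shows "(\<lambda>k. \<Sum>i\<in>I. c i * v i k) \<in> vert A B p"
proof -
  have "(\<lambda>k. \<Sum>i\<in>I. c i * v i k) \<in> tangent A p"
    using assms by (intro tangent_sum) (auto simp: vert_tangent)
  moreover have "v i (\<lambda>q. \<phi> q \<bullet> b) = 0" if "(U', \<phi>) \<in> A" "p \<in> U'" "b \<in> B" "i \<in> I" for U' \<phi> b i
    using assms(2)[OF that(4)] that(1-3) unfolding vert_def by blast
  ultimately show ?thesis unfolding vert_def by (auto intro!: sum.neutral)
qed

end

text \<open>The connection \<open>D\<close> is not constrained here; it only occurs as a parameter of \<open>bott_calculus\<close>.\<close>

locale framed_foliation = bott_calculus A B g D n m X Z + foliated_metric A B g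
  for A :: "('a::topological_space, 'e::euclidean_space) chart set"
    and B :: "'e set"
    and g :: "'a tensor2"
    and D :: "'a vfield \<Rightarrow> 'a vfield \<Rightarrow> 'a vfield"
    and n m :: nat
    and X Z :: "nat \<Rightarrow> 'a vfield" +
  fixes U :: "'a set"
  assumes frame: "local_orthonormal_frame A B g U n m X Z"
begin

abbreviation "VF \<equiv> vector_field A U"
abbreviation "SF \<equiv> smooth_fun A U"
abbreviation "HF \<equiv> horizontal_field A B g U"
abbreviation "VertF \<equiv> vertical_field A B U"

lemma U: "open U"
  using frame unfolding local_orthonormal_frame_def by blast

lemma restrict_frame:
  assumes "open U'" "U' \<subseteq> U"
  shows "framed_foliation A B g n m X Z U'"
proof (intro framed_foliation.intro framed_foliation_axioms.intro)
  show "local_orthonormal_frame A B g U' n m X Z"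
    using frame assms unfolding local_orthonormal_frame_def horizontal_field_def vertical_field_def
    by (meson field_subset subsetD)
qed (fact foliated_metric_axioms)

lemma g_smooth: "VF V \<Longrightarrow> VF W \<Longrightarrow> SF (\<lambda>p. g p (V p) (W p))"
  by (rule metric_smooth[OF U])

lemma HF_VF: "HF V \<Longrightarrow> VF V" and VertF_VF: "VertF V \<Longrightarrow> VF V"
  by (auto simp: horizontal_field_def vertical_field_def)

lemma HF_at: "HF V \<Longrightarrow> p \<in> U \<Longrightarrow> V p \<in> horiz A B g p" and VertF_at: "VertF V \<Longrightarrow> p \<in> U \<Longrightarrow> V p \<in> vert A B p"
  by (auto simp: horizontal_field_def vertical_field_def)

lemma X_HF: "i < n \<Longrightarrow> HF (X i)" and Z_VertF: "j < m \<Longrightarrow> VertF (Z j)"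
  using frame unfolding local_orthonormal_frame_def by blast+

lemma X_VF: "i < n \<Longrightarrow> VF (X i)" and Z_VF: "j < m \<Longrightarrow> VF (Z j)"
  using X_HF Z_VertF HF_VF VertF_VF by blast+

lemma X_at: "i < n \<Longrightarrow> p \<in> U \<Longrightarrow> X i p \<in> horiz A B g p" and Z_at: "j < m \<Longrightarrow> p \<in> U \<Longrightarrow> Z j p \<in> vert A B p"
  using X_HF Z_VertF HF_at VertF_at by blast+

lemma X_tangent: "i < n \<Longrightarrow> p \<in> U \<Longrightarrow> X i p \<in> tangent A p" and Z_tangent: "j < m \<Longrightarrow> p \<in> U \<Longrightarrow> Z j p \<in> tangent A p"
  using X_at Z_at horiz_tangent vert_tangent by blast+

lemma g_frame:
  assumes "p \<in> U"
  shows "i < n \<Longrightarrow> k < n \<Longrightarrow> g p (X i p) (X k p) = (if i = k then 1 else 0)"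
    and "j < m \<Longrightarrow> l < m \<Longrightarrow> g p (Z j p) (Z l p) = (if j = l then 1 else 0)"
    and "i < n \<Longrightarrow> j < m \<Longrightarrow> g p (X i p) (Z j p) = 0"
    and "i < n \<Longrightarrow> j < m \<Longrightarrow> g p (Z j p) (X i p) = 0"
  using frame assms horiz_vert[OF X_at Z_at] vert_horiz[OF X_at Z_at]
  unfolding local_orthonormal_frame_def by blast+

text \<open>Pointwise frame formulas; \<open>hpart_apply\<close> and \<open>vpart_apply\<close>
  identify \<open>hproj\<close> and \<open>vproj\<close> with the definite descriptions
  \<open>hpart\<close> and \<open>vpart\<close>.\<close>

definition hproj :: "'a \<Rightarrow> 'a tvec \<Rightarrow> 'a tvec" where
  "hproj p v = (\<lambda>k. \<Sum>i<n. g p v (X i p) * X i p k)"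

definition vproj :: "'a \<Rightarrow> 'a tvec \<Rightarrow> 'a tvec" where
  "vproj p v = (\<lambda>k. \<Sum>j<m. g p v (Z j p) * Z j p k)"

context
  fixes p assumes p: "p \<in> U"
begin

lemma hproj_horiz: "hproj p v \<in> horiz A B g p" and vproj_vert: "vproj p v \<in> vert A B p"
  unfolding hproj_def vproj_def using X_at Z_at p by (auto intro!: horiz_sum vert_sum)

lemma hproj_tangent: "hproj p v \<in> tangent A p" and vproj_tangent: "vproj p v \<in> tangent A p"
  using hproj_horiz vproj_vert horiz_tangent vert_tangent by blast+

lemma hproj_lin:
  "u \<in> tangent A p \<Longrightarrow> v \<in> tangent A p \<Longrightarrow>
    hproj p (\<lambda>k. a * u k + b * v k) = (\<lambda>k. a * hproj p u k + b * hproj p v k)"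
  unfolding hproj_def using X_tangent[OF _ p]
  by (auto simp: g_lin_left sum.distrib sum_distrib_left algebra_simps intro!: ext)

lemma vproj_lin:
  "u \<in> tangent A p \<Longrightarrow> v \<in> tangent A p \<Longrightarrow>
    vproj p (\<lambda>k. a * u k + b * v k) = (\<lambda>k. a * vproj p u k + b * vproj p v k)"
  unfolding vproj_def using Z_tangent[OF _ p]
  by (auto simp: g_lin_left sum.distrib sum_distrib_left algebra_simps intro!: ext)

lemma hproj_id: assumes "v \<in> horiz A B g p" shows "hproj p v = v"
proof -
  obtain c where c: "v = (\<lambda>k. \<Sum>i<n. c i * X i p k)"
    using frame p assms unfolding local_orthonormal_frame_def by blast
  have "g p v (X l p) = c l" if "l < n" for l
    unfolding c using that p X_tangent by (subst g_sum_left) (auto simp: g_frame if_distrib cong: if_cong)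
  then show ?thesis unfolding hproj_def by (subst (2) c) simp
qed

lemma vproj_id: assumes "v \<in> vert A B p" shows "vproj p v = v"
proof -
  obtain c where c: "v = (\<lambda>k. \<Sum>j<m. c j * Z j p k)"
    using frame p assms unfolding local_orthonormal_frame_def by blast
  have "g p v (Z l p) = c l" if "l < m" for l
    unfolding c using that p Z_tangent by (subst g_sum_left) (auto simp: g_frame if_distrib cong: if_cong)
  then show ?thesis unfolding vproj_def by (subst (2) c) simp
qed

lemma hproj_vert: "v \<in> vert A B p \<Longrightarrow> hproj p v = (\<lambda>_. 0)"
  unfolding hproj_def by (simp add: vert_horiz[OF X_at[OF _ p]])

lemma vproj_horiz: "v \<in> horiz A B g p \<Longrightarrow> vproj p v = (\<lambda>_. 0)"
  unfolding vproj_def by (simp add: horiz_vert[OF _ Z_at[OF _ p]])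

lemma g_hproj_right: "u \<in> tangent A p \<Longrightarrow> v \<in> tangent A p \<Longrightarrow>
    g p u (hproj p v) = (\<Sum>i<n. g p u (X i p) * g p v (X i p))"
  unfolding hproj_def by (subst g_sum_right) (auto simp: X_tangent p mult.commute)

lemma g_vproj_right: "u \<in> tangent A p \<Longrightarrow> v \<in> tangent A p \<Longrightarrow>
    g p u (vproj p v) = (\<Sum>j<m. g p u (Z j p) * g p v (Z j p))"
  unfolding vproj_def by (subst g_sum_right) (auto simp: Z_tangent p mult.commute)

text \<open>The two halves of the frame are only known to span their own subspaces. The remainder
  \<open>v - vproj p v\<close> is orthogonal to every \<open>Z j\<close>, hence to all vertical
  vectors; so it is horizontal and equal to its own \<open>hproj\<close>.\<close>

lemma proj_split: assumes v: "v \<in> tangent A p" shows "v k = hproj p v k + vproj p v k"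
proof -
  let ?w = "\<lambda>k. 1 * v k + (-1) * vproj p v k"
  have w: "?w \<in> tangent A p" by (rule tangent_combine[OF v vproj_tangent])
  have wZ: "g p ?w (Z j p) = 0" if j: "j < m" for j
  proof -
    have "g p (vproj p v) (Z j p) = g p v (Z j p)"
      unfolding vproj_def using p Z_tangent j
      by (subst g_sum_left) (auto simp: g_frame if_distrib cong: if_cong)
    then show ?thesis using g_lin_left[OF v vproj_tangent[of v] Z_tangent[OF j p], of 1 "-1"] by simp
  qed
  have "?w \<in> horiz A B g p"
    unfolding horiz_def mem_Collect_eq
  proof (intro conjI ballI)
    fix z assume z: "z \<in> vert A B p"
    have "g p ?w z = g p ?w (vproj p z)" using vproj_id[OF z] by simp
    also have "\<dots> = 0" using g_vproj_right[OF w vert_tangent[OF z]] wZ by simp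
    finally show "g p ?w z = 0" .
  qed (rule w)
  then have "?w = hproj p ?w" by (simp only: hproj_id)
  also have "\<dots> = (\<lambda>k. 1 * hproj p v k + (-1) * hproj p (vproj p v) k)"
    by (rule hproj_lin[OF v vproj_tangent])
  also have "\<dots> = hproj p v" by (simp add: hproj_vert[OF vproj_vert])
  finally have "?w k = hproj p v k" by (rule fun_cong)
  then show ?thesis by simp
qed

lemma hpart_apply: assumes F: "F p \<in> tangent A p" shows "hpart F p = hproj p (F p)"
  unfolding hpart_def
proof (rule the_equality)
  have "(\<lambda>k. F p k - hproj p (F p) k) = vproj p (F p)"
    using proj_split[OF F] by (auto simp: fun_eq_iff)
  then show "hproj p (F p) \<in> horiz A B g p \<and> (\<lambda>f. F p f - hproj p (F p) f) \<in> vert A B p"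
    using hproj_horiz vproj_vert by simp
next
  fix w assume w: "w \<in> horiz A B g p \<and> (\<lambda>f. F p f - w f) \<in> vert A B p"
  then have "hproj p (\<lambda>f. 1 * F p f + (-1) * w f) = (\<lambda>_. 0)" using hproj_vert by simp
  then show "w = hproj p (F p)"
    using hproj_lin[of "F p" w 1 "-1"] F w horiz_tangent hproj_id by (auto simp: fun_eq_iff)
qed

lemma vpart_apply: assumes F: "F p \<in> tangent A p" shows "vpart F p = vproj p (F p)"
  unfolding vpart_def
proof (rule the_equality)
  have "(\<lambda>k. F p k - vproj p (F p) k) = hproj p (F p)"
    using proj_split[OF F] by (auto simp: fun_eq_iff)
  then show "vproj p (F p) \<in> vert A B p \<and> (\<lambda>f. F p f - vproj p (F p) f) \<in> horiz A B g p"
    using hproj_horiz vproj_vert by simp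
next
  fix w assume w: "w \<in> vert A B p \<and> (\<lambda>f. F p f - w f) \<in> horiz A B g p"
  then have "vproj p (\<lambda>f. 1 * F p f + (-1) * w f) = (\<lambda>_. 0)" using vproj_horiz by simp
  then show "w = vproj p (F p)"
    using vproj_lin[of "F p" w 1 "-1"] F w vert_tangent vproj_id by (auto simp: fun_eq_iff)
qed

lemma g_proj_split:
  assumes "u \<in> tangent A p" "v \<in> tangent A p"
  shows "g p u v = g p u (hproj p v) + g p u (vproj p v)"
proof -
  have "g p u v = g p u (\<lambda>k. hproj p v k + vproj p v k)"
    using proj_split[OF assms(2)] by (metis (no_types, lifting) ext)
  then show ?thesis using g_add_right[OF hproj_tangent vproj_tangent assms(1)] by simp
qed

lemma g_hproj_sym: "u \<in> tangent A p \<Longrightarrow> v \<in> tangent A p \<Longrightarrow> g p (hproj p u) v = g p u (hproj p v)"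
  using g_hproj_right[of u v] g_hproj_right[of v u] g_sym[OF hproj_tangent, of v u] by (simp add: mult.commute)

lemma g_vproj_sym: "u \<in> tangent A p \<Longrightarrow> v \<in> tangent A p \<Longrightarrow> g p (vproj p u) v = g p u (vproj p v)"
  using g_vproj_right[of u v] g_vproj_right[of v u] g_sym[OF vproj_tangent, of v u] by (simp add: mult.commute)

end

lemma SF_near: "SF u \<Longrightarrow> p \<in> U \<Longrightarrow> smooth_near A p u"
  by (rule smooth_nearI)

lemma VF_tangent: "VF V \<Longrightarrow> p \<in> U \<Longrightarrow> V p \<in> tangent A p"
  by (rule field_tangent)

lemma VF_SF: "VF V \<Longrightarrow> SF u \<Longrightarrow> SF (\<lambda>p. V p u)"
  by (rule field_smooth) auto

lemma deriv_add: "VF V \<Longrightarrow> p \<in> U \<Longrightarrow> SF u \<Longrightarrow> SF w \<Longrightarrow> V p (\<lambda>q. u q + w q) = V p u + V p w"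
  by (intro tangent_add[OF field_tangent] SF_near)

lemma deriv_diff: "VF V \<Longrightarrow> p \<in> U \<Longrightarrow> SF u \<Longrightarrow> SF w \<Longrightarrow> V p (\<lambda>q. u q - w q) = V p u - V p w"
  by (intro tangent_diff[OF field_tangent] SF_near)

lemma deriv_mult: "VF V \<Longrightarrow> p \<in> U \<Longrightarrow> SF u \<Longrightarrow> SF w \<Longrightarrow> V p (\<lambda>q. u q * w q) = u p * V p w + w p * V p u"
  by (intro tangent_mult[OF field_tangent] SF_near)

lemma deriv_cmult: "VF V \<Longrightarrow> p \<in> U \<Longrightarrow> SF u \<Longrightarrow> V p (\<lambda>q. c * u q) = c * V p u"
  by (intro tangent_cmult[OF field_tangent] SF_near)

lemma deriv_const: "VF V \<Longrightarrow> p \<in> U \<Longrightarrow> V p (\<lambda>q. c) = 0"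
  by (intro tangent_const[OF field_tangent])

lemma deriv_cong: "VF V \<Longrightarrow> p \<in> U \<Longrightarrow> (\<And>q. q \<in> U \<Longrightarrow> u q = w q) \<Longrightarrow> V p u = V p w"
  by (rule tangent_cong[OF field_tangent U])

lemma deriv_sum:
  assumes "VF V" "p \<in> U" "finite I" "\<And>i. i \<in> I \<Longrightarrow> SF (u i)"
  shows "V p (\<lambda>q. \<Sum>i\<in>I. u i q) = (\<Sum>i\<in>I. V p (u i))"
  using assms(3,4)
proof (induction I)
  case empty
  then show ?case using deriv_const[OF assms(1,2)] by simp
next
  case (insert i I)
  have "SF (\<lambda>q. \<Sum>i\<in>I. u i q)" by (rule smooth_fun_sum[OF U insert(1)]) (use insert in auto)
  then show ?case using insert deriv_add[OF assms(1,2), of "u i" "\<lambda>q. \<Sum>i\<in>I. u i q"] by simp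
qed

lemma hpart_at: "VF V \<Longrightarrow> p \<in> U \<Longrightarrow> hpart V p = hproj p (V p)"
  using hpart_apply[of p V] VF_tangent by simp

lemma vpart_at: "VF V \<Longrightarrow> p \<in> U \<Longrightarrow> vpart V p = vproj p (V p)"
  using vpart_apply[of p V] VF_tangent by simp

lemma hpart_VF: assumes "VF V" shows "VF (hpart V)"
proof (rule field_cong)
  show "VF (\<lambda>p k. \<Sum>i<n. g p (V p) (X i p) * X i p k)"
    by (rule field_lin_sum[OF U]) (use assms X_VF g_smooth in auto)
  show "(\<lambda>k. \<Sum>i<n. g p (V p) (X i p) * X i p k) = hpart V p" if "p \<in> U" for p
    using hpart_at[OF assms that] by (simp add: hproj_def)
qed

lemma vpart_VF: assumes "VF V" shows "VF (vpart V)"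
proof (rule field_cong)
  show "VF (\<lambda>p k. \<Sum>j<m. g p (V p) (Z j p) * Z j p k)"
    by (rule field_lin_sum[OF U]) (use assms Z_VF g_smooth in auto)
  show "(\<lambda>k. \<Sum>j<m. g p (V p) (Z j p) * Z j p k) = vpart V p" if "p \<in> U" for p
    using vpart_at[OF assms that] by (simp add: vproj_def)
qed

lemma hpart_HF: "VF V \<Longrightarrow> HF (hpart V)"
  unfolding horizontal_field_def by (simp add: hpart_VF hpart_at hproj_horiz)

lemma vpart_VertF: "VF V \<Longrightarrow> VertF (vpart V)"
  unfolding vertical_field_def by (simp add: vpart_VF vpart_at vproj_vert)

lemma part_split: "VF V \<Longrightarrow> p \<in> U \<Longrightarrow> V p k = hpart V p k + vpart V p k"
  using proj_split[OF _ VF_tangent] by (simp add: hpart_at vpart_at)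

lemma hpart_lin:
  "SF u \<Longrightarrow> VF V \<Longrightarrow> VF W \<Longrightarrow> p \<in> U \<Longrightarrow>
    hpart (\<lambda>q k. u q * V q k + W q k) p = (\<lambda>k. u p * hpart V p k + hpart W p k)"
  using hproj_lin[of p "V p" "W p" "u p" 1] by (simp add: hpart_at field_lin VF_tangent)

lemma vpart_lin:
  "SF u \<Longrightarrow> VF V \<Longrightarrow> VF W \<Longrightarrow> p \<in> U \<Longrightarrow>
    vpart (\<lambda>q k. u q * V q k + W q k) p = (\<lambda>k. u p * vpart V p k + vpart W p k)"
  using vproj_lin[of p "V p" "W p" "u p" 1] by (simp add: vpart_at field_lin VF_tangent)

lemma hpart_of_HF: "HF V \<Longrightarrow> p \<in> U \<Longrightarrow> hpart V p = V p"
  by (simp add: hpart_at HF_VF HF_at hproj_id)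

lemma vpart_of_HF: "HF V \<Longrightarrow> p \<in> U \<Longrightarrow> vpart V p = (\<lambda>_. 0)"
  by (simp add: vpart_at HF_VF HF_at vproj_horiz)

lemma hpart_of_VertF: "VertF V \<Longrightarrow> p \<in> U \<Longrightarrow> hpart V p = (\<lambda>_. 0)"
  by (simp add: hpart_at VertF_VF VertF_at hproj_vert)

subsection \<open>Tensorial functionals\<close>

text \<open>Additivity and homogeneity are merged into one equation, the form that
  \<open>affine_connection\<close> and \<open>field_lin\<close> have. Since the frame coefficients
  of a field are smooth on the patch, this linearity already yields all frame expansions at
  \<open>p\<close>.\<close>

definition tensorial_at :: "'a \<Rightarrow> ('a vfield \<Rightarrow> real) \<Rightarrow> bool" where
  "tensorial_at p \<tau> \<longleftrightarrow> (\<forall>u V W. SF u \<longrightarrow> VF V \<longrightarrow> VF W \<longrightarrow>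
     \<tau> (\<lambda>q k. u q * V q k + W q k) = u p * \<tau> V + \<tau> W)"

lemma tensorial_atI:
  "(\<And>u V W. SF u \<Longrightarrow> VF V \<Longrightarrow> VF W \<Longrightarrow> \<tau> (\<lambda>q k. u q * V q k + W q k) = u p * \<tau> V + \<tau> W)
    \<Longrightarrow> tensorial_at p \<tau>"
  unfolding tensorial_at_def by blast

lemma tensorial_lin:
  "tensorial_at p \<tau> \<Longrightarrow> SF u \<Longrightarrow> VF V \<Longrightarrow> VF W \<Longrightarrow> \<tau> (\<lambda>q k. u q * V q k + W q k) = u p * \<tau> V + \<tau> W"
  unfolding tensorial_at_def by blast

text \<open>A field vanishing on \<open>U\<close> is its own product with the indicator of \<open>- U\<close>.\<close>

lemma local_functional:
  fixes \<tau> :: "'a vfield \<Rightarrow> real"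
  assumes add: "\<And>V W. VF V \<Longrightarrow> VF W \<Longrightarrow> \<tau> (\<lambda>q k. V q k + W q k) = \<tau> V + \<tau> W"
    and scale: "\<And>u V. SF u \<Longrightarrow> VF V \<Longrightarrow> (\<And>q. q \<in> U \<Longrightarrow> u q = 0) \<Longrightarrow> \<tau> (\<lambda>q k. u q * V q k) = 0"
    and V: "VF V" and eq: "\<And>q. q \<in> U \<Longrightarrow> V q = W q"
  shows "\<tau> V = \<tau> W"
proof -
  have W: "VF W" using field_cong[OF V] eq by blast
  let ?d = "\<lambda>q k. V q k - W q k"
  have d: "VF ?d" by (rule field_diff[OF U V W])
  let ?c = "\<lambda>q. if q \<in> U then 0 else 1 :: real"
  have c: "SF ?c" by (rule smooth_fun_cong[OF smooth_fun_const[OF U]]) simp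
  have "\<tau> (\<lambda>q k. ?c q * ?d q k) = 0" by (rule scale[OF c d]) simp
  moreover have "(\<lambda>q k. ?c q * ?d q k) = ?d" using eq by (auto simp: fun_eq_iff)
  ultimately have "\<tau> ?d = 0" by simp
  then show ?thesis using add[OF d W] by simp
qed

lemma tensorial_zero: assumes "tensorial_at p \<tau>" shows "\<tau> (\<lambda>_ _. 0) = 0"
  using tensorial_lin[OF assms smooth_fun_const[OF U, of 1] field_zero field_zero] by simp

lemma tensorial_add: "tensorial_at p \<tau> \<Longrightarrow> VF V \<Longrightarrow> VF W \<Longrightarrow> \<tau> (\<lambda>q k. V q k + W q k) = \<tau> V + \<tau> W"
  using tensorial_lin[OF _ smooth_fun_const[OF U, of 1]] by simp

lemma tensorial_scale: "tensorial_at p \<tau> \<Longrightarrow> SF u \<Longrightarrow> VF V \<Longrightarrow> \<tau> (\<lambda>q k. u q * V q k) = u p * \<tau> V"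
  using tensorial_lin[of p \<tau> u V "\<lambda>_ _. 0"] field_zero tensorial_zero by simp

lemma tensorial_cscale: "tensorial_at p \<tau> \<Longrightarrow> VF V \<Longrightarrow> \<tau> (\<lambda>q k. c * V q k) = c * \<tau> V"
  using tensorial_scale[OF _ smooth_fun_const[OF U]] by simp

lemma tensorial_diff:
  assumes "tensorial_at p \<tau>" "VF V" "VF W" shows "\<tau> (\<lambda>q k. V q k - W q k) = \<tau> V - \<tau> W"
  using tensorial_add[OF assms(1,2) field_cscale[OF U assms(3), of "-1"]]
    tensorial_cscale[OF assms(1,3), of "-1"] by simp

lemma tensorial_cong:
  "tensorial_at p \<tau> \<Longrightarrow> p \<in> U \<Longrightarrow> VF V \<Longrightarrow> (\<And>q. q \<in> U \<Longrightarrow> V q = W q) \<Longrightarrow> \<tau> V = \<tau> W"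
  by (rule local_functional[of \<tau> V W]) (auto simp: tensorial_add tensorial_scale)

lemma tensorial_sum:
  assumes "tensorial_at p \<tau>" "finite I" "\<And>i. i \<in> I \<Longrightarrow> SF (c i)" "\<And>i. i \<in> I \<Longrightarrow> VF (V i)"
  shows "\<tau> (\<lambda>q k. \<Sum>i\<in>I. c i q * V i q k) = (\<Sum>i\<in>I. c i p * \<tau> (V i))"
  using assms(2-)
proof (induction I)
  case empty
  then show ?case using tensorial_zero[OF assms(1)] by simp
next
  case (insert i I)
  then show ?case
    using tensorial_lin[OF assms(1), of "c i" "V i" "\<lambda>q k. \<Sum>i\<in>I. c i q * V i q k"]
      field_lin_sum[OF U insert(1), of c V] by simp
qed

lemma tensorial_expand_horizontal:
  assumes "tensorial_at p \<tau>" "VF V" "p \<in> U"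
  shows "\<tau> (hpart V) = (\<Sum>i<n. g p (V p) (X i p) * \<tau> (X i))"
proof -
  have "\<tau> (hpart V) = \<tau> (\<lambda>q k. \<Sum>i<n. g q (V q) (X i q) * X i q k)"
    by (rule tensorial_cong[OF assms(1,3) hpart_VF[OF assms(2)]])
      (simp add: hpart_at assms(2) hproj_def)
  also have "\<dots> = (\<Sum>i<n. g p (V p) (X i p) * \<tau> (X i))"
    by (rule tensorial_sum[OF assms(1)]) (use assms X_VF g_smooth in auto)
  finally show ?thesis .
qed

lemma tensorial_expand_vertical:
  assumes "tensorial_at p \<tau>" "VF V" "p \<in> U"
  shows "\<tau> (vpart V) = (\<Sum>j<m. g p (V p) (Z j p) * \<tau> (Z j))"
proof -
  have "\<tau> (vpart V) = \<tau> (\<lambda>q k. \<Sum>j<m. g q (V q) (Z j q) * Z j q k)"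
    by (rule tensorial_cong[OF assms(1,3) vpart_VF[OF assms(2)]])
      (simp add: vpart_at assms(2) vproj_def)
  also have "\<dots> = (\<Sum>j<m. g p (V p) (Z j p) * \<tau> (Z j))"
    by (rule tensorial_sum[OF assms(1)]) (use assms Z_VF g_smooth in auto)
  finally show ?thesis .
qed

lemma tensorial_parts:
  assumes "tensorial_at p \<tau>" "VF V" "p \<in> U"
  shows "\<tau> V = \<tau> (hpart V) + \<tau> (vpart V)"
proof -
  have "\<tau> V = \<tau> (\<lambda>q k. hpart V q k + vpart V q k)"
    by (rule tensorial_cong[OF assms(1,3,2)]) (use part_split[OF assms(2)] in \<open>auto simp: fun_eq_iff\<close>)
  then show ?thesis using tensorial_add[OF assms(1) hpart_VF vpart_VF] assms(2) by simp
qed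

lemma tensorial_expand:
  assumes "tensorial_at p \<tau>" "VF V" "p \<in> U"
  shows "\<tau> V = (\<Sum>i<n. g p (V p) (X i p) * \<tau> (X i)) + (\<Sum>j<m. g p (V p) (Z j p) * \<tau> (Z j))"
  using tensorial_parts tensorial_expand_horizontal tensorial_expand_vertical assms by simp

text \<open>Swapping the summation indices flips the sign of the skew factor. In the applications
  \<open>a\<close> consists of connection coefficients of the orthonormal frame or of the matrix of
  \<open>J_Y\<close>.\<close>

lemma skew_trace:
  fixes a :: "nat \<Rightarrow> nat \<Rightarrow> real"
  assumes "\<And>i l. i < K \<Longrightarrow> l < K \<Longrightarrow> a i l = - a l i"
  shows "(\<Sum>i<K. \<Sum>l<K. a i l * \<beta> l i) + (\<Sum>i<K. \<Sum>l<K. a i l * \<beta> i l) = 0"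
proof -
  have "(\<Sum>i<K. \<Sum>l<K. a i l * \<beta> l i) = (\<Sum>l<K. \<Sum>i<K. a i l * \<beta> l i)" by (rule sum.swap)
  also have "\<dots> = (\<Sum>l<K. \<Sum>i<K. - (a l i * \<beta> l i))"
    using assms by (intro sum.cong refl) (metis lessThan_iff mult_minus_left)
  finally show ?thesis by (simp add: sum_negf)
qed

end

subsection \<open>The Levi-Civita connection\<close>

text \<open>Besides the Levi-Civita property of \<open>D\<close>, the calculus uses three facts: the
  vertical bundle is involutive, the Lie derivative of the horizontal metric along vertical fields
  vanishes, and so does that of the vertical metric along horizontal fields. They are imposed on all
  open subsets so that the locale can be restricted to smaller patches.\<close>

locale foliated_patch = framed_foliation +
  assumes lc: "levi_civita A g D"
    and involutive: "\<And>U' V W. open U' \<Longrightarrow> U' \<subseteq> U \<Longrightarrow> vertical_field A B U' V \<Longrightarrow> vertical_field A B U' W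
      \<Longrightarrow> vertical_field A B U' (lie A V W)"
    and holonomy_invariant: "\<And>U' V Y W p. open U' \<Longrightarrow> U' \<subseteq> U \<Longrightarrow> vertical_field A B U' V
      \<Longrightarrow> horizontal_field A B g U' Y \<Longrightarrow> horizontal_field A B g U' W \<Longrightarrow> p \<in> U'
      \<Longrightarrow> V p (\<lambda>q. g q (Y q) (W q)) = g p (lie A V Y p) (W p) + g p (Y p) (lie A V W p)"
    and leafwise_invariant: "\<And>U' V Y W p. open U' \<Longrightarrow> U' \<subseteq> U \<Longrightarrow> horizontal_field A B g U' V
      \<Longrightarrow> vertical_field A B U' Y \<Longrightarrow> vertical_field A B U' W \<Longrightarrow> p \<in> U'
      \<Longrightarrow> V p (\<lambda>q. g q (Y q) (W q)) = g p (lie A V Y p) (W p) + g p (Y p) (lie A V W p)"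
begin

lemma restrict:
  assumes "open U'" "U' \<subseteq> U"
  shows "foliated_patch A B g D n m X Z U'"
proof (intro foliated_patch.intro foliated_patch_axioms.intro)
  fix U'' assume U'': "open U''" "U'' \<subseteq> U'"
  then have sub: "U'' \<subseteq> U" using assms(2) by blast
  show "vertical_field A B U'' V \<Longrightarrow> vertical_field A B U'' W
      \<Longrightarrow> vertical_field A B U'' (lie A V W)"
    "vertical_field A B U'' V
      \<Longrightarrow> horizontal_field A B g U'' Y \<Longrightarrow> horizontal_field A B g U'' W \<Longrightarrow> p \<in> U''
      \<Longrightarrow> V p (\<lambda>q. g q (Y q) (W q)) = g p (lie A V Y p) (W p) + g p (Y p) (lie A V W p)"
    "horizontal_field A B g U'' V
      \<Longrightarrow> vertical_field A B U'' Y \<Longrightarrow> vertical_field A B U'' W \<Longrightarrow> p \<in> U''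
      \<Longrightarrow> V p (\<lambda>q. g q (Y q) (W q)) = g p (lie A V Y p) (W p) + g p (Y p) (lie A V W p)"
    for V Y W p
    by (fact involutive[OF U''(1) sub] holonomy_invariant[OF U''(1) sub] leafwise_invariant[OF U''(1) sub])+
qed (fact restrict_frame[OF assms] lc)+

lemma D_axioms:
  assumes "VF V" "VF Y" "VF W" "SF u"
  shows "p \<in> U \<Longrightarrow> D (\<lambda>q k. u q * V q k + W q k) Y p k = u p * D V Y p k + D W Y p k"
    and "p \<in> U \<Longrightarrow> D V (\<lambda>q k. Y q k + W q k) p k = D V Y p k + D V W p k"
    and "p \<in> U \<Longrightarrow> D V (\<lambda>q k. u q * Y q k) p k = u p * D V Y p k + V p u * Y p k"
  using lc[unfolded levi_civita_def affine_connection_def, THEN conjunct1, rule_format, OF U assms]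
  by auto

lemmas D_VF = levi_civita_field[OF lc U]

lemma D_lin_left:
  "SF u \<Longrightarrow> VF V \<Longrightarrow> VF W \<Longrightarrow> VF Y \<Longrightarrow> p \<in> U \<Longrightarrow>
    D (\<lambda>q k. u q * V q k + W q k) Y p k = u p * D V Y p k + D W Y p k"
  by (rule D_axioms(1))

lemma D_add_right:
  "VF V \<Longrightarrow> VF W \<Longrightarrow> VF Y \<Longrightarrow> p \<in> U \<Longrightarrow>
    D V (\<lambda>q k. Y q k + W q k) p k = D V Y p k + D V W p k"
  by (rule D_axioms(2)[OF _ _ _ smooth_fun_const[OF U]])

lemma D_scale_right:
  "SF u \<Longrightarrow> VF V \<Longrightarrow> VF Y \<Longrightarrow> p \<in> U \<Longrightarrow>
    D V (\<lambda>q k. u q * Y q k) p k = u p * D V Y p k + V p u * Y p k"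
  by (rule D_axioms(3)[OF _ _ field_zero])

lemmas D_torsion_free = levi_civita_torsion_free[OF lc U]
lemmas D_metric = levi_civita_metric[OF lc U]

text \<open>\<open>D\<close> is not tensorial in its second argument, so locality there comes from
  \<open>local_functional\<close>: for a factor \<open>u\<close> vanishing on the patch both terms
  of the Leibniz rule are zero.\<close>

lemma D_cong:
  assumes V: "VF V" and W: "VF W" and p: "p \<in> U"
    and eqV: "\<And>q. q \<in> U \<Longrightarrow> V q = V' q" and eqW: "\<And>q. q \<in> U \<Longrightarrow> W q = W' q"
  shows "D V W p = D V' W' p"
proof
  fix k
  have V': "VF V'" using field_cong[OF V] eqV by blast
  have "tensorial_at p (\<lambda>V. D V W p k)" by (rule tensorial_atI) (rule D_lin_left[OF _ _ _ W p])
  then have "D V W p k = D V' W p k" by (rule tensorial_cong) (use V p eqV in auto)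
  moreover have "D V' W p k = D V' W' p k"
    by (rule local_functional[of "\<lambda>W. D V' W p k" W W'])
      (use V' W p eqW in \<open>auto simp: D_add_right D_scale_right deriv_cong[OF V' p, of _ "\<lambda>_. 0"] deriv_const\<close>)
  ultimately show "D V W p k = D V' W' p k" by simp
qed

subsection \<open>The Bott connection\<close>

lemma nabla_at:
  assumes V: "VF V" and W: "VF W" and p: "p \<in> U"
  shows "nabla V W p k = hproj p (D (hpart V) (hpart W) p) k + hproj p (lie A (vpart V) (hpart W) p) k
    + vproj p (lie A (hpart V) (vpart W) p) k + vproj p (D (vpart V) (vpart W) p) k"
proof -
  note hv = hpart_VF[OF V] vpart_VF[OF V] hpart_VF[OF W] vpart_VF[OF W]
  show ?thesis unfolding nabla_def
    using hpart_at[OF D_VF[OF hv(1,3)] p] hpart_at[OF lie_field[OF U hv(2,3)] p]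
      vpart_at[OF lie_field[OF U hv(1,4)] p] vpart_at[OF D_VF[OF hv(2,4)] p]
    by simp
qed

lemma nabla_VF:
  assumes V: "VF V" and W: "VF W" shows "VF (nabla V W)"
proof -
  note hv = hpart_VF[OF V] vpart_VF[OF V] hpart_VF[OF W] vpart_VF[OF W]
  show ?thesis unfolding nabla_def
    by (intro field_add[OF U] hpart_VF vpart_VF D_VF lie_field[OF U] hv)
qed

lemma nabla_tangent: "VF V \<Longrightarrow> VF W \<Longrightarrow> p \<in> U \<Longrightarrow> nabla V W p \<in> tangent A p"
  by (rule VF_tangent[OF nabla_VF])

lemma nabla_cong:
  assumes V: "VF V" and W: "VF W" and p: "p \<in> U"
    and eqV: "\<And>q. q \<in> U \<Longrightarrow> V q = V' q" and eqW: "\<And>q. q \<in> U \<Longrightarrow> W q = W' q"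
  shows "nabla V W p = nabla V' W' p"
proof
  fix k
  have V': "VF V'" and W': "VF W'" using field_cong[OF V, of V'] field_cong[OF W, of W'] eqV eqW by auto
  have h: "hpart V q = hpart V' q" "vpart V q = vpart V' q" "hpart W q = hpart W' q" "vpart W q = vpart W' q"
    if "q \<in> U" for q using that eqV eqW V V' W W' by (simp_all add: hpart_at vpart_at)
  note hv = hpart_VF[OF V] vpart_VF[OF V] hpart_VF[OF W] vpart_VF[OF W]
  show "nabla V W p k = nabla V' W' p k"
    unfolding nabla_at[OF V W p] nabla_at[OF V' W' p]
    using D_cong[OF hv(1,3) p h(1,3)] D_cong[OF hv(2,4) p h(2,4)]
      lie_cong[OF U hv(2,3) p h(2,3)] lie_cong[OF U hv(1,4) p h(1,4)] by simp
qed

text \<open>Each bracket produces a derivative of \<open>u\<close>, but in the wrong component: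
  \<open>hproj\<close> meets a multiple of \<open>vpart V\<close> and \<open>vproj\<close> a
  multiple of \<open>hpart V\<close>, and both are killed.\<close>

lemma nabla_lin_left:
  assumes u: "SF u" and V: "VF V" and W: "VF W" and Y: "VF Y" and p: "p \<in> U"
  shows "nabla (\<lambda>q k. u q * V q k + W q k) Y p k = u p * nabla V Y p k + nabla W Y p k"
proof -
  let ?S = "\<lambda>q k. u q * V q k + W q k"
  have S: "VF ?S" by (rule field_lin[OF u V W])
  note hv = hpart_VF[OF V] vpart_VF[OF V] hpart_VF[OF W] vpart_VF[OF W]
  note hvY = hpart_VF[OF Y] vpart_VF[OF Y]
  note t = VF_tangent[OF _ p]
  have 1: "D (hpart ?S) (hpart Y) p = (\<lambda>k. u p * D (hpart V) (hpart Y) p k + 1 * D (hpart W) (hpart Y) p k)"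
    using D_cong[OF hpart_VF[OF S] hvY(1) p hpart_lin[OF u V W] refl] D_lin_left[OF u hv(1,3) hvY(1) p]
    by (auto simp: fun_eq_iff)
  have 2: "lie A (vpart ?S) (hpart Y) p
      = (\<lambda>k. u p * lie A (vpart V) (hpart Y) p k + 1 * (- hpart Y p u * vpart V p k + 1 * lie A (vpart W) (hpart Y) p k))"
    using lie_cong[OF U vpart_VF[OF S] hvY(1) p vpart_lin[OF u V W] refl] lie_lin_left[OF U hvY(1) hv(2,4) u p]
    by (auto simp: fun_eq_iff)
  have 3: "lie A (hpart ?S) (vpart Y) p
      = (\<lambda>k. u p * lie A (hpart V) (vpart Y) p k + 1 * (- vpart Y p u * hpart V p k + 1 * lie A (hpart W) (vpart Y) p k))"
    using lie_cong[OF U hpart_VF[OF S] hvY(2) p hpart_lin[OF u V W] refl] lie_lin_left[OF U hvY(2) hv(1,3) u p]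
    by (auto simp: fun_eq_iff)
  have 4: "D (vpart ?S) (vpart Y) p = (\<lambda>k. u p * D (vpart V) (vpart Y) p k + 1 * D (vpart W) (vpart Y) p k)"
    using D_cong[OF vpart_VF[OF S] hvY(2) p vpart_lin[OF u V W] refl] D_lin_left[OF u hv(2,4) hvY(2) p]
    by (auto simp: fun_eq_iff)
  have z: "hproj p (vpart V p) = (\<lambda>_. 0)" "vproj p (hpart V p) = (\<lambda>_. 0)"
    using V p by (simp_all add: hpart_at vpart_at hproj_vert vproj_vert vproj_horiz hproj_horiz)
  note tD = t[OF D_VF[OF hv(1) hvY(1)]] t[OF D_VF[OF hv(3) hvY(1)]] t[OF D_VF[OF hv(2) hvY(2)]] t[OF D_VF[OF hv(4) hvY(2)]]
  note tl = t[OF lie_field[OF U hv(2) hvY(1)]] t[OF lie_field[OF U hv(4) hvY(1)]] t[OF lie_field[OF U hv(1) hvY(2)]]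
    t[OF lie_field[OF U hv(3) hvY(2)]]
  show ?thesis
    unfolding nabla_at[OF S Y p] nabla_at[OF V Y p] nabla_at[OF W Y p] 1 2 3 4
    by (simp only: hproj_lin[OF p] vproj_lin[OF p] tD tl tangent_combine t[OF hv(1)] t[OF hv(2)] z)
      (simp add: algebra_simps)
qed

text \<open>The four blocks contribute the four products of a part of \<open>Y\<close>
  differentiating \<open>u\<close> with a part of \<open>V\<close>; together they make up
  \<open>Y p u * V p k\<close>.\<close>

lemma nabla_lin_right:
  assumes u: "SF u" and V: "VF V" and W: "VF W" and Y: "VF Y" and p: "p \<in> U"
  shows "nabla Y (\<lambda>q k. u q * V q k + W q k) p k = u p * nabla Y V p k + Y p u * V p k + nabla Y W p k"
proof -
  let ?S = "\<lambda>q k. u q * V q k + W q k"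
  have S: "VF ?S" by (rule field_lin[OF u V W])
  note hv = hpart_VF[OF V] vpart_VF[OF V] hpart_VF[OF W] vpart_VF[OF W]
  note hvY = hpart_VF[OF Y] vpart_VF[OF Y]
  note t = VF_tangent[OF _ p]
  have DS: "D Y' (\<lambda>q k. u q * V' q k + W' q k) p k = u p * D Y' V' p k + Y' p u * V' p k + D Y' W' p k"
    if "VF Y'" "VF V'" "VF W'" for Y' V' W' k
    using D_add_right[OF that(1,3) field_scale[OF u that(2)] p] D_scale_right[OF u that(1,2) p] by simp
  have 1: "D (hpart Y) (hpart ?S) p
      = (\<lambda>k. u p * D (hpart Y) (hpart V) p k + 1 * (hpart Y p u * hpart V p k + 1 * D (hpart Y) (hpart W) p k))"
    using D_cong[OF hvY(1) hpart_VF[OF S] p refl hpart_lin[OF u V W]] DS[OF hvY(1) hv(1,3)]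
    by (auto simp: fun_eq_iff)
  have 2: "lie A (vpart Y) (hpart ?S) p
      = (\<lambda>k. u p * lie A (vpart Y) (hpart V) p k + 1 * (vpart Y p u * hpart V p k + 1 * lie A (vpart Y) (hpart W) p k))"
    using lie_cong[OF U hvY(2) hpart_VF[OF S] p refl hpart_lin[OF u V W]] lie_lin_right[OF U hvY(2) hv(1,3) u p]
    by (auto simp: fun_eq_iff)
  have 3: "lie A (hpart Y) (vpart ?S) p
      = (\<lambda>k. u p * lie A (hpart Y) (vpart V) p k + 1 * (hpart Y p u * vpart V p k + 1 * lie A (hpart Y) (vpart W) p k))"
    using lie_cong[OF U hvY(1) vpart_VF[OF S] p refl vpart_lin[OF u V W]] lie_lin_right[OF U hvY(1) hv(2,4) u p]
    by (auto simp: fun_eq_iff)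
  have 4: "D (vpart Y) (vpart ?S) p
      = (\<lambda>k. u p * D (vpart Y) (vpart V) p k + 1 * (vpart Y p u * vpart V p k + 1 * D (vpart Y) (vpart W) p k))"
    using D_cong[OF hvY(2) vpart_VF[OF S] p refl vpart_lin[OF u V W]] DS[OF hvY(2) hv(2,4)]
    by (auto simp: fun_eq_iff)
  have z: "hproj p (hpart V p) = hpart V p" "vproj p (vpart V p) = vpart V p"
    using V p by (simp_all add: hpart_at vpart_at vproj_vert hproj_horiz hproj_id vproj_id)
  note tD = t[OF D_VF[OF hvY(1) hv(1)]] t[OF D_VF[OF hvY(1) hv(3)]] t[OF D_VF[OF hvY(2) hv(2)]] t[OF D_VF[OF hvY(2) hv(4)]]
  note tl = t[OF lie_field[OF U hvY(2) hv(1)]] t[OF lie_field[OF U hvY(2) hv(3)]] t[OF lie_field[OF U hvY(1) hv(2)]]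
    t[OF lie_field[OF U hvY(1) hv(4)]]
  have "nabla Y ?S p k = u p * nabla Y V p k + (hpart Y p u + vpart Y p u) * (hpart V p k + vpart V p k) + nabla Y W p k"
    unfolding nabla_at[OF Y S p] nabla_at[OF Y V p] nabla_at[OF Y W p] 1 2 3 4
    by (simp only: hproj_lin[OF p] vproj_lin[OF p] tD tl tangent_combine t[OF hv(1)] t[OF hv(2)] z)
      (simp add: algebra_simps)
  then show ?thesis using part_split[OF Y p, of u] part_split[OF V p, of k] by simp
qed

lemma nabla_horizontal:
  assumes V: "VF V" and W: "HF W" and p: "p \<in> U"
  shows "nabla V W p \<in> horiz A B g p"
proof -
  note VW = hpart_VF[OF V] vpart_VF[OF V]
  have "lie A (hpart V) (vpart W) p = (\<lambda>_. 0)"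
    using lie_cong[OF U VW(1) vpart_VF[OF HF_VF[OF W]] p refl vpart_of_HF[OF W]] lie_zero[OF U VW(1) p]
    by (auto simp: fun_eq_iff)
  moreover have "D (vpart V) (vpart W) p = (\<lambda>_. 0)"
    using D_cong[OF VW(2) vpart_VF[OF HF_VF[OF W]] p refl vpart_of_HF[OF W]]
      D_scale_right[OF smooth_fun_const[OF U, of 0] VW(2) field_zero p] deriv_const[OF VW(2) p]
    by (auto simp: fun_eq_iff)
  moreover have "vproj p (\<lambda>_. 0) = (\<lambda>_. 0)"
    using Z_tangent p by (simp add: vproj_def g_zero_left)
  ultimately have "nabla V W p = (\<lambda>k. 1 * hproj p (D (hpart V) (hpart W) p) k + 1 * hproj p (lie A (vpart V) (hpart W) p) k)"
    using nabla_at[OF V HF_VF[OF W] p] by (intro ext) simp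
  also have "\<dots> = hproj p (\<lambda>k. 1 * D (hpart V) (hpart W) p k + 1 * lie A (vpart V) (hpart W) p k)"
    using D_VF lie_field[OF U] hpart_VF vpart_VF V HF_VF[OF W] VF_tangent[OF _ p]
    by (intro hproj_lin[OF p, symmetric]) auto
  finally show ?thesis using hproj_horiz[OF p] by simp
qed

lemma nabla_vertical:
  assumes V: "VF V" and W: "VertF W" and p: "p \<in> U"
  shows "nabla V W p \<in> vert A B p"
proof -
  note VW = hpart_VF[OF V] vpart_VF[OF V]
  have "lie A (vpart V) (hpart W) p = (\<lambda>_. 0)"
    using lie_cong[OF U VW(2) hpart_VF[OF VertF_VF[OF W]] p refl hpart_of_VertF[OF W]] lie_zero[OF U VW(2) p]
    by (auto simp: fun_eq_iff)
  moreover have "D (hpart V) (hpart W) p = (\<lambda>_. 0)"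
    using D_cong[OF VW(1) hpart_VF[OF VertF_VF[OF W]] p refl hpart_of_VertF[OF W]]
      D_scale_right[OF smooth_fun_const[OF U, of 0] VW(1) field_zero p] deriv_const[OF VW(1) p]
    by (auto simp: fun_eq_iff)
  moreover have "hproj p (\<lambda>_. 0) = (\<lambda>_. 0)"
    using X_tangent p by (simp add: hproj_def g_zero_left)
  ultimately have "nabla V W p = (\<lambda>k. 1 * vproj p (lie A (hpart V) (vpart W) p) k + 1 * vproj p (D (vpart V) (vpart W) p) k)"
    using nabla_at[OF V VertF_VF[OF W] p] by (intro ext) simp
  also have "\<dots> = vproj p (\<lambda>k. 1 * lie A (hpart V) (vpart W) p k + 1 * D (vpart V) (vpart W) p k)"
    using D_VF lie_field[OF U] hpart_VF vpart_VF V VertF_VF[OF W] VF_tangent[OF _ p]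
    by (intro vproj_lin[OF p, symmetric]) auto
  finally show ?thesis using vproj_vert[OF p] by simp
qed

lemma vert_add: "u \<in> vert A B p \<Longrightarrow> v \<in> vert A B p \<Longrightarrow> (\<lambda>k. u k + v k) \<in> vert A B p"
  using vert_sum[of "{0,1::nat}" "\<lambda>i. if i = 0 then u else v" p "\<lambda>_. 1"] by simp

lemma nabla_add_right:
  assumes "VF V" "VF W" "VF Y" "p \<in> U"
  shows "nabla Y (\<lambda>q k. V q k + W q k) p k = nabla Y V p k + nabla Y W p k"
  using nabla_lin_right[OF smooth_fun_const[OF U, of 1] assms] deriv_const[OF assms(3,4)] by simp

lemma nabla_add_left:
  assumes "VF V" "VF W" "VF Y" "p \<in> U"
  shows "nabla (\<lambda>q k. V q k + W q k) Y p k = nabla V Y p k + nabla W Y p k"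
  using nabla_lin_left[OF smooth_fun_const[OF U, of 1] assms] by simp

lemma nabla_zero_left: "VF Y \<Longrightarrow> p \<in> U \<Longrightarrow> nabla (\<lambda>_ _. 0) Y p k = 0"
  using nabla_add_left[OF field_zero field_zero, of Y p k] by simp

lemma nabla_zero_right: "VF Y \<Longrightarrow> p \<in> U \<Longrightarrow> nabla Y (\<lambda>_ _. 0) p k = 0"
  using nabla_add_right[OF field_zero field_zero, of Y p k] by simp

lemma nabla_HF: "VF V \<Longrightarrow> HF W \<Longrightarrow> HF (nabla V W)"
  unfolding horizontal_field_def[of _ _ _ _ "nabla V W"] using nabla_VF nabla_horizontal HF_VF by blast

lemma nabla_VertF: "VF V \<Longrightarrow> VertF W \<Longrightarrow> VertF (nabla V W)"
  unfolding vertical_field_def[of _ _ _ "nabla V W"] using nabla_VF nabla_vertical VertF_VF by blast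

lemma g_parts:
  assumes V: "VF V" and W: "VF W" and p: "p \<in> U"
  shows "g p (V p) (W p) = g p (hpart V p) (hpart W p) + g p (vpart V p) (vpart W p)"
proof -
  note t = VF_tangent[OF V p] VF_tangent[OF W p]
  have "g p (V p) (hpart W p) = g p (hpart V p) (hpart W p)"
    using g_hproj_sym[OF p t(1) hproj_tangent[OF p, of "W p"]] hproj_id[OF p hproj_horiz[OF p]] V W p
    by (simp add: hpart_at)
  moreover have "g p (V p) (vpart W p) = g p (vpart V p) (vpart W p)"
    using g_vproj_sym[OF p t(1) vproj_tangent[OF p, of "W p"]] vproj_id[OF p vproj_vert[OF p]] V W p
    by (simp add: vpart_at)
  ultimately show ?thesis using g_proj_split[OF p t] V W p by (simp add: hpart_at vpart_at)
qed

lemma g_nabla: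
  assumes V: "VF V" and W: "VF W" and Y: "VF Y" and p: "p \<in> U"
  shows "g p (nabla V W p) (Y p) =
      g p (D (hpart V) (hpart W) p) (hpart Y p) + g p (lie A (vpart V) (hpart W) p) (hpart Y p)
    + g p (lie A (hpart V) (vpart W) p) (vpart Y p) + g p (D (vpart V) (vpart W) p) (vpart Y p)"
proof -
  note hv = hpart_VF[OF V] vpart_VF[OF V] hpart_VF[OF W] vpart_VF[OF W]
  note t = VF_tangent[OF D_VF[OF hv(1,3)] p] VF_tangent[OF lie_field[OF U hv(2,3)] p]
    VF_tangent[OF lie_field[OF U hv(1,4)] p] VF_tangent[OF D_VF[OF hv(2,4)] p]
  note tY = VF_tangent[OF Y p]
  have 1: "nabla V W p = (\<lambda>k. hproj p (D (hpart V) (hpart W) p) k + (hproj p (lie A (vpart V) (hpart W) p) k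
    + (vproj p (lie A (hpart V) (vpart W) p) k + vproj p (D (vpart V) (vpart W) p) k)))"
    using nabla_at[OF V W p] by (auto simp: fun_eq_iff)
  have tadd: "(\<lambda>k. u k + v k) \<in> tangent A p" if "u \<in> tangent A p" "v \<in> tangent A p" for u v
    using tangent_combine[OF that, of 1 1] by simp
  show ?thesis unfolding 1
    by (simp add: g_add_left[OF _ _ tY] tadd hproj_tangent[OF p] vproj_tangent[OF p]
        g_hproj_sym[OF p _ tY] g_vproj_sym[OF p _ tY] t hpart_at[OF Y p] vpart_at[OF Y p])
qed

text \<open>The metric is block diagonal, and each block is differentiated in two directions.
  Compatibility of \<open>D\<close> serves the horizontal block in horizontal directions and the
  vertical block in vertical ones. In the mixed cases the connection is a projected bracket, and the
  claim is \<open>holonomy_invariant\<close> or \<open>leafwise_invariant\<close>.\<close>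

lemma nabla_metric:
  assumes V: "VF V" and W: "VF W" and Y: "VF Y" and p: "p \<in> U"
  shows "V p (\<lambda>q. g q (W q) (Y q)) = g p (nabla V W p) (Y p) + g p (W p) (nabla V Y p)"
proof -
  note hv = hpart_VF[OF V] vpart_VF[OF V] 
  note hvW = hpart_VF[OF W] vpart_VF[OF W]
  note hvY = hpart_VF[OF Y] vpart_VF[OF Y]
  let ?a = "\<lambda>q. g q (hpart W q) (hpart Y q)" and ?b = "\<lambda>q. g q (vpart W q) (vpart Y q)"
  have ab: "SF ?a" "SF ?b" by (intro g_smooth hvW hvY)+
  have "V p (\<lambda>q. g q (W q) (Y q)) = V p (\<lambda>q. ?a q + ?b q)"
    by (rule deriv_cong[OF V p]) (rule g_parts[OF W Y])
  also have "\<dots> = (hpart V p ?a + vpart V p ?a) + (hpart V p ?b + vpart V p ?b)"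
    using deriv_add[OF V p ab] part_split[OF V p] by simp
  finally have "V p (\<lambda>q. g q (W q) (Y q)) = (hpart V p ?a + vpart V p ?a) + (hpart V p ?b + vpart V p ?b)" .
  moreover have "hpart V p ?a = g p (D (hpart V) (hpart W) p) (hpart Y p) + g p (hpart W p) (D (hpart V) (hpart Y) p)"
    by (rule D_metric[OF hv(1) hvW(1) hvY(1) p])
  moreover have "vpart V p ?b = g p (D (vpart V) (vpart W) p) (vpart Y p) + g p (vpart W p) (D (vpart V) (vpart Y) p)"
    by (rule D_metric[OF hv(2) hvW(2) hvY(2) p])
  moreover have "vpart V p ?a = g p (lie A (vpart V) (hpart W) p) (hpart Y p) + g p (hpart W p) (lie A (vpart V) (hpart Y) p)"
    by (rule holonomy_invariant[OF U subset_refl vpart_VertF[OF V] hpart_HF[OF W] hpart_HF[OF Y] p])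
  moreover have "hpart V p ?b = g p (lie A (hpart V) (vpart W) p) (vpart Y p) + g p (vpart W p) (lie A (hpart V) (vpart Y) p)"
    by (rule leafwise_invariant[OF U subset_refl hpart_HF[OF V] vpart_VertF[OF W] vpart_VertF[OF Y] p])
  ultimately show ?thesis
    using g_nabla[OF V W Y p] g_nabla[OF V Y W p] g_sym[OF VF_tangent[OF W p] nabla_tangent[OF V Y p]]
      g_sym[OF VF_tangent[OF hvW(1) p] VF_tangent[OF D_VF[OF hv(1) hvY(1)] p]]
      g_sym[OF VF_tangent[OF hvW(1) p] VF_tangent[OF lie_field[OF U hv(2) hvY(1)] p]]
      g_sym[OF VF_tangent[OF hvW(2) p] VF_tangent[OF lie_field[OF U hv(1) hvY(2)] p]]
      g_sym[OF VF_tangent[OF hvW(2) p] VF_tangent[OF D_VF[OF hv(2) hvY(2)] p]]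
    by linarith
qed

subsection \<open>Torsion\<close>

lemma lie_parts:
  assumes V: "VF V" and W: "VF W" and p: "p \<in> U"
  shows "lie A V W p k = lie A (hpart V) (hpart W) p k + lie A (hpart V) (vpart W) p k
    + lie A (vpart V) (hpart W) p k + lie A (vpart V) (vpart W) p k"
proof -
  note hv = hpart_VF[OF V] vpart_VF[OF V] hpart_VF[OF W] vpart_VF[OF W]
  have s: "Y q = (\<lambda>k. hpart Y q k + vpart Y q k)" if "VF Y" "q \<in> U" for Y q
    using part_split[OF that] by (rule ext)
  have "lie A V W p k = lie A (\<lambda>q k. hpart V q k + vpart V q k) (\<lambda>q k. hpart W q k + vpart W q k) p k"
    using lie_cong[OF U V W p s[OF V] s[OF W]] by simp
  then show ?thesis
    using lie_add_left[OF U field_add[OF U hv(3,4)] hv(1,2) p]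
      lie_add_right[OF U hv(1,3,4) p] lie_add_right[OF U hv(2,3,4) p] by simp
qed

text \<open>In mixed directions both covariant derivatives are projections of the bracket and leave
  no torsion; for vertical pairs there is none because \<open>D\<close> is torsion-free and the
  vertical bundle involutive. For horizontal pairs the vertical part of the bracket is left
  over.\<close>

lemma torsion_eq:
  assumes V: "VF V" and W: "VF W" and p: "p \<in> U"
  shows "torsion V W p k = - vpart (lie A (hpart V) (hpart W)) p k"
proof -
  note hv = hpart_VF[OF V] vpart_VF[OF V]
  note hw = hpart_VF[OF W] vpart_VF[OF W]
  note t = VF_tangent[OF _ p]
  have hneg: "hproj p (\<lambda>k. - u k) = (\<lambda>k. - hproj p u k)" if "u \<in> tangent A p" for u
    using hproj_lin[OF p that that, of "-1" 0] by simp
  have vneg: "vproj p (\<lambda>k. - u k) = (\<lambda>k. - vproj p u k)" if "u \<in> tangent A p" for u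
    using vproj_lin[OF p that that, of "-1" 0] by simp
  have hsub: "hproj p (\<lambda>k. u k - v k) = (\<lambda>k. hproj p u k - hproj p v k)"
    if "u \<in> tangent A p" "v \<in> tangent A p" for u v
    using hproj_lin[OF p that, of 1 "-1"] by simp
  have vsub: "vproj p (\<lambda>k. u k - v k) = (\<lambda>k. vproj p u k - vproj p v k)"
    if "u \<in> tangent A p" "v \<in> tangent A p" for u v
    using vproj_lin[OF p that, of 1 "-1"] by simp
  have hh: "hproj p (lie A (hpart V) (hpart W) p) k
      = hproj p (D (hpart V) (hpart W) p) k - hproj p (D (hpart W) (hpart V) p) k"
    using hsub[OF t[OF D_VF[OF hv(1) hw(1)]] t[OF D_VF[OF hw(1) hv(1)]]] D_torsion_free[OF hv(1) hw(1) p]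
    by (simp add: fun_eq_iff)
  have vv: "vproj p (lie A (vpart V) (vpart W) p) k
      = vproj p (D (vpart V) (vpart W) p) k - vproj p (D (vpart W) (vpart V) p) k"
    using vsub[OF t[OF D_VF[OF hv(2) hw(2)]] t[OF D_VF[OF hw(2) hv(2)]]] D_torsion_free[OF hv(2) hw(2) p]
    by (simp add: fun_eq_iff)
  have vv': "vproj p (lie A (vpart V) (vpart W) p) = lie A (vpart V) (vpart W) p"
    by (intro vproj_id[OF p] VertF_at[OF involutive[OF U subset_refl]] vpart_VertF V W p)
  have "lie A (vpart W) (hpart V) p = (\<lambda>k. - lie A (hpart V) (vpart W) p k)"
    "lie A (hpart W) (vpart V) p = (\<lambda>k. - lie A (vpart V) (hpart W) p k)"
    using lie_antisym by (blast intro: ext)+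
  then have hs: "hproj p (lie A (vpart W) (hpart V) p) k = - hproj p (lie A (hpart V) (vpart W) p) k"
    "vproj p (lie A (hpart W) (vpart V) p) k = - vproj p (lie A (vpart V) (hpart W) p) k"
    using hneg[OF t[OF lie_field[OF U hv(1) hw(2)]]] vneg[OF t[OF lie_field[OF U hv(2) hw(1)]]] by simp_all
  note s = proj_split[OF p t[OF lie_field[OF U hv(1) hw(1)]], of k] proj_split[OF p t[OF lie_field[OF U hv(1) hw(2)]], of k]
    proj_split[OF p t[OF lie_field[OF U hv(2) hw(1)]], of k]
  show ?thesis
    using s hs hh vv vv' lie_parts[OF V W p, of k] nabla_at[OF V W p, of k] nabla_at[OF W V p, of k]
      vpart_at[OF lie_field[OF U hv(1) hw(1)] p]
    by (simp add: torsion_def)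
qed

lemma torsion_VF: "VF V \<Longrightarrow> VF W \<Longrightarrow> VF (torsion V W)"
  unfolding torsion_def by (intro field_diff[OF U] nabla_VF lie_field[OF U])

lemma torsion_vert:
  assumes V: "VF V" and W: "VF W" and p: "p \<in> U" shows "torsion V W p \<in> vert A B p"
proof -
  let ?L = "lie A (hpart V) (hpart W)"
  have "VF ?L" by (intro lie_field[OF U] hpart_VF V W)
  then have "vpart ?L p \<in> vert A B p" by (intro VertF_at[OF vpart_VertF] p)
  \<comment> \<open>A sum with one term, so that \<open>vert_sum\<close> gives closure under
    negation.\<close>
  then have "(\<lambda>k. \<Sum>i\<in>{0::nat}. -1 * vpart ?L p k) \<in> vert A B p" by (intro vert_sum) auto
  moreover have "torsion V W p = (\<lambda>k. \<Sum>i\<in>{0::nat}. -1 * vpart ?L p k)"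
    using torsion_eq[OF V W p] by (auto simp: fun_eq_iff)
  ultimately show ?thesis by simp
qed

lemma torsion_VertF: "VF V \<Longrightarrow> VF W \<Longrightarrow> VertF (torsion V W)"
  unfolding vertical_field_def by (simp add: torsion_VF torsion_vert)

lemma torsion_tangent: "VF V \<Longrightarrow> VF W \<Longrightarrow> p \<in> U \<Longrightarrow> torsion V W p \<in> tangent A p"
  by (rule VF_tangent[OF torsion_VF])

lemma torsion_antisym: "torsion V W p k = - torsion W V p k"
  using lie_antisym[of V W p k] by (simp add: torsion_def)

lemma torsion_lin_left:
  assumes u: "SF u" and V: "VF V" and W: "VF W" and Y: "VF Y" and p: "p \<in> U"
  shows "torsion (\<lambda>q k. u q * V q k + W q k) Y p k = u p * torsion V Y p k + torsion W Y p k"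
  unfolding torsion_def
  using nabla_lin_left[OF assms] nabla_lin_right[OF assms] lie_lin_left[OF U Y V W u p]
  by (simp add: algebra_simps)

lemma torsion_lin_right:
  assumes u: "SF u" and V: "VF V" and W: "VF W" and Y: "VF Y" and p: "p \<in> U"
  shows "torsion Y (\<lambda>q k. u q * V q k + W q k) p k = u p * torsion Y V p k + torsion Y W p k"
  using torsion_lin_left[OF assms, of k] torsion_antisym[of Y "\<lambda>q k. u q * V q k + W q k" p k]
    torsion_antisym[of V Y p k] torsion_antisym[of W Y p k] by simp

lemma torsion_vertical_left:
  assumes V: "VertF V" and W: "VF W" and p: "p \<in> U" shows "torsion V W p = (\<lambda>_. 0)"
proof
  fix k
  note V' = VertF_VF[OF V]
  note hv = hpart_VF[OF V'] hpart_VF[OF W]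
  have "lie A (hpart V) (hpart W) p = lie A (\<lambda>_ _. 0) (hpart W) p"
    by (rule lie_cong[OF U hv p]) (use V hpart_of_VertF in auto)
  also have "\<dots> = (\<lambda>_. 0)"
    using lie_zero[OF U hv(2) p] lie_antisym[of "\<lambda>_ _. 0" "hpart W" p] by (auto simp: fun_eq_iff)
  finally show "torsion V W p k = 0"
    using torsion_eq[OF V' W p] vpart_at[OF lie_field[OF U hv] p] Z_tangent[OF _ p]
    by (simp add: vproj_def g_zero_left)
qed

lemma torsion_vertical_right:
  "VertF V \<Longrightarrow> VF W \<Longrightarrow> p \<in> U \<Longrightarrow> torsion W V p = (\<lambda>_. 0)"
  using torsion_vertical_left[of V W p] torsion_antisym[of W V p] by (auto simp: fun_eq_iff)

lemma tensorial_torsion_left: "VF W \<Longrightarrow> p \<in> U \<Longrightarrow> tensorial_at p (\<lambda>V. torsion V W p k)"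
  by (rule tensorial_atI) (rule torsion_lin_left)

lemma tensorial_torsion_right: "VF V \<Longrightarrow> p \<in> U \<Longrightarrow> tensorial_at p (\<lambda>W. torsion V W p k)"
  by (rule tensorial_atI) (rule torsion_lin_right)

lemma tensorial_g:
  assumes w: "w \<in> tangent A p" and F: "\<And>k. tensorial_at p (\<lambda>V. F V p k)"
    and t: "\<And>V. VF V \<Longrightarrow> F V p \<in> tangent A p"
  shows "tensorial_at p (\<lambda>V. g p w (F V p))"
proof (rule tensorial_atI)
  fix u V W assume uVW: "SF u" "VF V" "VF W"
  have "F (\<lambda>q k. u q * V q k + W q k) p = (\<lambda>k. u p * F V p k + 1 * F W p k)"
    using tensorial_lin[OF F uVW] by (auto simp: fun_eq_iff)
  then show "g p w (F (\<lambda>q k. u q * V q k + W q k) p) = u p * g p w (F V p) + g p w (F W p)"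
    using g_lin_right[OF t[OF uVW(2)] t[OF uVW(3)] w, of "u p" 1] by simp
qed

lemma tensorial_g_left:
  assumes "w \<in> tangent A p" "\<And>k. tensorial_at p (\<lambda>V. F V p k)"
    and t: "\<And>V. VF V \<Longrightarrow> F V p \<in> tangent A p"
  shows "tensorial_at p (\<lambda>V. g p (F V p) w)"
proof -
  have *: "tensorial_at p (\<lambda>V. g p w (F V p))" by (rule tensorial_g[of w p F, OF assms])
  show ?thesis
  proof (rule tensorial_atI)
    fix u V W assume uVW: "SF u" "VF V" "VF W"
    show "g p (F (\<lambda>q k. u q * V q k + W q k) p) w = u p * g p (F V p) w + g p (F W p) w"
      using tensorial_lin[OF * uVW] g_sym[OF assms(1) t[OF field_lin[OF uVW]]]
        g_sym[OF assms(1) t[OF uVW(2)]] g_sym[OF assms(1) t[OF uVW(3)]] by simp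
  qed
qed

lemma tensorial_id: "tensorial_at p (\<lambda>V. V p k)"
  by (rule tensorial_atI) simp

lemma torsion_hpart_left:
  assumes V: "VF V" and W: "VF W" and p: "p \<in> U" shows "torsion (hpart V) W p = torsion V W p"
proof
  fix k
  show "torsion (hpart V) W p k = torsion V W p k"
    using tensorial_parts[OF tensorial_torsion_left[OF W p] V p, of k]
      torsion_vertical_left[OF vpart_VertF[OF V] W p] by simp
qed

text \<open>The torsion vanishes as soon as one argument is vertical, so only the horizontal half of
  the frame contributes.\<close>

lemma g_torsion_expand:
  assumes V: "VF V" and W: "VF W" and p: "p \<in> U" and w: "w \<in> tangent A p"
  shows "g p w (torsion V W p) = (\<Sum>i<n. g p (W p) (X i p) * g p w (torsion V (X i) p))"
proof -
  have "tensorial_at p (\<lambda>W. g p w (torsion V W p))"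
    by (rule tensorial_g[where F = "\<lambda>W. torsion V W", OF w tensorial_torsion_right[OF V p] torsion_tangent[OF V _ p]])
  from tensorial_expand[OF this W p] show ?thesis
    using torsion_vertical_right[OF Z_VertF V p] w by (simp add: g_zero_right)
qed

subsection \<open>The maps \<open>J\<close>\<close>

text \<open>Resolves the definite description into a frame formula. The test fields in
  \<open>J_map\<close> live on arbitrary neighbourhoods \<open>U1\<close>, so the torsion is
  expanded on the smaller patch \<open>U \<inter> U1\<close>; testing with the frame fields
  \<open>X i\<close> alone gives uniqueness.\<close>

lemma J_at:
  assumes V: "VF V" and W: "VF W" and p: "p \<in> U"
  shows "J_map V W p = (\<lambda>k. \<Sum>i<n. g p (V p) (torsion W (X i) p) * X i p k)"
  unfolding J_map_def
proof (rule the_equality)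
  let ?y = "\<lambda>k. \<Sum>i<n. g p (V p) (torsion W (X i) p) * X i p k"
  have y: "?y \<in> horiz A B g p" by (intro horiz_sum) (auto simp: X_at p)
  have coeff: "g p (vpart V p) (torsion (hpart W) (X i) p) = g p (V p) (torsion W (X i) p)" if i: "i < n" for i
    using g_vproj_sym[OF p VF_tangent[OF V p] torsion_tangent[OF W X_VF[OF i] p]]
      vproj_id[OF p torsion_vert[OF W X_VF[OF i] p]] vpart_at[OF V p] torsion_hpart_left[OF W X_VF[OF i] p]
    by simp
  show "?y \<in> horiz A B g p \<and> (\<forall>U Y. open U \<longrightarrow> p \<in> U \<longrightarrow> horizontal_field A B g U Y \<longrightarrow>
      g p ?y (Y p) = g p (vpart V p) (torsion (hpart W) Y p))"
  proof (intro conjI allI impI y)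
    fix U1 Y assume U1: "open U1" "p \<in> U1" "horizontal_field A B g U1 Y"
    interpret P: foliated_patch A B g D n m X Z "U \<inter> U1"
      by (rule restrict) (use U U1 in auto)
    have pP: "p \<in> U \<inter> U1" using p U1 by simp
    have YP: "P.VF Y" using U1(3) field_subset unfolding horizontal_field_def by blast
    have WP: "P.VF (hpart W)" using hpart_VF[OF W] field_subset by blast
    have tY: "Y p \<in> tangent A p" by (rule P.VF_tangent[OF YP pP])
    have tV: "vpart V p \<in> tangent A p" by (rule VF_tangent[OF vpart_VF[OF V] p])
    have "g p (vpart V p) (torsion (hpart W) Y p)
        = (\<Sum>i<n. g p (Y p) (X i p) * g p (vpart V p) (torsion (hpart W) (X i) p))"
      by (rule P.g_torsion_expand[OF WP YP pP tV])
    also have "\<dots> = (\<Sum>i<n. g p (V p) (torsion W (X i) p) * g p (X i p) (Y p))"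
      by (intro sum.cong refl) (simp add: coeff g_sym[OF tY X_tangent] p)
    also have "\<dots> = g p ?y (Y p)"
      by (rule g_sum_left[symmetric]) (use tY X_tangent p in auto)
    finally show "g p ?y (Y p) = g p (vpart V p) (torsion (hpart W) Y p)" by simp
  qed
  fix y' assume y': "y' \<in> horiz A B g p \<and> (\<forall>U Y. open U \<longrightarrow> p \<in> U \<longrightarrow> horizontal_field A B g U Y \<longrightarrow>
      g p y' (Y p) = g p (vpart V p) (torsion (hpart W) Y p))"
  then have "g p y' (X i p) = g p (V p) (torsion W (X i) p)" if "i < n" for i
    using U p X_HF[OF that] coeff[OF that] by metis
  then have "hproj p y' = ?y" by (simp add: hproj_def)
  then show "y' = ?y" using hproj_id[OF p] y' by metis
qed

lemma J_VF: assumes "VF V" "VF W" shows "VF (J_map V W)"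
proof (rule field_cong)
  show "VF (\<lambda>p k. \<Sum>i<n. g p (V p) (torsion W (X i) p) * X i p k)"
    by (rule field_lin_sum[OF U]) (use assms X_VF g_smooth torsion_VF in auto)
  show "(\<lambda>k. \<Sum>i<n. g p (V p) (torsion W (X i) p) * X i p k) = J_map V W p" if "p \<in> U" for p
    using J_at[OF assms that] by simp
qed

lemma J_HF: "VF V \<Longrightarrow> VF W \<Longrightarrow> HF (J_map V W)"
  unfolding horizontal_field_def using J_VF by (auto simp: J_at intro!: horiz_sum X_at)

lemma J_tangent: "VF V \<Longrightarrow> VF W \<Longrightarrow> p \<in> U \<Longrightarrow> J_map V W p \<in> tangent A p"
  by (rule VF_tangent[OF J_VF])

lemma g_J:
  assumes V: "VF V" and W: "VF W" and Y: "VF Y" and p: "p \<in> U"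
  shows "g p (J_map V W p) (Y p) = g p (V p) (torsion W Y p)"
proof -
  have "g p (J_map V W p) (Y p) = (\<Sum>i<n. g p (V p) (torsion W (X i) p) * g p (X i p) (Y p))"
    unfolding J_at[OF V W p] by (rule g_sum_left) (use X_tangent p VF_tangent[OF Y] in auto)
  also have "\<dots> = (\<Sum>i<n. g p (Y p) (X i p) * g p (V p) (torsion W (X i) p))"
    by (intro sum.cong refl) (simp add: g_sym[OF VF_tangent[OF Y p] X_tangent] p)
  also have "\<dots> = g p (V p) (torsion W Y p)"
    by (rule g_torsion_expand[OF W Y p VF_tangent[OF V p], symmetric])
  finally show ?thesis .
qed

lemma tensorial_J_left:
  assumes W: "VF W" and p: "p \<in> U" shows "tensorial_at p (\<lambda>V. J_map V W p k)"
proof (rule tensorial_atI)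
  fix u V V' assume uV: "SF u" "VF V" "VF V'"
  note t = VF_tangent[OF _ p]
  show "J_map (\<lambda>q k. u q * V q k + V' q k) W p k = u p * J_map V W p k + J_map V' W p k"
    unfolding J_at[OF field_lin[OF uV] W p] J_at[OF uV(2) W p] J_at[OF uV(3) W p]
    using g_lin_left[OF t[OF uV(2)] t[OF uV(3)], of _ "u p" 1] torsion_tangent[OF W X_VF p]
    by (simp add: sum_distrib_left sum.distrib[symmetric] algebra_simps)
qed

subsection \<open>Curvature\<close>

lemma curvature_VF: "VF V \<Longrightarrow> VF W \<Longrightarrow> VF Y \<Longrightarrow> VF (curvature V W Y)"
  unfolding curvature_def by (intro field_diff[OF U] nabla_VF lie_field[OF U])

lemma curvature_tangent: "VF V \<Longrightarrow> VF W \<Longrightarrow> VF Y \<Longrightarrow> p \<in> U \<Longrightarrow> curvature V W Y p \<in> tangent A p"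
  by (rule VF_tangent[OF curvature_VF])

lemma curvature_horiz:
  assumes V: "VF V" and W: "VF W" and Y: "HF Y" and p: "p \<in> U"
  shows "curvature V W Y p \<in> horiz A B g p"
proof -
  note nab = nabla_HF[OF V nabla_HF[OF W Y]] nabla_HF[OF W nabla_HF[OF V Y]] nabla_HF[OF lie_field[OF U V W] Y]
  have "(\<lambda>k. \<Sum>i\<in>{0,1,2::nat}. (if i = 0 then 1 else -1) *
      (if i = 0 then nabla V (nabla W Y) p else if i = 1 then nabla W (nabla V Y) p else nabla (lie A V W) Y p) k)
      \<in> horiz A B g p"
    by (rule horiz_sum) (use nab[THEN HF_at, OF p] in auto)
  then show ?thesis unfolding curvature_def by (simp add: algebra_simps)
qed

lemma curvature_vert:
  assumes V: "VF V" and W: "VF W" and Y: "VertF Y" and p: "p \<in> U"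
  shows "curvature V W Y p \<in> vert A B p"
proof -
  note nab = nabla_VertF[OF V nabla_VertF[OF W Y]] nabla_VertF[OF W nabla_VertF[OF V Y]] nabla_VertF[OF lie_field[OF U V W] Y]
  have "(\<lambda>k. \<Sum>i\<in>{0,1,2::nat}. (if i = 0 then 1 else -1) *
      (if i = 0 then nabla V (nabla W Y) p else if i = 1 then nabla W (nabla V Y) p else nabla (lie A V W) Y p) k)
      \<in> vert A B p"
    by (rule vert_sum) (use nab[THEN VertF_at, OF p] in auto)
  then show ?thesis unfolding curvature_def by (simp add: algebra_simps)
qed

text \<open>The derivative \<open>W p u\<close> enters once through \<open>nabla W\<close> and once,
  with the opposite sign, through the bracket.\<close>

lemma curvature_lin_left:
  assumes u: "SF u" and V: "VF V" and V': "VF V'" and W: "VF W" and Y: "VF Y" and p: "p \<in> U"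
  shows "curvature (\<lambda>q k. u q * V q k + V' q k) W Y p k = u p * curvature V W Y p k + curvature V' W Y p k"
proof -
  let ?S = "\<lambda>q k. u q * V q k + V' q k"
  have S: "VF ?S" by (rule field_lin[OF u V V'])
  have 1: "nabla ?S (nabla W Y) p k = u p * nabla V (nabla W Y) p k + nabla V' (nabla W Y) p k"
    by (rule nabla_lin_left[OF u V V' nabla_VF[OF W Y] p])
  have "nabla W (nabla ?S Y) p = nabla W (\<lambda>q k. u q * nabla V Y q k + nabla V' Y q k) p"
    by (rule nabla_cong[OF W nabla_VF[OF S Y] p refl]) (use nabla_lin_left[OF u V V' Y] in auto)
  then have 2: "nabla W (nabla ?S Y) p k = u p * nabla W (nabla V Y) p k + W p u * nabla V Y p k + nabla W (nabla V' Y) p k"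
    using nabla_lin_right[OF u nabla_VF[OF V Y] nabla_VF[OF V' Y] W p] by simp
  have Wu: "SF (\<lambda>q. - W q u)" using smooth_fun_cmult[OF VF_SF[OF W u], of "-1"] by simp
  have "nabla (lie A ?S W) Y p = nabla (\<lambda>q k. u q * lie A V W q k + (- W q u * V q k + lie A V' W q k)) Y p"
    by (rule nabla_cong[OF lie_field[OF U S W] Y p _ refl]) (use lie_lin_left[OF U W V V' u] in auto)
  then have 3: "nabla (lie A ?S W) Y p k = u p * nabla (lie A V W) Y p k + (- W p u * nabla V Y p k + nabla (lie A V' W) Y p k)"
    using nabla_lin_left[OF u lie_field[OF U V W] field_lin[OF Wu V lie_field[OF U V' W]] Y p]
      nabla_lin_left[OF Wu V lie_field[OF U V' W] Y p] by simp
  show ?thesis unfolding curvature_def using 1 2 3 by (simp add: algebra_simps)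
qed

lemma curvature_antisym:
  assumes "VF V" "VF W" "VF Y" "p \<in> U"
  shows "curvature V W Y p k = - curvature W V Y p k"
proof -
  have "lie A V W = (\<lambda>q k. - 1 * lie A W V q k + 0)"
    using lie_antisym[of V W] by (intro ext) simp
  then have "nabla (lie A V W) Y p k = - nabla (lie A W V) Y p k"
    using nabla_lin_left[OF smooth_fun_const[OF U, of "-1"] lie_field[OF U assms(2,1)] field_zero assms(3,4)]
      nabla_zero_left[OF assms(3,4)] by simp
  then show ?thesis by (simp add: curvature_def)
qed

lemma g_curvature_antisym:
  assumes "VF V" "VF W" "VF Y" "p \<in> U" "w \<in> tangent A p"
  shows "g p (curvature V W Y p) w = - g p (curvature W V Y p) w"
proof -
  have "curvature V W Y p = (\<lambda>k. 0 * curvature W V Y p k + -1 * curvature W V Y p k)"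
    using curvature_antisym[OF assms(1-4)] by auto
  moreover have "g p (\<lambda>k. 0 * curvature W V Y p k + -1 * curvature W V Y p k) w = - g p (curvature W V Y p) w"
    using g_lin_left[OF curvature_tangent[OF assms(2,1,3,4)] curvature_tangent[OF assms(2,1,3,4)] assms(5), of 0 "-1"]
    by simp
  ultimately show ?thesis by (rule arg_cong[THEN trans, where f1 = "\<lambda>u. g p u w"])
qed

lemma tensorial_curvature:
  assumes "VF V" "VF Y" "p \<in> U" shows "tensorial_at p (\<lambda>W. curvature V W Y p k)"
proof (rule tensorial_atI)
  fix u W W' assume uW: "SF u" "VF W" "VF W'"
  show "curvature V (\<lambda>q k. u q * W q k + W' q k) Y p k = u p * curvature V W Y p k + curvature V W' Y p k"
    using curvature_lin_left[OF uW assms, of k] curvature_antisym[OF assms(1) field_lin[OF uW] assms(2,3), of k]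
      curvature_antisym[OF assms(1) uW(2) assms(2,3), of k] curvature_antisym[OF assms(1) uW(3) assms(2,3), of k]
    by simp
qed

text \<open>The operator \<open>V W - W V - [V, W]\<close> annihilates the function
  \<open>g(Y, Y')\<close>. Metric compatibility turns this into the sum of the two curvature
  pairings, while the mixed products of first derivatives cancel.\<close>

lemma curvature_skew:
  assumes V: "VF V" and W: "VF W" and Y: "VF Y" and Y': "VF Y'" and p: "p \<in> U"
  shows "g p (curvature V W Y p) (Y' p) = - g p (Y p) (curvature V W Y' p)"
proof -
  let ?a = "\<lambda>q. g q (Y q) (Y' q)"
  have a: "SF ?a" by (rule g_smooth[OF Y Y'])
  note t = VF_tangent[OF _ p]
  have two: "V p (\<lambda>q. W q ?a) = g p (nabla V (nabla W Y) p) (Y' p) + g p (nabla W Y p) (nabla V Y' p)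
     + (g p (nabla V Y p) (nabla W Y' p) + g p (Y p) (nabla V (nabla W Y') p))"
    if V: "VF V" and W: "VF W" for V W
  proof -
    have "V p (\<lambda>q. W q ?a) = V p (\<lambda>q. g q (nabla W Y q) (Y' q) + g q (Y q) (nabla W Y' q))"
      by (rule deriv_cong[OF V p]) (rule nabla_metric[OF W Y Y'])
    also have "\<dots> = V p (\<lambda>q. g q (nabla W Y q) (Y' q)) + V p (\<lambda>q. g q (Y q) (nabla W Y' q))"
      by (intro deriv_add[OF V p] g_smooth nabla_VF W Y Y')
    finally show ?thesis
      using nabla_metric[OF V nabla_VF[OF W Y] Y' p] nabla_metric[OF V Y nabla_VF[OF W Y'] p] by simp
  qed
  have "lie A V W p ?a = V p (\<lambda>q. W q ?a) - W p (\<lambda>q. V q ?a)"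
    by (rule lie_eq[OF SF_near[OF a p]])
  then have "V p (\<lambda>q. W q ?a) - W p (\<lambda>q. V q ?a)
      = g p (nabla (lie A V W) Y p) (Y' p) + g p (Y p) (nabla (lie A V W) Y' p)"
    using nabla_metric[OF lie_field[OF U V W] Y Y' p] by simp
  moreover have "g p (curvature V W Y p) (Y' p) = g p (nabla V (nabla W Y) p) (Y' p)
      - g p (nabla W (nabla V Y) p) (Y' p) - g p (nabla (lie A V W) Y p) (Y' p)"
    unfolding curvature_def
    by (simp add: g_diff_left t Y' V W Y nabla_VF lie_field[OF U] field_tangent[OF field_diff[OF U] p])
  moreover have "g p (Y p) (curvature V W Y' p) = g p (Y p) (nabla V (nabla W Y') p)
      - g p (Y p) (nabla W (nabla V Y') p) - g p (Y p) (nabla (lie A V W) Y' p)"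
    unfolding curvature_def
    by (simp add: g_diff_right t Y' V W Y nabla_VF lie_field[OF U] field_tangent[OF field_diff[OF U] p])
  ultimately show ?thesis using two[OF V W] two[OF W V] by simp
qed

text \<open>All torsion terms of the first Bianchi identity are vertical.\<close>

lemma bianchi_vert:
  assumes V: "VF V" and W: "VF W" and Y: "VF Y" and p: "p \<in> U"
  shows "(\<lambda>k. curvature V W Y p k + (curvature W Y V p k + curvature Y V W p k)) \<in> vert A B p"
proof -
  have key: "nabla V (nabla W Y) p k - nabla V (nabla Y W) p k - nabla (lie A W Y) V p k
      = nabla V (torsion W Y) p k + torsion V (lie A W Y) p k + lie A V (lie A W Y) p k"
    if V: "VF V" and W: "VF W" and Y: "VF Y" for V W Y k
  proof -
    have "nabla V (nabla W Y) p = nabla V (\<lambda>q k. torsion W Y q k + (nabla Y W q k + lie A W Y q k)) p"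
      by (rule nabla_cong[OF V nabla_VF[OF W Y] p refl]) (auto simp: torsion_def)
    then have "nabla V (nabla W Y) p k = nabla V (torsion W Y) p k + (nabla V (nabla Y W) p k + nabla V (lie A W Y) p k)"
      using nabla_add_right[OF torsion_VF[OF W Y] field_add[OF U nabla_VF[OF Y W] lie_field[OF U W Y]] V p]
        nabla_add_right[OF nabla_VF[OF Y W] lie_field[OF U W Y] V p] by simp
    then show ?thesis by (simp add: torsion_def)
  qed
  have "(\<lambda>k. curvature V W Y p k + (curvature W Y V p k + curvature Y V W p k))
     = (\<lambda>k. (nabla V (torsion W Y) p k + torsion V (lie A W Y) p k)
        + ((nabla W (torsion Y V) p k + torsion W (lie A Y V) p k)
        + (nabla Y (torsion V W) p k + torsion Y (lie A V W) p k)))"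
    (is "?l = ?r")
  proof
    fix k
    have "?l k = (nabla V (nabla W Y) p k - nabla V (nabla Y W) p k - nabla (lie A W Y) V p k)
        + ((nabla W (nabla Y V) p k - nabla W (nabla V Y) p k - nabla (lie A Y V) W p k)
        + (nabla Y (nabla V W) p k - nabla Y (nabla W V) p k - nabla (lie A V W) Y p k))"
      by (simp add: curvature_def)
    then show "?l k = ?r k"
      unfolding key[OF V W Y] key[OF W Y V] key[OF Y V W] using lie_jacobi[OF U V W Y p, of k] by simp
  qed
  also have "\<dots> \<in> vert A B p"
    using V W Y p by (intro vert_add VertF_at[OF nabla_VertF] torsion_VertF torsion_vert lie_field[OF U])
  finally show ?thesis .
qed

lemma bianchi:
  assumes V: "VF V" and W: "VF W" and Y: "VF Y" and Y': "HF Y'" and p: "p \<in> U"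
  shows "g p (curvature V W Y p) (Y' p) + g p (curvature W Y V p) (Y' p) + g p (curvature Y V W p) (Y' p) = 0"
proof -
  note t = curvature_tangent[OF V W Y p] curvature_tangent[OF W Y V p] curvature_tangent[OF Y V W p]
  have "(\<lambda>k. curvature W Y V p k + curvature Y V W p k) \<in> tangent A p"
    using tangent_combine[OF t(2,3), of 1 1] by simp
  then show ?thesis
    using vert_horiz[OF HF_at[OF Y' p] bianchi_vert[OF V W Y p]] t VF_tangent[OF HF_VF[OF Y'] p]
    by (simp add: g_add_left)
qed

text \<open>The classical combination of two skew symmetries with four cyclic sums. Each of the four
  fields occupies the last slot of one of these sums, and \<open>bianchi\<close> takes a horizontal
  field there.\<close>

lemma curvature_pair_symmetric:
  assumes "HF a" "HF b" "HF c" "HF d" and p: "p \<in> U"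
  shows "g p (curvature a b c p) (d p) = g p (curvature c d a p) (b p)"
proof -
  define r where "r a b c d = g p (curvature a b c p) (d p)" for a b c d
  have s1: "r a b c d = - r b a c d" if "HF a" "HF b" "HF c" "HF d" for a b c d
    unfolding r_def using that HF_VF VF_tangent p by (intro g_curvature_antisym) auto
  have s2: "r a b c d = - r a b d c" if "HF a" "HF b" "HF c" "HF d" for a b c d
    using curvature_skew[of a b c d p] that p HF_VF g_sym[OF VF_tangent curvature_tangent]
    unfolding r_def by metis
  have b: "r a b c d + r b c a d + r c a b d = 0" if "HF a" "HF b" "HF c" "HF d" for a b c d
    unfolding r_def using that HF_VF by (intro bianchi[OF _ _ _ _ p]) auto
  have "r a b c d = r c d a b"
    using b[OF assms(2,3,1,4)] b[OF assms(3,1,4,2)] b[OF assms(1,4,2,3)] b[OF assms(4,2,3,1)]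
      s2[OF assms(2,3,1,4)] s2[OF assms(3,1,2,4)] s2[OF assms(1,4,3,2)] s2[OF assms(4,2,1,3)]
      s1[OF assms(2,1,4,3)] s2[OF assms(1,2,4,3)] s1[OF assms(3,4,2,1)] s2[OF assms(4,3,2,1)] s1[OF assms(4,3,1,2)]
    by linarith
  then show ?thesis by (simp add: r_def)
qed

text \<open>\<open>g(R(a,V)b,c)\<close> is symmetric in \<open>a, b\<close> and skew in \<open>b, c\<close>.\<close>

lemma curvature_vertical_direction:
  assumes "HF a" "HF b" "HF c" and V: "VertF V" and p: "p \<in> U"
  shows "g p (curvature a V b p) (c p) = 0"
proof -
  define r where "r a b c = g p (curvature a V b p) (c p)" for a b c
  have s1: "r a b c = r b a c" if "HF a" "HF b" "HF c" for a b c
  proof -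
    note h = that(1,2)[THEN HF_VF]
    have "g p (curvature b a V p) (c p) = 0"
      by (rule vert_horiz[OF HF_at[OF that(3) p] curvature_vert[OF h(2,1) V p]])
    moreover have "g p (curvature V b a p) (c p) = - g p (curvature b V a p) (c p)"
      by (rule g_curvature_antisym[OF VertF_VF[OF V] h(2,1) p VF_tangent[OF HF_VF[OF that(3)] p]])
    ultimately show ?thesis
      using bianchi[OF h(1) VertF_VF[OF V] h(2) that(3) p] unfolding r_def by simp
  qed
  have s2: "r a b c = - r a c b" if "HF a" "HF b" "HF c" for a b c
    using curvature_skew[OF HF_VF[OF that(1)] VertF_VF[OF V] that(2,3)[THEN HF_VF] p]
      g_sym[OF VF_tangent[OF HF_VF[OF that(2)] p] curvature_tangent[OF HF_VF[OF that(1)] VertF_VF[OF V] HF_VF[OF that(3)] p]]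
    unfolding r_def by simp
  have "r a b c = 0"
    using assms(1-3) s1[of a b c] s2[of b a c] s1[of b c a] s2[of c b a] s1[of c a b] s2[of a c b] by simp
  then show ?thesis by (simp add: r_def)
qed

end

text \<open>The squares of the symmetric and the antisymmetric part add up. An antisymmetric entry
  is half of \<open>a k i - a i k\<close>, whence \<open>1 / 4\<close>; the symmetric part is cut
  down to its diagonal, where Cauchy-Schwarz gives \<open>1 / real n\<close>. For
  \<open>n = 0\<close> division by zero yields \<open>0\<close> and both sides vanish.\<close>

lemma sum_squares_ge_trace_antisym:
  fixes a :: "nat \<Rightarrow> nat \<Rightarrow> real"
  shows "(\<Sum>i<n. \<Sum>k<n. (a i k)\<^sup>2) \<ge> 1 / real n * (\<Sum>i<n. a i i)\<^sup>2 + 1 / 4 * (\<Sum>i<n. \<Sum>k<n. (a k i - a i k)\<^sup>2)"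
proof -
  let ?s = "\<lambda>i k. ((a i k + a k i) / 2)\<^sup>2"
  have "(\<Sum>i<n. \<Sum>k<n. (a i k)\<^sup>2) = (\<Sum>i<n. \<Sum>k<n. (a k i)\<^sup>2)" by (rule sum.swap)
  then have "(\<Sum>i<n. \<Sum>k<n. (a i k)\<^sup>2) = (\<Sum>i<n. \<Sum>k<n. 1 / 2 * (a i k)\<^sup>2 + 1 / 2 * (a k i)\<^sup>2)"
    by (simp add: sum.distrib sum_distrib_left[symmetric] sum_divide_distrib[symmetric])
  also have "\<dots> = (\<Sum>i<n. \<Sum>k<n. ?s i k + 1 / 4 * (a k i - a i k)\<^sup>2)"
    by (intro sum.cong refl) (simp add: power2_eq_square field_simps)
  also have "\<dots> = (\<Sum>i<n. \<Sum>k<n. ?s i k) + 1 / 4 * (\<Sum>i<n. \<Sum>k<n. (a k i - a i k)\<^sup>2)"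
    by (simp add: sum.distrib sum_distrib_left sum_divide_distrib)
  finally have 1: "(\<Sum>i<n. \<Sum>k<n. (a i k)\<^sup>2) = (\<Sum>i<n. \<Sum>k<n. ?s i k) + 1 / 4 * (\<Sum>i<n. \<Sum>k<n. (a k i - a i k)\<^sup>2)" .
  have "(\<Sum>i<n. (a i i)\<^sup>2) \<le> (\<Sum>i<n. \<Sum>k<n. ?s i k)"
  proof (rule sum_mono)
    fix i assume "i \<in> {..<n}"
    then have "?s i i \<le> (\<Sum>k<n. ?s i k)" by (intro member_le_sum) auto
    then show "(a i i)\<^sup>2 \<le> (\<Sum>k<n. ?s i k)" by simp
  qed
  moreover have "1 / real n * (\<Sum>i<n. a i i)\<^sup>2 \<le> (\<Sum>i<n. (a i i)\<^sup>2)"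
  proof (cases "n = 0")
    case False
    have "(\<Sum>i<n. a i i)\<^sup>2 \<le> (\<Sum>i<n. (a i i)\<^sup>2) * real n"
      using sum_squared_le_sum_of_squares[of "\<lambda>i. a i i" "{..<n}"] by simp
    then show ?thesis using False by (simp add: field_simps)
  qed simp
  ultimately show ?thesis using 1 by linarith
qed

context foliated_patch
begin

subsection \<open>The Hessian of the Bott connection\<close>

definition hess :: "('a \<Rightarrow> real) \<Rightarrow> 'a vfield \<Rightarrow> 'a vfield \<Rightarrow> 'a \<Rightarrow> real" where
  "hess f V W p = V p (\<lambda>q. W q f) - nabla V W p f"

lemma nabla_form_differential: "nabla_form V (differential f) W p = hess f V W p"
  by (simp add: nabla_form_def differential_def hess_def)

lemma hor_laplacian_hess: "hor_laplacian f p = (\<Sum>i<n. hess f (X i) (X i) p)"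
  by (simp add: hor_laplacian_def hess_def)

lemma hess_SF: assumes "SF f" "VF V" "VF W" shows "SF (hess f V W)"
proof -
  have "SF (\<lambda>p. V p (\<lambda>q. W q f) - nabla V W p f)"
    by (rule smooth_fun_diff[OF VF_SF[OF assms(2) VF_SF[OF assms(3,1)]] VF_SF[OF nabla_VF[OF assms(2,3)] assms(1)]])
  then show ?thesis by (simp add: hess_def[abs_def])
qed

lemma hess_comm:
  assumes f: "SF f" and p: "p \<in> U" shows "hess f W V p = hess f V W p + torsion V W p f"
  using lie_eq[OF SF_near[OF f p], of V W] by (simp add: hess_def torsion_def)

lemma tensorial_hess_left: "SF f \<Longrightarrow> VF W \<Longrightarrow> p \<in> U \<Longrightarrow> tensorial_at p (\<lambda>V. hess f V W p)"
  by (rule tensorial_atI, unfold hess_def, subst nabla_lin_left) (auto simp: algebra_simps)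

lemma tensorial_hess_right:
  assumes f: "SF f" and V: "VF V" and p: "p \<in> U" shows "tensorial_at p (\<lambda>W. hess f V W p)"
proof (rule tensorial_atI)
  fix u W W' assume u: "SF u" and W: "VF W" and W': "VF W'"
  have "V p (\<lambda>q. u q * W q f + W' q f) = (u p * V p (\<lambda>q. W q f) + W p f * V p u) + V p (\<lambda>q. W' q f)"
    using deriv_add[OF V p smooth_fun_mult[OF u VF_SF[OF W f]] VF_SF[OF W' f]]
      deriv_mult[OF V p u VF_SF[OF W f]] by simp
  then show "hess f V (\<lambda>q k. u q * W q k + W' q k) p = u p * hess f V W p + hess f V W' p"
    unfolding hess_def nabla_lin_right[OF u W W' V p] by (simp add: algebra_simps)
qed

text \<open>Applied to the function \<open>Y f\<close>, the bracket is the commutator of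
  \<open>V\<close> and \<open>W\<close>, which cancels the third-order terms. Only the second slot
  of the Hessian is differentiated covariantly; leaving the first slot alone keeps
  \<open>lie A V W\<close> on the right instead of the torsion.\<close>

lemma ricci_identity:
  assumes f: "SF f" and V: "VF V" and W: "VF W" and Y: "VF Y" and p: "p \<in> U"
  shows "V p (hess f W Y) - hess f W (nabla V Y) p - W p (hess f V Y) + hess f V (nabla W Y) p
    = hess f (lie A V W) Y p - curvature V W Y p f"
proof -
  have d: "V p (hess f W Y) = V p (\<lambda>q. W q (\<lambda>r. Y r f)) - V p (\<lambda>q. nabla W Y q f)" if "VF V" "VF W" for V W
    unfolding hess_def[abs_def]
    by (rule deriv_diff[OF that(1) p VF_SF[OF that(2) VF_SF[OF Y f]] VF_SF[OF nabla_VF[OF that(2) Y] f]])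
  have "lie A V W p (\<lambda>r. Y r f) = V p (\<lambda>q. W q (\<lambda>r. Y r f)) - W p (\<lambda>q. V q (\<lambda>r. Y r f))"
    by (rule lie_eq[OF SF_near[OF VF_SF[OF Y f] p]])
  then show ?thesis by (simp add: d V W hess_def curvature_def)
qed

lemma horiz_apply: "v \<in> horiz A B g p \<Longrightarrow> p \<in> U \<Longrightarrow> v k = (\<Sum>i<n. g p v (X i p) * X i p k)"
  using hproj_id[of p v] unfolding hproj_def by (metis (no_types, lifting))

lemma vert_apply: "v \<in> vert A B p \<Longrightarrow> p \<in> U \<Longrightarrow> v k = (\<Sum>j<m. g p v (Z j p) * Z j p k)"
  using vproj_id[of p v] unfolding vproj_def by (metis (no_types, lifting))

lemma tensorial_expand_HF:
  "tensorial_at p \<tau> \<Longrightarrow> HF V \<Longrightarrow> p \<in> U \<Longrightarrow> \<tau> V = (\<Sum>i<n. g p (V p) (X i p) * \<tau> (X i))"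
  using tensorial_expand[OF _ HF_VF] horiz_vert[OF HF_at Z_at] by simp

lemma tensorial_expand_VertF:
  "tensorial_at p \<tau> \<Longrightarrow> VertF V \<Longrightarrow> p \<in> U \<Longrightarrow> \<tau> V = (\<Sum>j<m. g p (V p) (Z j p) * \<tau> (Z j))"
  using tensorial_expand[OF _ VertF_VF] vert_horiz[OF X_at VertF_at] by simp

text \<open>Used with \<open>S i\<close> equal to \<open>J_map Y (X i)\<close> and to
  \<open>nabla Y (X i)\<close>, both of which have a skew matrix in the frame. The Hessian in the
  role of \<open>\<beta>\<close> is not symmetric, so both orders of the slots have to
  enter.\<close>

lemma skew_sum:
  assumes l: "\<And>W. VF W \<Longrightarrow> tensorial_at p (\<lambda>V. \<beta> V W)" and r: "\<And>V. VF V \<Longrightarrow> tensorial_at p (\<lambda>W. \<beta> V W)"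
    and S: "\<And>i. i < n \<Longrightarrow> HF (S i)" and p: "p \<in> U"
    and skew: "\<And>i k. i < n \<Longrightarrow> k < n \<Longrightarrow> g p (S i p) (X k p) = - g p (S k p) (X i p)"
  shows "(\<Sum>i<n. \<beta> (S i) (X i)) + (\<Sum>i<n. \<beta> (X i) (S i)) = 0"
proof -
  have "(\<Sum>i<n. \<beta> (S i) (X i)) = (\<Sum>i<n. \<Sum>k<n. g p (S i p) (X k p) * \<beta> (X k) (X i))"
    by (intro sum.cong refl) (auto intro!: tensorial_expand_HF[OF l S p] X_VF)
  moreover have "(\<Sum>i<n. \<beta> (X i) (S i)) = (\<Sum>i<n. \<Sum>k<n. g p (S i p) (X k p) * \<beta> (X i) (X k))"
    by (intro sum.cong refl) (auto intro!: tensorial_expand_HF[OF r S p] X_VF)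
  ultimately show ?thesis
    using skew_trace[of n "\<lambda>i k. g p (S i p) (X k p)" "\<lambda>k i. \<beta> (X k) (X i)", OF skew] by simp
qed

lemma nabla_skew:
  assumes V: "VF V" and W: "VF W" and Y: "VF Y" and p: "p \<in> U"
    and c: "\<And>q. q \<in> U \<Longrightarrow> g q (W q) (Y q) = c"
  shows "g p (nabla V W p) (Y p) = - g p (nabla V Y p) (W p)"
proof -
  have "V p (\<lambda>q. g q (W q) (Y q)) = V p (\<lambda>q. c)" by (rule deriv_cong[OF V p c])
  then show ?thesis
    using nabla_metric[OF V W Y p] deriv_const[OF V p] g_sym[OF VF_tangent[OF W p] nabla_tangent[OF V Y p]] by simp
qed

lemma nabla_skew_X: "VF V \<Longrightarrow> p \<in> U \<Longrightarrow> i < n \<Longrightarrow> k < n \<Longrightarrow>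
    g p (nabla V (X i) p) (X k p) = - g p (nabla V (X k) p) (X i p)"
  by (rule nabla_skew[OF _ X_VF X_VF]) (auto intro: g_frame)

lemma nabla_skew_Z: "VF V \<Longrightarrow> p \<in> U \<Longrightarrow> i < m \<Longrightarrow> k < m \<Longrightarrow>
    g p (nabla V (Z i) p) (Z k p) = - g p (nabla V (Z k) p) (Z i p)"
  by (rule nabla_skew[OF _ Z_VF Z_VF]) (auto intro: g_frame)

lemma g_torsion_antisym:
  assumes "VF V" "VF W" "p \<in> U" "w \<in> tangent A p"
  shows "g p w (torsion V W p) = - g p w (torsion W V p)"
proof -
  have "torsion V W p = (\<lambda>k. 0 * torsion W V p k + -1 * torsion W V p k)"
    using torsion_antisym[of V W p] by auto
  moreover have "g p w (\<lambda>k. 0 * torsion W V p k + -1 * torsion W V p k) = - g p w (torsion W V p)"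
    using g_lin_right[OF torsion_tangent[OF assms(2,1,3)] torsion_tangent[OF assms(2,1,3)] assms(4), of 0 "-1"]
    by simp
  ultimately show ?thesis by (rule arg_cong[THEN trans, where f1 = "g p w"])
qed

lemma J_skew:
  assumes "VF Y" "VF V" "VF W" "p \<in> U"
  shows "g p (J_map Y V p) (W p) = - g p (J_map Y W p) (V p)"
  using g_J g_torsion_antisym[of V W p "Y p"] VF_tangent assms by simp

lemma J_horizontal_left: "HF V \<Longrightarrow> VF W \<Longrightarrow> p \<in> U \<Longrightarrow> J_map V W p = (\<lambda>_. 0)"
  using J_at[OF HF_VF] horiz_vert[OF HF_at torsion_vert] X_VF by simp

subsection \<open>Covariant derivatives of the torsion and of \<open>J\<close>\<close>

lemma vert_diff: "u \<in> vert A B p \<Longrightarrow> v \<in> vert A B p \<Longrightarrow> (\<lambda>k. u k - v k) \<in> vert A B p"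
  using vert_sum[of "{0,1::nat}" "\<lambda>i. if i = 0 then u else v" p "\<lambda>i. if i = 0 then 1 else -1"] by simp

lemma horiz_diff: "u \<in> horiz A B g p \<Longrightarrow> v \<in> horiz A B g p \<Longrightarrow> (\<lambda>k. u k - v k) \<in> horiz A B g p"
  using horiz_sum[of "{0,1::nat}" "\<lambda>i. if i = 0 then u else v" p "\<lambda>i. if i = 0 then 1 else -1"] by simp

lemma nabla_torsion_vert:
  assumes "VF Y" "VF V" "VF W" "p \<in> U" shows "nabla_torsion Y V W p \<in> vert A B p"
  unfolding nabla_torsion_def using assms
  by (intro vert_diff VertF_at[OF nabla_VertF] torsion_VertF torsion_vert nabla_VF)

lemma nabla_torsion_tangent:
  "VF Y \<Longrightarrow> VF V \<Longrightarrow> VF W \<Longrightarrow> p \<in> U \<Longrightarrow> nabla_torsion Y V W p \<in> tangent A p"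
  by (rule vert_tangent[OF nabla_torsion_vert])

text \<open>The derivative of \<open>u\<close> along \<open>Y\<close> multiplies
  \<open>torsion V W\<close> twice, from differentiating the torsion and from
  \<open>torsion V (nabla Y W)\<close>, with opposite signs.\<close>

lemma tensorial_nabla_torsion:
  assumes Y: "VF Y" and V: "VF V" and p: "p \<in> U"
  shows "tensorial_at p (\<lambda>W. nabla_torsion Y V W p k)"
proof (rule tensorial_atI)
  fix u W W' assume u: "SF u" and W: "VF W" and W': "VF W'"
  let ?S = "\<lambda>q k. u q * W q k + W' q k"
  have S: "VF ?S" by (rule field_lin[OF u W W'])
  have "nabla Y (torsion V ?S) p = nabla Y (\<lambda>q k. u q * torsion V W q k + torsion V W' q k) p"
    by (rule nabla_cong[OF Y torsion_VF[OF V S] p refl]) (use torsion_lin_right[OF u W W' V] in auto)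
  then have 1: "nabla Y (torsion V ?S) p k
      = u p * nabla Y (torsion V W) p k + Y p u * torsion V W p k + nabla Y (torsion V W') p k"
    using nabla_lin_right[OF u torsion_VF[OF V W] torsion_VF[OF V W'] Y p] by simp
  have Yu: "SF (\<lambda>q. Y q u)" by (rule VF_SF[OF Y u])
  have "torsion V (nabla Y ?S) p k = torsion V (\<lambda>q k. u q * nabla Y W q k + (Y q u * W q k + nabla Y W' q k)) p k"
    by (rule tensorial_cong[OF tensorial_torsion_right[OF V p] p nabla_VF[OF Y S]])
      (use nabla_lin_right[OF u W W' Y] in auto)
  then have 2: "torsion V (nabla Y ?S) p k
      = u p * torsion V (nabla Y W) p k + (Y p u * torsion V W p k + torsion V (nabla Y W') p k)"
    using torsion_lin_right[OF u nabla_VF[OF Y W] field_lin[OF Yu W nabla_VF[OF Y W']] V p]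
      torsion_lin_right[OF Yu W nabla_VF[OF Y W'] V p] by simp
  show "nabla_torsion Y V ?S p k = u p * nabla_torsion Y V W p k + nabla_torsion Y V W' p k"
    unfolding nabla_torsion_def using 1 2 torsion_lin_right[OF u W W' nabla_VF[OF Y V] p]
    by (simp add: algebra_simps)
qed

lemma nabla_torsion_vertical:
  assumes Y: "VF Y" and V: "VF V" and W: "VertF W" and p: "p \<in> U"
  shows "nabla_torsion Y V W p = (\<lambda>_. 0)"
proof -
  have "nabla Y (torsion V W) p = nabla Y (\<lambda>_ _. 0) p"
    by (rule nabla_cong[OF Y torsion_VF[OF V VertF_VF[OF W]] p refl torsion_vertical_right[OF W V]])
  then show ?thesis
    using nabla_zero_right[OF Y p] torsion_vertical_right[OF W nabla_VF[OF Y V] p]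
      torsion_vertical_right[OF nabla_VertF[OF Y W] V p]
    by (auto simp: nabla_torsion_def fun_eq_iff)
qed

text \<open>Obtained by differentiating \<open>g(J_Y W, W') = g(Y, T(W, W'))\<close> with a parallel
  metric: the covariant derivative of \<open>J\<close> is dual to that of the torsion.\<close>

lemma g_nabla_J:
  assumes V: "VF V" and Y: "VF Y" and W: "VF W" and W': "VF W'" and p: "p \<in> U"
  shows "g p (\<lambda>k. nabla V (J_map Y W) p k - J_map (nabla V Y) W p k - J_map Y (nabla V W) p k) (W' p)
    = g p (Y p) (nabla_torsion V W W' p)"
proof -
  note tW' = VF_tangent[OF W' p] and tY = VF_tangent[OF Y p]
  note t = nabla_tangent[OF V J_VF[OF Y W] p] J_tangent[OF nabla_VF[OF V Y] W p] J_tangent[OF Y nabla_VF[OF V W] p]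
  note s = nabla_tangent[OF V torsion_VF[OF W W'] p] torsion_tangent[OF nabla_VF[OF V W] W' p]
    torsion_tangent[OF W nabla_VF[OF V W'] p]
  have dt: "(\<lambda>k. u k - v k) \<in> tangent A p" if "u \<in> tangent A p" "v \<in> tangent A p" for u v
    using tangent_combine[OF that, of 1 "-1"] by simp
  have "V p (\<lambda>q. g q (J_map Y W q) (W' q)) = V p (\<lambda>q. g q (Y q) (torsion W W' q))"
    by (rule deriv_cong[OF V p]) (rule g_J[OF Y W W'])
  then have "g p (nabla V (J_map Y W) p) (W' p) + g p (Y p) (torsion W (nabla V W') p)
      = g p (nabla V Y p) (torsion W W' p) + g p (Y p) (nabla V (torsion W W') p)"
    using nabla_metric[OF V J_VF[OF Y W] W' p] nabla_metric[OF V Y torsion_VF[OF W W'] p]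
      g_J[OF Y W nabla_VF[OF V W'] p] by simp
  then show ?thesis
    unfolding nabla_torsion_def
    by (simp add: g_diff_left[OF _ _ tW'] g_diff_right[OF _ _ tY] dt t s
        g_J[OF nabla_VF[OF V Y] W W' p] g_J[OF Y nabla_VF[OF V W] W' p])
qed

text \<open>Trades the trace over the vertical frame for one over the horizontal frame. Each
  \<open>J\<close> is replaced by the torsion it is dual to, and the sum over \<open>Z j\<close>
  then collapses because the torsion is vertical. This quadratic torsion expression is the form in
  which \<open>J_sq\<close> is compared with other terms.\<close>

lemma g_J_sq:
  assumes W: "VF W" and Y: "VF Y" and p: "p \<in> U"
  shows "g p (J_sq W p) (Y p) = - (\<Sum>i<n. g p (torsion (X i) Y p) (torsion (X i) W p))"
proof -
  have vf: "VF (J_map (Z j) W)" if "j < m" for j by (rule J_VF[OF Z_VF[OF that] W])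
  have "g p (J_sq W p) (Y p) = g p (\<lambda>k. \<Sum>j<m. 1 * J_map (Z j) (J_map (Z j) W) p k) (Y p)"
    by (simp add: J_sq_def)
  also have "\<dots> = (\<Sum>j<m. 1 * g p (J_map (Z j) (J_map (Z j) W) p) (Y p))"
    by (rule g_sum_left) (use J_tangent[OF Z_VF vf p] VF_tangent[OF Y p] in auto)
  also have "\<dots> = (\<Sum>j<m. \<Sum>i<n. - (g p (Z j p) (torsion (X i) W p) * g p (Z j p) (torsion (X i) Y p)))"
  proof (intro sum.cong refl)
    fix j assume "j \<in> {..<m}"
    then have j: "j < m" by simp
    have "g p (J_map (Z j) (J_map (Z j) W) p) (Y p) = - g p (Z j p) (torsion Y (J_map (Z j) W) p)"
      using g_J[OF Z_VF[OF j] vf[OF j] Y p] g_torsion_antisym[OF vf[OF j] Y p Z_tangent[OF j p]] by simp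
    also have "\<dots> = - (\<Sum>i<n. g p (J_map (Z j) W p) (X i p) * g p (Z j p) (torsion Y (X i) p))"
      using g_torsion_expand[OF Y vf[OF j] p Z_tangent[OF j p]] by simp
    also have "\<dots> = (\<Sum>i<n. - (g p (Z j p) (torsion (X i) W p) * g p (Z j p) (torsion (X i) Y p)))"
      unfolding sum_negf[symmetric]
      by (intro sum.cong refl)
        (simp add: g_J[OF Z_VF[OF j] W X_VF p] g_torsion_antisym[OF W X_VF p Z_tangent[OF j p]]
          g_torsion_antisym[OF Y X_VF p Z_tangent[OF j p]])
    finally show "1 * g p (J_map (Z j) (J_map (Z j) W) p) (Y p)
      = (\<Sum>i<n. - (g p (Z j p) (torsion (X i) W p) * g p (Z j p) (torsion (X i) Y p)))" by simp
  qed
  also have "\<dots> = (\<Sum>i<n. \<Sum>j<m. - (g p (Z j p) (torsion (X i) W p) * g p (Z j p) (torsion (X i) Y p)))"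
    by (rule sum.swap)
  also have "\<dots> = (\<Sum>i<n. - g p (torsion (X i) Y p) (torsion (X i) W p))"
  proof (intro sum.cong refl)
    fix i assume "i \<in> {..<n}"
    then have i: "i < n" by simp
    note tt = torsion_tangent[OF X_VF[OF i] Y p] torsion_tangent[OF X_VF[OF i] W p]
    show "(\<Sum>j<m. - (g p (Z j p) (torsion (X i) W p) * g p (Z j p) (torsion (X i) Y p)))
      = - g p (torsion (X i) Y p) (torsion (X i) W p)"
      using g_vproj_right[OF p tt] vproj_id[OF p torsion_vert[OF X_VF[OF i] W p]] tt
      by (simp add: sum_negf g_sym[OF Z_tangent[OF _ p]] mult.commute)
  qed
  finally show ?thesis by (simp add: sum_negf)
qed

end

section \<open>Commutation of the horizontal Laplacian with the differential\<close>

locale foliated_patch_function = foliated_patch +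
  fixes f :: "'a \<Rightarrow> real"
  assumes f: "SF f"
begin

abbreviation "df \<equiv> differential f"

lemma hsharp_df: "hsharp df = (\<lambda>p k. \<Sum>i<n. X i p f * X i p k)"
  and vsharp_df: "vsharp df = (\<lambda>p k. \<Sum>j<m. Z j p f * Z j p k)"
  by (auto simp: hsharp_def vsharp_def differential_def)

lemma hsharp_HF: "HF (hsharp df)"
  unfolding horizontal_field_def hsharp_df
  using VF_SF[OF X_VF f] by (auto intro!: field_lin_sum[OF U] horiz_sum X_VF X_at)

lemma vsharp_VertF: "VertF (vsharp df)"
  unfolding vertical_field_def vsharp_df
  using VF_SF[OF Z_VF f] by (auto intro!: field_lin_sum[OF U] vert_sum Z_VF Z_at)

lemma sharp_VF: "VF (sharp df)"
  unfolding sharp_def by (intro field_add[OF U] HF_VF[OF hsharp_HF] VertF_VF[OF vsharp_VertF])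

context
  fixes p assumes p: "p \<in> U"
begin

lemma g_hsharp: "l < n \<Longrightarrow> g p (hsharp df p) (X l p) = X l p f"
  unfolding hsharp_df by (subst g_sum_left) (auto simp: X_tangent p g_frame if_distrib cong: if_cong)

lemma g_vsharp: "l < m \<Longrightarrow> g p (vsharp df p) (Z l p) = Z l p f"
  unfolding vsharp_df by (subst g_sum_left) (auto simp: Z_tangent p g_frame if_distrib cong: if_cong)

lemma g_sharp: "l < n \<Longrightarrow> g p (sharp df p) (X l p) = X l p f"
  using g_add_left[OF VF_tangent[OF HF_VF[OF hsharp_HF] p] VF_tangent[OF VertF_VF[OF vsharp_VertF] p], of "X l p"]
    g_hsharp vert_horiz[OF X_at[OF _ p] VertF_at[OF vsharp_VertF p]]
  by (simp add: sharp_def X_tangent p)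

lemma delta_T_apply_sharp:
  "delta_T (sharp df) p k = (\<Sum>l<n. X l p f * delta_T (X l) p k)"
proof -
  have "nabla_torsion (X i) (X i) (sharp df) p k = (\<Sum>l<n. X l p f * nabla_torsion (X i) (X i) (X l) p k)"
    if i: "i < n" for i
    using tensorial_expand[OF tensorial_nabla_torsion[OF X_VF[OF i] X_VF[OF i] p] sharp_VF p, of k]
      nabla_torsion_vertical[OF X_VF[OF i] X_VF[OF i] Z_VertF p] by (simp add: g_sharp)
  then have "delta_T (sharp df) p k = (\<Sum>i<n. \<Sum>l<n. X l p f * nabla_torsion (X i) (X i) (X l) p k)"
    by (simp add: delta_T_def)
  also have "\<dots> = (\<Sum>l<n. \<Sum>i<n. X l p f * nabla_torsion (X i) (X i) (X l) p k)" by (rule sum.swap)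
  finally show ?thesis by (simp add: delta_T_def sum_distrib_left)
qed

lemma g_torsion_sharp:
  "VF V \<Longrightarrow> w \<in> tangent A p \<Longrightarrow> g p w (torsion V (sharp df) p) = (\<Sum>l<n. X l p f * g p w (torsion V (X l) p))"
  using g_torsion_expand[OF _ sharp_VF p] by (simp add: g_sharp)

text \<open>By \<open>g_nabla_J\<close> the divergence of \<open>J\<close> is dual to the divergence
  of the torsion. This sum occurs in the rough Laplacian with factor
  \<open>- 1 / \<epsilon>\<close>, and \<open>1 / \<epsilon> * delta_T_form\<close> in
  \<open>box_eps\<close> cancels it; here the sign convention of \<open>delta_T\<close>
  matters.\<close>

lemma sum_nabla_J:
  assumes Y: "VF Y"
  shows "(\<Sum>i<n. nabla (X i) (J_map Y (X i)) p f - J_map (nabla (X i) Y) (X i) p f - J_map Y (nabla (X i) (X i)) p f)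
    = delta_T_form df Y p"
proof -
  note tY = VF_tangent[OF Y p]
  have "nabla (X i) (J_map Y (X i)) p f - J_map (nabla (X i) Y) (X i) p f - J_map Y (nabla (X i) (X i)) p f
      = (\<Sum>l<n. g p (Y p) (nabla_torsion (X i) (X i) (X l) p) * X l p f)" if i: "i < n" for i
  proof -
    note Xi = X_VF[OF i]
    let ?v = "\<lambda>k. nabla (X i) (J_map Y (X i)) p k - J_map (nabla (X i) Y) (X i) p k - J_map Y (nabla (X i) (X i)) p k"
    have "?v \<in> horiz A B g p"
      by (intro horiz_diff HF_at[OF _ p] nabla_HF J_HF nabla_VF Xi Y)
    then have "?v f = (\<Sum>l<n. g p ?v (X l p) * X l p f)" by (rule horiz_apply[OF _ p])
    also have "\<dots> = (\<Sum>l<n. g p (Y p) (nabla_torsion (X i) (X i) (X l) p) * X l p f)"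
      by (intro sum.cong refl) (simp add: g_nabla_J[OF Xi Y Xi X_VF p])
    finally show ?thesis .
  qed
  then have "(\<Sum>i<n. nabla (X i) (J_map Y (X i)) p f - J_map (nabla (X i) Y) (X i) p f - J_map Y (nabla (X i) (X i)) p f)
      = (\<Sum>i<n. \<Sum>l<n. g p (Y p) (nabla_torsion (X i) (X i) (X l) p) * X l p f)" by simp
  also have "\<dots> = (\<Sum>i<n. g p (nabla_torsion (X i) (X i) (sharp df) p) (Y p))"
  proof (intro sum.cong refl)
    fix i assume "i \<in> {..<n}"
    then have Xi: "VF (X i)" by (simp add: X_VF)
    have "tensorial_at p (\<lambda>W. g p (Y p) (nabla_torsion (X i) (X i) W p))"
      by (rule tensorial_g[where F = "\<lambda>W. nabla_torsion (X i) (X i) W"])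
        (auto intro: tY tensorial_nabla_torsion nabla_torsion_tangent Xi p)
    from tensorial_expand[OF this sharp_VF p]
    show "(\<Sum>l<n. g p (Y p) (nabla_torsion (X i) (X i) (X l) p) * X l p f)
        = g p (nabla_torsion (X i) (X i) (sharp df) p) (Y p)"
      using nabla_torsion_vertical[OF Xi Xi Z_VertF p]
        g_sym[OF tY nabla_torsion_tangent[OF Xi Xi sharp_VF p]]
      by (simp add: g_sharp g_zero_right tY mult.commute)
  qed
  also have "\<dots> = (\<Sum>i<n. 1 * g p (nabla_torsion (X i) (X i) (sharp df) p) (Y p))" by simp
  also have "\<dots> = g p (\<lambda>k. \<Sum>i<n. 1 * nabla_torsion (X i) (X i) (sharp df) p k) (Y p)"
    by (rule g_sum_left[symmetric]) (auto intro: nabla_torsion_tangent X_VF sharp_VF p tY)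
  finally show ?thesis by (simp add: delta_T_form_def flat_def delta_T_def)
qed

text \<open>With the subscript \<open>torsion (X i) Y\<close>, the frame formula for
  \<open>J\<close> becomes the quadratic torsion expression of \<open>g_J_sq\<close>. This is the
  part of the rough Laplacian that the \<open>J_sq_form\<close> term of \<open>box_eps\<close>
  cancels.\<close>

lemma sum_J_torsion:
  assumes Y: "VF Y"
  shows "(\<Sum>i<n. J_map (torsion (X i) Y) (X i) p f) = - J_sq_form df Y p"
  unfolding J_sq_form_def flat_def g_J_sq[OF sharp_VF Y p] minus_minus
proof (intro sum.cong refl)
  fix i assume "i \<in> {..<n}"
  then have Xi: "VF (X i)" by (simp add: X_VF)
  show "J_map (torsion (X i) Y) (X i) p f = g p (torsion (X i) Y p) (torsion (X i) (sharp df) p)"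
    using J_at[OF torsion_VF[OF Xi Y] Xi p] g_torsion_sharp[OF Xi torsion_tangent[OF Xi Y p]]
    by (simp add: mult.commute)
qed

text \<open>Pair symmetry followed by skewness brings \<open>Y\<close> into the slot it has in
  \<open>Ric\<close>. The vertical part of \<open>Y\<close> contributes nothing by
  \<open>curvature_vertical_direction\<close>, and the vertical half of the trace in
  \<open>Ric\<close> vanishes because the curvature preserves the horizontal bundle.\<close>

lemma sum_curvature:
  assumes Y: "VF Y"
  shows "(\<Sum>i<n. curvature (X i) Y (X i) p f) = - Ric_H_form df Y p"
proof -
  note hY = hpart_HF[OF Y]
  have *: "curvature (X i) Y (X i) p f = - g p (curvature (X i) (hsharp df) (hpart Y) p) (X i p)"
    if i: "i < n" for i
  proof -
    note Xi = X_VF[OF i]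
    have coeff: "g p (curvature (X i) Y (X i) p) (X l p) = - g p (curvature (X i) (X l) (hpart Y) p) (X i p)"
      if l: "l < n" for l
    proof -
      note Xl = X_VF[OF l]
      have "tensorial_at p (\<lambda>Y. g p (curvature (X i) Y (X i) p) (X l p))"
        by (rule tensorial_g_left[where F = "\<lambda>Y. curvature (X i) Y (X i)"])
          (auto intro: X_tangent l p tensorial_curvature curvature_tangent Xi)
      from tensorial_parts[OF this Y p]
      have "g p (curvature (X i) Y (X i) p) (X l p) = g p (curvature (X i) (hpart Y) (X i) p) (X l p)"
        using curvature_vertical_direction[OF X_HF[OF i] X_HF[OF i] X_HF[OF l] vpart_VertF[OF Y] p] by simp
      also have "\<dots> = g p (curvature (X i) (X l) (X i) p) (hpart Y p)"
        by (rule curvature_pair_symmetric[OF X_HF[OF i] hY X_HF[OF i] X_HF[OF l] p])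
      also have "\<dots> = - g p (X i p) (curvature (X i) (X l) (hpart Y) p)"
        by (rule curvature_skew[OF Xi Xl Xi HF_VF[OF hY] p])
      finally show ?thesis
        using g_sym[OF X_tangent[OF i p] curvature_tangent[OF Xi Xl HF_VF[OF hY] p]] by simp
    qed
    have "curvature (X i) Y (X i) p f = (\<Sum>l<n. g p (curvature (X i) Y (X i) p) (X l p) * X l p f)"
      by (rule horiz_apply[OF curvature_horiz[OF Xi Y X_HF[OF i] p] p])
    also have "\<dots> = - (\<Sum>l<n. g p (hsharp df p) (X l p) * g p (curvature (X i) (X l) (hpart Y) p) (X i p))"
      unfolding sum_negf[symmetric] by (intro sum.cong refl) (simp add: coeff g_hsharp)
    also have "tensorial_at p (\<lambda>W. g p (curvature (X i) W (hpart Y) p) (X i p))"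
      by (rule tensorial_g_left[where F = "\<lambda>W. curvature (X i) W (hpart Y)"])
        (auto intro: X_tangent i p tensorial_curvature curvature_tangent Xi HF_VF hY)
    then have "(\<Sum>l<n. g p (hsharp df p) (X l p) * g p (curvature (X i) (X l) (hpart Y) p) (X i p))
        = g p (curvature (X i) (hsharp df) (hpart Y) p) (X i p)"
      by (rule tensorial_expand_HF[OF _ hsharp_HF p, symmetric])
    finally show ?thesis .
  qed
  have "g p (curvature (Z j) (hsharp df) (hpart Y) p) (Z j p) = 0" if "j < m" for j
    by (rule horiz_vert[OF curvature_horiz[OF Z_VF[OF that] HF_VF[OF hsharp_HF] hY p] Z_at[OF that p]])
  then show ?thesis by (simp add: * Ric_H_form_def Ric_def sum_negf)
qed

lemma nabla_eps_form_df:
  assumes V: "VF V" and Y: "VF Y"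
  shows "q \<in> U \<Longrightarrow> nabla_eps_form \<epsilon> V df Y q = hess f Y V q - 1 / \<epsilon> * J_map Y V q f"
  using hess_comm[OF f, of q Y V]
  by (simp add: nabla_eps_form_def T_eps_form_def nabla_form_differential)
    (simp add: differential_def T_eps_def)

lemma tensorial_T_eps:
  assumes "tensorial_at p \<tau>" and V: "VF V" and Y: "VF Y"
  shows "\<tau> (T_eps \<epsilon> V Y) = \<tau> (torsion V Y) - 1 / \<epsilon> * \<tau> (J_map Y V)"
  unfolding T_eps_def
  using tensorial_diff[OF assms(1) torsion_VF[OF V Y] field_cscale[OF U J_VF[OF Y V], of "1 / \<epsilon>"]]
    tensorial_cscale[OF assms(1) J_VF[OF Y V], of "1 / \<epsilon>"] by simp

lemma T_eps_VF: "VF V \<Longrightarrow> VF Y \<Longrightarrow> VF (T_eps \<epsilon> V Y)"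
  unfolding T_eps_def by (intro field_diff[OF U] torsion_VF field_cscale[OF U] J_VF)

text \<open>A term with \<open>1 / \<epsilon>\<^sup>2\<close> could only be \<open>J\<close> with
  the horizontal subscript \<open>J_map Y (X i)\<close>, which is zero. The three groups with
  \<open>1 / \<epsilon>\<close> are kept apart because each is evaluated for a different reason once
  summed over \<open>i\<close>.\<close>

lemma rough_laplacian_summand:
  assumes i: "i < n" and Y: "VF Y"
  shows "nabla_eps_form \<epsilon> (X i) (nabla_eps_form \<epsilon> (X i) df) Y p - nabla_eps_form \<epsilon> (nabla (X i) (X i)) df Y p
   = (X i p (hess f Y (X i)) - hess f (nabla (X i) Y) (X i) p - hess f Y (nabla (X i) (X i)) p
       + hess f (torsion (X i) Y) (X i) p)
     - 1 / \<epsilon> * (nabla (X i) (J_map Y (X i)) p f - J_map (nabla (X i) Y) (X i) p f - J_map Y (nabla (X i) (X i)) p f)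
     - 1 / \<epsilon> * (hess f (X i) (J_map Y (X i)) p + hess f (J_map Y (X i)) (X i) p)
     - 1 / \<epsilon> * J_map (torsion (X i) Y) (X i) p f"
proof -
  note Xi = X_VF[OF i]
  let ?\<omega> = "nabla_eps_form \<epsilon> (X i) df"
  have "X i p (?\<omega> Y) = X i p (\<lambda>q. hess f Y (X i) q - 1 / \<epsilon> * J_map Y (X i) q f)"
    by (rule deriv_cong[OF Xi p nabla_eps_form_df[OF Xi Y]])
  also have "\<dots> = X i p (hess f Y (X i)) - X i p (\<lambda>q. 1 / \<epsilon> * J_map Y (X i) q f)"
    by (rule deriv_diff[OF Xi p hess_SF[OF f Y Xi] smooth_fun_cmult[OF VF_SF[OF J_VF[OF Y Xi] f]]])
  also have "X i p (\<lambda>q. 1 / \<epsilon> * J_map Y (X i) q f) = 1 / \<epsilon> * X i p (\<lambda>q. J_map Y (X i) q f)"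
    by (rule deriv_cmult[OF Xi p VF_SF[OF J_VF[OF Y Xi] f]])
  also have "X i p (\<lambda>q. J_map Y (X i) q f) = hess f (X i) (J_map Y (X i)) p + nabla (X i) (J_map Y (X i)) p f"
    by (simp add: hess_def)
  finally have 1: "X i p (?\<omega> Y) = X i p (hess f Y (X i))
      - 1 / \<epsilon> * (hess f (X i) (J_map Y (X i)) p + nabla (X i) (J_map Y (X i)) p f)" .
  have 2: "?\<omega> (nabla (X i) Y) p = hess f (nabla (X i) Y) (X i) p - 1 / \<epsilon> * J_map (nabla (X i) Y) (X i) p f"
    by (rule nabla_eps_form_df[OF Xi nabla_VF[OF Xi Y] p])
  have "?\<omega> (T_eps \<epsilon> (X i) Y) p = hess f (T_eps \<epsilon> (X i) Y) (X i) p - 1 / \<epsilon> * J_map (T_eps \<epsilon> (X i) Y) (X i) p f"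
    by (rule nabla_eps_form_df[OF Xi T_eps_VF[OF Xi Y] p])
  then have 3: "?\<omega> (T_eps \<epsilon> (X i) Y) p
      = (hess f (torsion (X i) Y) (X i) p - 1 / \<epsilon> * hess f (J_map Y (X i)) (X i) p)
        - 1 / \<epsilon> * J_map (torsion (X i) Y) (X i) p f"
    using tensorial_T_eps[OF tensorial_hess_left[OF f Xi p] Xi Y, of \<epsilon>]
      tensorial_T_eps[OF tensorial_J_left[OF Xi p, of f] Xi Y, of \<epsilon>]
      J_horizontal_left[OF J_HF[OF Y Xi] Xi p] by simp
  have 4: "nabla_eps_form \<epsilon> (nabla (X i) (X i)) df Y p
      = hess f Y (nabla (X i) (X i)) p - 1 / \<epsilon> * J_map Y (nabla (X i) (X i)) p f"
    by (rule nabla_eps_form_df[OF nabla_VF[OF Xi Xi] Y p])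
  have "nabla_eps_form \<epsilon> (X i) ?\<omega> Y p = X i p (?\<omega> Y) - ?\<omega> (nabla (X i) Y) p + ?\<omega> (T_eps \<epsilon> (X i) Y) p"
    by (simp add: nabla_eps_form_def[of \<epsilon> "X i" ?\<omega>] nabla_form_def T_eps_form_def)
  then show ?thesis unfolding 1 2 3 4 by (simp only: algebra_simps)
qed

lemma box_eps_df:
  assumes Y: "VF Y"
  shows "box_eps \<epsilon> df Y p = (\<Sum>i<n. X i p (hess f Y (X i)) - hess f (nabla (X i) Y) (X i) p
      - hess f Y (nabla (X i) (X i)) p + hess f (torsion (X i) Y) (X i) p) - Ric_H_form df Y p"
proof -
  \<comment> \<open>\<open>J_map Y\<close> is skew, so its contraction with the symmetrised Hessian
    is zero.\<close>
  have "(\<Sum>i<n. hess f (J_map Y (X i)) (X i) p) + (\<Sum>i<n. hess f (X i) (J_map Y (X i)) p) = 0"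
    by (rule skew_sum[of p "\<lambda>V W. hess f V W p"])
      (auto intro: tensorial_hess_left tensorial_hess_right f p J_HF J_skew Y X_VF)
  then have z: "(\<Sum>i<n. hess f (X i) (J_map Y (X i)) p + hess f (J_map Y (X i)) (X i) p) = 0"
    by (simp add: sum.distrib)
  have "rough_laplacian \<epsilon> df Y p = (\<Sum>i<n. X i p (hess f Y (X i)) - hess f (nabla (X i) Y) (X i) p
      - hess f Y (nabla (X i) (X i)) p + hess f (torsion (X i) Y) (X i) p)
      - 1 / \<epsilon> * delta_T_form df Y p + 1 / \<epsilon> * J_sq_form df Y p"
  proof -
    have split: "(\<Sum>i<n. a i - c * b i - c * d i - c * e i)
        = (\<Sum>i<n. a i) - c * (\<Sum>i<n. b i) - c * (\<Sum>i<n. d i) - c * (\<Sum>i<n. e i)" for a b d e and c :: real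
      by (simp add: sum_subtractf sum_distrib_left)
    have "rough_laplacian \<epsilon> df Y p = (\<Sum>i<n. (X i p (hess f Y (X i)) - hess f (nabla (X i) Y) (X i) p
       - hess f Y (nabla (X i) (X i)) p + hess f (torsion (X i) Y) (X i) p)
     - 1 / \<epsilon> * (nabla (X i) (J_map Y (X i)) p f - J_map (nabla (X i) Y) (X i) p f - J_map Y (nabla (X i) (X i)) p f)
     - 1 / \<epsilon> * (hess f (X i) (J_map Y (X i)) p + hess f (J_map Y (X i)) (X i) p)
     - 1 / \<epsilon> * J_map (torsion (X i) Y) (X i) p f)"
      unfolding rough_laplacian_def
      by (intro sum.cong refl rough_laplacian_summand Y) simp
    then show "?thesis"
      unfolding split sum_nabla_J[OF Y] sum_J_torsion[OF Y] z by simp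
  qed
  then show ?thesis by (simp add: box_eps_def)
qed

text \<open>The frame is not parallel, but \<open>nabla Y (X i)\<close> has a skew matrix in it, so
  the Hessian terms it produces when the trace is differentiated cancel after summation. Rewriting
  the bracket of \<open>ricci_identity\<close> through the torsion supplies the term
  \<open>hess f (torsion (X i) Y) (X i)\<close>.\<close>

lemma hor_laplacian_commutes:
  assumes Y: "VF Y" shows "Y p (hor_laplacian f) = box_eps \<epsilon> df Y p"
proof -
  have *: "X i p (hess f Y (X i)) - hess f (nabla (X i) Y) (X i) p - hess f Y (nabla (X i) (X i)) p
      + hess f (torsion (X i) Y) (X i) p
    = Y p (hess f (X i) (X i)) - (hess f (nabla Y (X i)) (X i) p + hess f (X i) (nabla Y (X i)) p)
      - curvature (X i) Y (X i) p f" if i: "i < n" for i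
  proof -
    note Xi = X_VF[OF i]
    have "lie A (X i) Y = (\<lambda>q k. nabla (X i) Y q k - nabla Y (X i) q k - torsion (X i) Y q k)"
      by (simp add: torsion_def)
    then have "hess f (lie A (X i) Y) (X i) p
        = hess f (nabla (X i) Y) (X i) p - hess f (nabla Y (X i)) (X i) p - hess f (torsion (X i) Y) (X i) p"
      using tensorial_diff[OF tensorial_hess_left[OF f Xi p] field_diff[OF U nabla_VF[OF Xi Y] nabla_VF[OF Y Xi]] torsion_VF[OF Xi Y]]
        tensorial_diff[OF tensorial_hess_left[OF f Xi p] nabla_VF[OF Xi Y] nabla_VF[OF Y Xi]] by simp
    then show ?thesis using ricci_identity[OF f Xi Y Xi p] by simp
  qed
  have "(\<Sum>i<n. hess f (nabla Y (X i)) (X i) p) + (\<Sum>i<n. hess f (X i) (nabla Y (X i)) p) = 0"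
    by (rule skew_sum[of p "\<lambda>V W. hess f V W p"])
      (auto intro: tensorial_hess_left tensorial_hess_right f p nabla_HF nabla_skew_X Y X_VF X_HF)
  then have z: "(\<Sum>i<n. hess f (nabla Y (X i)) (X i) p + hess f (X i) (nabla Y (X i)) p) = 0"
    by (simp add: sum.distrib)
  have "Y p (hor_laplacian f) = Y p (\<lambda>q. \<Sum>i<n. hess f (X i) (X i) q)"
    by (simp add: hor_laplacian_hess[abs_def])
  also have "\<dots> = (\<Sum>i<n. Y p (hess f (X i) (X i)))"
    by (rule deriv_sum[OF Y p]) (auto intro: hess_SF f X_VF)
  finally show ?thesis
    unfolding box_eps_df[OF Y] using * z sum_curvature[OF Y] by (simp add: sum_subtractf)
qed

end

text \<open>\<open>E\<close> will be the horizontal or the vertical part of the frame.\<close>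

lemma hor_laplacian_norm_sq:
  fixes E :: "nat \<Rightarrow> 'a vfield"
  assumes E: "\<And>k. k < K \<Longrightarrow> VF (E k)"
    and expand: "\<And>V k \<tau> q. VF V \<Longrightarrow> k < K \<Longrightarrow> q \<in> U \<Longrightarrow> tensorial_at q \<tau> \<Longrightarrow>
      \<tau> (nabla V (E k)) = (\<Sum>l<K. g q (nabla V (E k) q) (E l q) * \<tau> (E l))"
    and skew: "\<And>V k l q. VF V \<Longrightarrow> k < K \<Longrightarrow> l < K \<Longrightarrow> q \<in> U \<Longrightarrow>
      g q (nabla V (E k) q) (E l q) = - g q (nabla V (E l) q) (E k q)"
    and p: "p \<in> U"
  shows "1 / 2 * hor_laplacian (\<lambda>q. \<Sum>k<K. E k q f * E k q f) p
    = (\<Sum>i<n. \<Sum>k<K. (hess f (X i) (E k) p)\<^sup>2)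
      + (\<Sum>k<K. E k p f * (\<Sum>i<n. X i p (hess f (X i) (E k)) - hess f (X i) (nabla (X i) (E k)) p
          - hess f (nabla (X i) (X i)) (E k) p))"
proof -
  let ?h = "\<lambda>i k. hess f (X i) (E k)" and ?N = "\<lambda>i k. nabla (X i) (E k)"
  let ?d = "\<lambda>i k. X i p (?h i k) - hess f (X i) (?N i k) p - hess f (nabla (X i) (X i)) (E k) p"
  let ?u = "\<lambda>q. \<Sum>k<K. E k q f * E k q f"
  have Ef: "SF (\<lambda>q. E k q f)" if "k < K" for k by (rule VF_SF[OF E[OF that] f])
  have d: "V q (\<lambda>r. E k r f) = hess f V (E k) q + nabla V (E k) q f" for V k q
    by (simp add: hess_def)
  have Vu: "V q ?u = (\<Sum>k<K. 2 * (E k q f * hess f V (E k) q))" if V: "VF V" and q: "q \<in> U" for V q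
  proof -
    have "V q ?u = (\<Sum>k<K. V q (\<lambda>r. E k r f * E k r f))"
      by (rule deriv_sum[OF V q]) (auto intro: smooth_fun_mult Ef)
    also have "\<dots> = (\<Sum>k<K. 2 * (E k q f * hess f V (E k) q) + 2 * (E k q f * nabla V (E k) q f))"
      by (intro sum.cong refl) (simp add: deriv_mult[OF V q Ef Ef] d algebra_simps)
    also have "\<dots> = (\<Sum>k<K. 2 * (E k q f * hess f V (E k) q))
        + 2 * (\<Sum>k<K. \<Sum>l<K. g q (nabla V (E k) q) (E l q) * (E l q f * E k q f))"
      by (simp add: sum.distrib sum_distrib_left expand[OF V _ q tensorial_id] algebra_simps)
    also have "(\<Sum>k<K. \<Sum>l<K. g q (nabla V (E k) q) (E l q) * (E l q f * E k q f)) = 0"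
      using skew_trace[of K "\<lambda>k l. g q (nabla V (E k) q) (E l q)" "\<lambda>l k. E l q f * E k q f", OF skew[OF V _ _ q]]
      by (simp add: mult.commute)
    finally show ?thesis by simp
  qed
  have XX: "X i p (\<lambda>q. X i q ?u) = 2 * (\<Sum>k<K. (?h i k p)\<^sup>2)
      + 2 * (\<Sum>k<K. E k p f * (X i p (?h i k) - hess f (X i) (?N i k) p))"
    if i: "i < n" for i
  proof -
    note Xi = X_VF[OF i]
    have s: "SF (\<lambda>q. E k q f * ?h i k q)" if "k < K" for k
      by (rule smooth_fun_mult[OF Ef[OF that] hess_SF[OF f Xi E[OF that]]])
    have "X i p (\<lambda>q. X i q ?u) = X i p (\<lambda>q. \<Sum>k<K. 2 * (E k q f * ?h i k q))"
      by (rule deriv_cong[OF Xi p Vu[OF Xi]])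
    also have "\<dots> = (\<Sum>k<K. X i p (\<lambda>q. 2 * (E k q f * ?h i k q)))"
      by (rule deriv_sum[OF Xi p]) (auto intro: smooth_fun_cmult s)
    also have "\<dots> = (\<Sum>k<K. 2 * (E k p f * X i p (?h i k)
        + ?h i k p * (?h i k p + ?N i k p f)))"
    proof (intro sum.cong refl)
      fix k assume "k \<in> {..<K}"
      then have k: "k < K" by simp
      show "X i p (\<lambda>q. 2 * (E k q f * ?h i k q)) = 2 * (E k p f * X i p (?h i k)
        + ?h i k p * (?h i k p + ?N i k p f))"
        using deriv_cmult[OF Xi p s[OF k], of 2] deriv_mult[OF Xi p Ef[OF k] hess_SF[OF f Xi E[OF k]]]
        by (simp add: d)
    qed
    also have "\<dots> = (\<Sum>k<K. 2 * (?h i k p)\<^sup>2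
        + 2 * (E k p f * (X i p (?h i k) - hess f (X i) (?N i k) p))
        + 2 * (?h i k p * ?N i k p f + E k p f * hess f (X i) (?N i k) p))"
      by (intro sum.cong refl) (simp add: power2_eq_square algebra_simps)
    also have "\<dots> = 2 * (\<Sum>k<K. (?h i k p)\<^sup>2)
        + 2 * (\<Sum>k<K. E k p f * (X i p (?h i k) - hess f (X i) (?N i k) p))
        + 2 * ((\<Sum>k<K. ?h i k p * ?N i k p f) + (\<Sum>k<K. E k p f * hess f (X i) (?N i k) p))"
      by (simp only: sum.distrib sum_distrib_left[symmetric])
    \<comment> \<open>Covariant derivatives of \<open>E k\<close> stay in the span of
      \<open>E\<close> with skew coefficients, so after expansion the two double sums are
      opposite.\<close>
    also have "(\<Sum>k<K. ?h i k p * ?N i k p f) + (\<Sum>k<K. E k p f * hess f (X i) (?N i k) p) = 0"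
    proof -
      have "(\<Sum>k<K. ?h i k p * ?N i k p f)
          = (\<Sum>k<K. \<Sum>l<K. g p (?N i k p) (E l p) * (E l p f * ?h i k p))"
        by (intro sum.cong refl) (simp add: expand[OF Xi _ p tensorial_id] sum_distrib_left algebra_simps)
      moreover have "(\<Sum>k<K. E k p f * hess f (X i) (?N i k) p)
          = (\<Sum>k<K. \<Sum>l<K. g p (?N i k p) (E l p) * (E k p f * hess f (X i) (E l) p))"
        by (intro sum.cong refl)
          (simp add: expand[OF Xi _ p tensorial_hess_right[OF f Xi p]] sum_distrib_left algebra_simps)
      ultimately show ?thesis
        using skew_trace[of K "\<lambda>k l. g p (?N i k p) (E l p)" "\<lambda>l k. E l p f * ?h i k p",
            OF skew[OF Xi _ _ p]] by simp
    qed
    finally show ?thesis by simp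
  qed
  have "hor_laplacian ?u p = (\<Sum>i<n. 2 * (\<Sum>k<K. (?h i k p)\<^sup>2)
      + 2 * (\<Sum>k<K. E k p f * ?d i k))"
    unfolding hor_laplacian_def
  proof (intro sum.cong refl)
    fix i assume "i \<in> {..<n}"
    then have i: "i < n" by simp
    show "X i p (\<lambda>q. X i q ?u) - nabla (X i) (X i) p ?u = 2 * (\<Sum>k<K. (?h i k p)\<^sup>2)
      + 2 * (\<Sum>k<K. E k p f * ?d i k)"
      unfolding XX[OF i] Vu[OF nabla_VF[OF X_VF[OF i] X_VF[OF i]] p]
      by (simp add: sum_distrib_left sum_subtractf right_diff_distrib)
  qed
  also have "\<dots> = 2 * (\<Sum>i<n. \<Sum>k<K. (?h i k p)\<^sup>2)
      + 2 * (\<Sum>i<n. \<Sum>k<K. E k p f * ?d i k)"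
    by (simp only: sum.distrib sum_distrib_left[symmetric])
  also have "(\<Sum>i<n. \<Sum>k<K. E k p f * ?d i k)
      = (\<Sum>k<K. \<Sum>i<n. E k p f * ?d i k)"
    by (rule sum.swap)
  finally show ?thesis unfolding sum_distrib_left[symmetric] by linarith
qed

section \<open>Bochner formulas for the horizontal and the vertical energy, and the resulting
  inequality\<close>

context
  fixes p assumes p: "p \<in> U"
begin

text \<open>The rough Laplacian on the left has the slots of the Hessian in the order opposite to
  \<open>box_eps_df\<close>, and every exchange costs a torsion term. Three of these assemble to the
  divergence of the torsion. The mixed Hessian with \<open>torsion (X i) Y\<close> occurs twice:
  once from differentiating that field and once from the torsion term inside
  \<open>box_eps_df\<close>.\<close>

lemma bochner_summand:
  assumes Y: "VF Y"
  shows "(\<Sum>i<n. X i p (hess f (X i) Y) - hess f (X i) (nabla (X i) Y) p - hess f (nabla (X i) (X i)) Y p)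
    = box_eps \<epsilon> df Y p + Ric_H_form df Y p - delta_T Y p f - 2 * (\<Sum>i<n. hess f (X i) (torsion (X i) Y) p)"
proof -
  have *: "X i p (hess f (X i) Y) - hess f (X i) (nabla (X i) Y) p - hess f (nabla (X i) (X i)) Y p
    = (X i p (hess f Y (X i)) - hess f (nabla (X i) Y) (X i) p - hess f Y (nabla (X i) (X i)) p
        + hess f (torsion (X i) Y) (X i) p)
      - nabla_torsion (X i) (X i) Y p f - 2 * hess f (X i) (torsion (X i) Y) p" if i: "i < n" for i
  proof -
    note Xi = X_VF[OF i]
    have "X i p (hess f (X i) Y) = X i p (\<lambda>q. hess f Y (X i) q - torsion (X i) Y q f)"
      by (rule deriv_cong[OF Xi p]) (simp add: hess_comm[OF f, of _ Y "X i"])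
    also have "\<dots> = X i p (hess f Y (X i)) - X i p (\<lambda>q. torsion (X i) Y q f)"
      by (rule deriv_diff[OF Xi p hess_SF[OF f Y Xi] VF_SF[OF torsion_VF[OF Xi Y] f]])
    also have "X i p (\<lambda>q. torsion (X i) Y q f) = hess f (X i) (torsion (X i) Y) p + nabla (X i) (torsion (X i) Y) p f"
      by (simp add: hess_def)
    finally have "X i p (hess f (X i) Y) = X i p (hess f Y (X i))
        - (hess f (X i) (torsion (X i) Y) p + nabla (X i) (torsion (X i) Y) p f)" .
    moreover have "hess f (torsion (X i) Y) (X i) p = hess f (X i) (torsion (X i) Y) p"
      using hess_comm[OF f p, of "torsion (X i) Y" "X i"]
        torsion_vertical_right[OF torsion_VertF[OF Xi Y] Xi p] by simp
    ultimately show ?thesis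
      using hess_comm[OF f p, of "nabla (X i) Y" "X i"] hess_comm[OF f p, of Y "nabla (X i) (X i)"]
      by (simp add: nabla_torsion_def)
  qed
  show ?thesis
    unfolding box_eps_df[OF p Y] delta_T_def using *
    by (simp add: sum_subtractf sum_distrib_left)
qed

text \<open>Each correction in \<open>bochner_summand\<close> is a torsion or a curvature of the
  horizontal bundle with a vertical argument, and vanishes.\<close>

lemma bochner_vertical:
  assumes j: "j < m"
  shows "(\<Sum>i<n. X i p (hess f (X i) (Z j)) - hess f (X i) (nabla (X i) (Z j)) p - hess f (nabla (X i) (X i)) (Z j) p)
    = box_eps \<epsilon> df (Z j) p"
proof -
  note Zj = Z_VF[OF j]
  have "curvature (X i) (Z j) (X i) p f = 0" if i: "i < n" for i
    using horiz_apply[OF curvature_horiz[OF X_VF[OF i] Zj X_HF[OF i] p] p, of f]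
      curvature_vertical_direction[OF X_HF[OF i] X_HF[OF i] X_HF Z_VertF[OF j] p] by simp
  then have "Ric_H_form df (Z j) p = 0" using sum_curvature[OF p Zj] by simp
  moreover have "delta_T (Z j) p f = 0"
    by (simp add: delta_T_def nabla_torsion_vertical[OF X_VF X_VF Z_VertF[OF j] p])
  moreover have "hess f (X i) (torsion (X i) (Z j)) p = 0" if i: "i < n" for i
    using tensorial_cong[OF tensorial_hess_right[OF f X_VF[OF i] p] p torsion_VF[OF X_VF[OF i] Zj]
        torsion_vertical_right[OF Z_VertF[OF j] X_VF[OF i]]]
      tensorial_zero[OF tensorial_hess_right[OF f X_VF[OF i] p]] by simp
  ultimately show ?thesis unfolding bochner_summand[OF Zj, of \<epsilon>] by simp
qed

lemma hor_laplacian_norm_sq_H: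
  "1 / 2 * hor_laplacian (inner_H df df) p
    = (\<Sum>i<n. \<Sum>k<n. (hess f (X i) (X k) p)\<^sup>2)
      + (\<Sum>k<n. X k p f * (box_eps \<epsilon> df (X k) p + Ric_H_form df (X k) p - delta_T (X k) p f
          - 2 * (\<Sum>i<n. hess f (X i) (torsion (X i) (X k)) p)))"
proof -
  have "inner_H df df = (\<lambda>q. \<Sum>k<n. X k q f * X k q f)"
    by (simp add: inner_H_def differential_def fun_eq_iff)
  then show ?thesis
    using hor_laplacian_norm_sq[of n X, OF X_VF tensorial_expand_HF[OF _ nabla_HF[OF _ X_HF]] nabla_skew_X p]
    by (simp add: bochner_summand[OF X_VF, of _ \<epsilon>])
qed

lemma hor_laplacian_norm_sq_V:
  "1 / 2 * hor_laplacian (inner_V df df) p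
    = (\<Sum>i<n. \<Sum>j<m. (hess f (X i) (Z j) p)\<^sup>2) + (\<Sum>j<m. Z j p f * box_eps \<epsilon> df (Z j) p)"
proof -
  have "inner_V df df = (\<lambda>q. \<Sum>k<m. Z k q f * Z k q f)"
    by (simp add: inner_V_def differential_def fun_eq_iff)
  then show ?thesis
    using hor_laplacian_norm_sq[of m Z, OF Z_VF tensorial_expand_VertF[OF _ nabla_VertF[OF _ Z_VertF]] nabla_skew_Z p]
    by (simp add: bochner_vertical[of _ \<epsilon>])
qed

lemma hor_laplacian_inner_eps:
  "hor_laplacian (inner_eps \<epsilon> df df) p = hor_laplacian (inner_H df df) p + \<epsilon> * hor_laplacian (inner_V df df) p"
proof -
  have H: "SF (inner_H df df)" unfolding inner_H_def[abs_def] differential_def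
    using VF_SF[OF X_VF f] by (intro smooth_fun_sum[OF U] smooth_fun_mult) auto
  have V: "SF (inner_V df df)" unfolding inner_V_def[abs_def] differential_def
    using VF_SF[OF Z_VF f] by (intro smooth_fun_sum[OF U] smooth_fun_mult) auto
  have W: "W q (inner_eps \<epsilon> df df) = W q (inner_H df df) + \<epsilon> * W q (inner_V df df)" if "VF W" "q \<in> U" for W q
    unfolding inner_eps_def[abs_def]
    using deriv_add[OF that H smooth_fun_cmult[OF V]] deriv_cmult[OF that V] by simp
  have "X i p (\<lambda>q. X i q (inner_eps \<epsilon> df df)) = X i p (\<lambda>q. X i q (inner_H df df)) + \<epsilon> * X i p (\<lambda>q. X i q (inner_V df df))"
    if i: "i < n" for i
  proof -
    note Xi = X_VF[OF i]
    have "X i p (\<lambda>q. X i q (inner_eps \<epsilon> df df)) = X i p (\<lambda>q. X i q (inner_H df df) + \<epsilon> * X i q (inner_V df df))"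
      by (rule deriv_cong[OF Xi p W[OF Xi]])
    then show ?thesis
      using deriv_add[OF Xi p VF_SF[OF Xi H] smooth_fun_cmult[OF VF_SF[OF Xi V]]] deriv_cmult[OF Xi p VF_SF[OF Xi V]]
      by simp
  qed
  then show ?thesis
    unfolding hor_laplacian_def
    by (simp add: W nabla_VF X_VF p sum.distrib sum_subtractf sum_distrib_left algebra_simps)
qed

lemma trace_nabla_sym_df: "trace_nabla_sym df p = (\<Sum>i<n. hess f (X i) (X i) p)"
  by (simp add: trace_nabla_sym_def nabla_sym_def nabla_form_differential)

lemma torsion_apply_vsharp:
  assumes "VF V" "VF W" shows "torsion V W p f = g p (vsharp df p) (torsion V W p)"
proof -
  note T = torsion_vert[OF assms p]
  have "g p (vsharp df p) (torsion V W p) = g p (vsharp df p) (vproj p (torsion V W p))"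
    using vproj_id[OF p T] by simp
  also have "\<dots> = (\<Sum>j<m. Z j p f * g p (torsion V W p) (Z j p))"
    using g_vproj_right[OF p VF_tangent[OF VertF_VF[OF vsharp_VertF] p] vert_tangent[OF T]]
    by (simp add: g_vsharp[OF p])
  finally show ?thesis using vert_apply[OF T p, of f] by (simp add: mult.commute)
qed

text \<open>The trace of the square of a skew map is minus its squared norm. The matrix entries are,
  by \<open>hess_comm\<close>, the differences of the Hessian under exchange of its slots.\<close>

lemma trace_J_sq_df: "trace_J_sq df p = - (\<Sum>i<n. \<Sum>k<n. (torsion (X i) (X k) p f)\<^sup>2)"
proof -
  let ?V = "vsharp df"
  note V = VertF_VF[OF vsharp_VertF]
  note tV = VF_tangent[OF V p]
  have "g p (J_map ?V (J_map ?V (X i)) p) (X i p) = - (\<Sum>k<n. (torsion (X i) (X k) p f)\<^sup>2)" if i: "i < n" for i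
  proof -
    note Xi = X_VF[OF i]
    have "g p (J_map ?V (J_map ?V (X i)) p) (X i p) = - g p (?V p) (torsion (X i) (J_map ?V (X i)) p)"
      using g_J[OF V J_VF[OF V Xi] Xi p] g_torsion_antisym[OF J_VF[OF V Xi] Xi p tV] by simp
    also have "\<dots> = - (\<Sum>k<n. g p (J_map ?V (X i) p) (X k p) * g p (?V p) (torsion (X i) (X k) p))"
      using g_torsion_expand[OF Xi J_VF[OF V Xi] p tV] by simp
    also have "(\<Sum>k<n. g p (J_map ?V (X i) p) (X k p) * g p (?V p) (torsion (X i) (X k) p))
        = (\<Sum>k<n. (torsion (X i) (X k) p f)\<^sup>2)"
      by (intro sum.cong refl) (simp add: g_J[OF V Xi X_VF p] torsion_apply_vsharp[OF Xi X_VF] power2_eq_square)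
    finally show ?thesis .
  qed
  then show ?thesis by (simp add: trace_J_sq_def sum_negf)
qed

text \<open>The divergence of the torsion has vertical values, so pairing it with \<open>df\<close>
  over the vertical frame amounts to applying it to \<open>f\<close>.\<close>

lemma inner_V_delta_T: "inner_V (delta_T_form df) df p = (\<Sum>k<n. X k p f * delta_T (X k) p f)"
proof -
  have "(\<lambda>k. \<Sum>i<n. 1 * nabla_torsion (X i) (X i) (sharp df) p k) \<in> vert A B p"
    by (rule vert_sum) (auto intro: nabla_torsion_vert X_VF sharp_VF f p)
  then have "delta_T (sharp df) p \<in> vert A B p" by (simp add: delta_T_def[abs_def])
  then have "delta_T (sharp df) p f = (\<Sum>j<m. g p (delta_T (sharp df) p) (Z j p) * Z j p f)"
    by (rule vert_apply[OF _ p])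
  then show ?thesis
    using delta_T_apply_sharp[OF p, of f] by (simp add: inner_V_def delta_T_form_def flat_def differential_def)
qed

theorem bochner_inequality:
  assumes \<epsilon>: "0 < \<epsilon>"
  shows "1 / 2 * hor_laplacian (inner_eps \<epsilon> df df) p - inner_eps \<epsilon> (box_eps \<epsilon> df) df p
    \<ge> 1 / real n * (trace_nabla_sym df p)\<^sup>2 - 1 / 4 * trace_J_sq df p
      + inner_H (Ric_H_form df) df p - inner_V (delta_T_form df) df p + 1 / \<epsilon> * inner_H (J_sq_form df) df p"
proof -
  define t where "t i j = (\<Sum>k<n. X k p f * g p (Z j p) (torsion (X i) (X k) p))" for i j
  define h where "h i j = hess f (X i) (Z j) p" for i j
  have dapp: "df V p = V p f" for V by (simp add: differential_def)
  have tsharp: "g p (Z j p) (torsion (X i) (sharp df) p) = t i j" if "i < n" "j < m" for i j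
    unfolding t_def using that by (intro g_torsion_sharp[OF p] X_VF Z_tangent p) auto
  have cross: "(\<Sum>k<n. X k p f * (\<Sum>i<n. hess f (X i) (torsion (X i) (X k)) p)) = (\<Sum>i<n. \<Sum>j<m. t i j * h i j)"
  proof -
    have "hess f (X i) (torsion (X i) (X k)) p = (\<Sum>j<m. g p (Z j p) (torsion (X i) (X k) p) * h i j)"
      if "i < n" "k < n" for i k
    proof -
      have "hess f (X i) (torsion (X i) (X k)) p = (\<Sum>j<m. g p (torsion (X i) (X k) p) (Z j p) * h i j)"
        unfolding h_def using that
        by (intro tensorial_expand_VertF[OF tensorial_hess_right[OF f]] torsion_VertF X_VF p) auto
      then show ?thesis
        using g_sym[OF torsion_tangent[OF X_VF[OF that(1)] X_VF[OF that(2)] p] Z_tangent[OF _ p]] by simp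
    qed
    then have "(\<Sum>k<n. X k p f * (\<Sum>i<n. hess f (X i) (torsion (X i) (X k)) p))
        = (\<Sum>k<n. \<Sum>i<n. \<Sum>j<m. X k p f * g p (Z j p) (torsion (X i) (X k) p) * h i j)"
      by (simp add: sum_distrib_left mult.assoc)
    also have "\<dots> = (\<Sum>i<n. \<Sum>k<n. \<Sum>j<m. X k p f * g p (Z j p) (torsion (X i) (X k) p) * h i j)"
      by (rule sum.swap)
    also have "\<dots> = (\<Sum>i<n. \<Sum>j<m. \<Sum>k<n. X k p f * g p (Z j p) (torsion (X i) (X k) p) * h i j)"
      by (intro sum.cong refl sum.swap)
    finally show ?thesis by (simp add: t_def sum_distrib_right)
  qed
  have J: "inner_H (J_sq_form df) df p = - (\<Sum>i<n. \<Sum>j<m. (t i j)\<^sup>2)"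
  proof -
    have "J_sq_form df (X k) p = - (\<Sum>i<n. \<Sum>j<m. g p (Z j p) (torsion (X i) (X k) p) * t i j)" if k: "k < n" for k
    proof -
      have "g p (torsion (X i) (X k) p) (torsion (X i) (sharp df) p)
          = (\<Sum>j<m. g p (Z j p) (torsion (X i) (X k) p) * t i j)" if i: "i < n" for i
      proof -
        note tt = torsion_tangent[OF X_VF[OF i] X_VF[OF k] p] torsion_tangent[OF X_VF[OF i] sharp_VF p]
        show ?thesis
          using g_vproj_right[OF p tt] vproj_id[OF p torsion_vert[OF X_VF[OF i] sharp_VF p]]
          by (simp add: g_sym[OF tt(1) Z_tangent[OF _ p]] g_sym[OF tt(2) Z_tangent[OF _ p]] tsharp[OF i])
      qed
      then show ?thesis
        using g_J_sq[OF sharp_VF X_VF[OF k] p] by (simp add: J_sq_form_def flat_def)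
    qed
    then have "inner_H (J_sq_form df) df p
        = - (\<Sum>k<n. \<Sum>i<n. \<Sum>j<m. X k p f * g p (Z j p) (torsion (X i) (X k) p) * t i j)"
      by (simp add: inner_H_def dapp sum_negf sum_distrib_left sum_distrib_right algebra_simps)
    also have "(\<Sum>k<n. \<Sum>i<n. \<Sum>j<m. X k p f * g p (Z j p) (torsion (X i) (X k) p) * t i j)
        = (\<Sum>i<n. \<Sum>k<n. \<Sum>j<m. X k p f * g p (Z j p) (torsion (X i) (X k) p) * t i j)"
      by (rule sum.swap)
    also have "\<dots> = (\<Sum>i<n. \<Sum>j<m. \<Sum>k<n. X k p f * g p (Z j p) (torsion (X i) (X k) p) * t i j)"
      by (intro sum.cong refl sum.swap)
    also have "\<dots> = (\<Sum>i<n. \<Sum>j<m. (t i j)\<^sup>2)"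
      by (simp only: sum_distrib_right[symmetric] t_def[symmetric] power2_eq_square)
    finally show ?thesis .
  qed
  have comm: "hess f (X k) (X i) p - hess f (X i) (X k) p = torsion (X i) (X k) p f" for i k
    using hess_comm[OF f p, of "X k" "X i"] by simp
  have "1 / real n * (trace_nabla_sym df p)\<^sup>2 - 1 / 4 * trace_J_sq df p \<le> (\<Sum>i<n. \<Sum>k<n. (hess f (X i) (X k) p)\<^sup>2)"
    using sum_squares_ge_trace_antisym[where n = n and a = "\<lambda>i k. hess f (X i) (X k) p"]
    by (simp add: trace_nabla_sym_df trace_J_sq_df comm)
  moreover have "\<epsilon> * (\<Sum>i<n. \<Sum>j<m. (h i j)\<^sup>2) - 2 * (\<Sum>i<n. \<Sum>j<m. t i j * h i j)
      \<ge> 1 / \<epsilon> * inner_H (J_sq_form df) df p"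
  proof -
    have "- (1 / \<epsilon> * (t i j)\<^sup>2) \<le> \<epsilon> * (h i j)\<^sup>2 - 2 * (t i j * h i j)" for i j
    proof -
      have "0 \<le> (\<epsilon> * h i j - t i j)\<^sup>2 / \<epsilon>" using \<epsilon> by simp
      also have "\<dots> = \<epsilon> * (h i j)\<^sup>2 - 2 * (t i j * h i j) + 1 / \<epsilon> * (t i j)\<^sup>2"
        using \<epsilon> by (simp add: power2_eq_square field_simps)
      finally show ?thesis by simp
    qed
    then have "(\<Sum>i<n. \<Sum>j<m. - (1 / \<epsilon> * (t i j)\<^sup>2)) \<le> (\<Sum>i<n. \<Sum>j<m. \<epsilon> * (h i j)\<^sup>2 - 2 * (t i j * h i j))"
      by (intro sum_mono)
    then show ?thesis unfolding J by (simp add: sum_subtractf sum_negf sum_distrib_left)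
  qed
  \<comment> \<open>An exact identity; the only losses are the two estimates above.\<close>
  moreover have "1 / 2 * hor_laplacian (inner_eps \<epsilon> df df) p - inner_eps \<epsilon> (box_eps \<epsilon> df) df p
    = (\<Sum>i<n. \<Sum>k<n. (hess f (X i) (X k) p)\<^sup>2) + inner_H (Ric_H_form df) df p - inner_V (delta_T_form df) df p
      + (\<epsilon> * (\<Sum>i<n. \<Sum>j<m. (h i j)\<^sup>2) - 2 * (\<Sum>i<n. \<Sum>j<m. t i j * h i j))"
  proof -
    have "(\<Sum>k<n. X k p f * (box_eps \<epsilon> df (X k) p + Ric_H_form df (X k) p - delta_T (X k) p f
          - 2 * (\<Sum>i<n. hess f (X i) (torsion (X i) (X k)) p)))
      = inner_H (box_eps \<epsilon> df) df p + inner_H (Ric_H_form df) df p - inner_V (delta_T_form df) df p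
        - 2 * (\<Sum>i<n. \<Sum>j<m. t i j * h i j)"
      unfolding cross[symmetric] inner_V_delta_T inner_H_def dapp
      by (simp add: sum.distrib sum_subtractf sum_distrib_left algebra_simps)
    moreover have "(\<Sum>j<m. Z j p f * box_eps \<epsilon> df (Z j) p) = inner_V (box_eps \<epsilon> df) df p"
      by (simp add: inner_V_def dapp mult.commute)
    ultimately show ?thesis
      using hor_laplacian_norm_sq_H[of \<epsilon>] hor_laplacian_norm_sq_V[of \<epsilon>]
      unfolding hor_laplacian_inner_eps inner_eps_def[of \<epsilon> "box_eps \<epsilon> df"] h_def
      by (simp add: algebra_simps)
  qed
  ultimately show ?thesis by linarith
qed

end

end

section \<open>Coordinate fields and basic fields\<close>

text \<open>Gaussian elimination: the pivot unknown is removed from the other equations and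
  recovered from the pivot equation. It serves as the dimension count for tangent vectors, which are
  here functions on functions.\<close>

lemma underdetermined_system:
  fixes a :: "'i \<Rightarrow> 'j \<Rightarrow> real"
  assumes "finite E" "finite V" "card E < card V"
  shows "\<exists>x. (\<exists>j\<in>V. x j \<noteq> 0) \<and> (\<forall>i\<in>E. (\<Sum>j\<in>V. a i j * x j) = 0)"
  using assms
proof (induction E arbitrary: V a rule: finite_induct)
  case empty
  then have "V \<noteq> {}" by auto
  then show ?case by (intro exI[of _ "\<lambda>_. 1"]) auto
next
  case (insert i0 E)
  show ?case
  proof (cases "\<forall>j\<in>V. a i0 j = 0")
    case True
    obtain x where "\<exists>j\<in>V. x j \<noteq> 0" "\<forall>i\<in>E. (\<Sum>j\<in>V. a i j * x j) = 0"
      using insert.IH[of V a] insert.prems insert.hyps by auto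
    then show ?thesis using True by (intro exI[of _ x]) auto
  next
    case False
    then obtain j0 where j0: "j0 \<in> V" "a i0 j0 \<noteq> 0" by blast
    let ?V = "V - {j0}"
    have V: "finite ?V" "card E < card ?V" using insert.prems insert.hyps j0 by auto
    obtain y where y: "\<exists>j\<in>?V. y j \<noteq> 0"
      "\<forall>i\<in>E. (\<Sum>j\<in>?V. (a i j - a i j0 * a i0 j / a i0 j0) * y j) = 0"
      using insert.IH[OF V, of "\<lambda>i j. a i j - a i j0 * a i0 j / a i0 j0"] by blast
    define c where "c = - (\<Sum>j\<in>?V. a i0 j * y j) / a i0 j0"
    define x where "x j = (if j = j0 then c else y j)" for j
    have sum: "(\<Sum>j\<in>V. a i j * x j) = a i j0 * c + (\<Sum>j\<in>?V. a i j * y j)" for i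
      using sum.remove[OF insert.prems(1) j0(1), of "\<lambda>j. a i j * x j"]
      by (auto simp: x_def intro!: sum.cong)
    have "(\<Sum>j\<in>V. a i j * x j) = 0" if "i \<in> E" for i
    proof -
      have "0 = (\<Sum>j\<in>?V. a i j * y j) - (\<Sum>j\<in>?V. a i j0 / a i0 j0 * (a i0 j * y j))"
      proof -
        have "(\<Sum>j\<in>?V. (a i j - a i j0 * a i0 j / a i0 j0) * y j)
            = (\<Sum>j\<in>?V. a i j * y j) - (\<Sum>j\<in>?V. a i j0 / a i0 j0 * (a i0 j * y j))"
          unfolding sum_subtractf[symmetric] by (intro sum.cong refl) (simp add: left_diff_distrib)
        then show ?thesis using y(2) that by simp
      qed
      then show ?thesis unfolding sum c_def by (simp add: sum_distrib_left sum_divide_distrib)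
    qed
    moreover have "(\<Sum>j\<in>V. a i0 j * x j) = 0"
      unfolding sum c_def using j0(2) by simp
    moreover have "\<exists>j\<in>V. x j \<noteq> 0" using y(1) by (auto simp: x_def)
    ultimately show ?thesis by blast
  qed
qed

context manifold
begin

text \<open>The partial derivative in the direction \<open>b\<close>, with the value
  \<open>0\<close> on functions that are not smooth near \<open>p\<close>, as \<open>tangent\<close>
  prescribes.\<close>

definition coord_field :: "'a set \<Rightarrow> ('a \<Rightarrow> 'e) \<Rightarrow> 'e \<Rightarrow> 'a vfield" where
  "coord_field V \<phi> b p = (\<lambda>k. if smooth_near A p k
     then frechet_derivative (k \<circ> inv_into V \<phi>) (at (\<phi> p)) b else 0)"

lemma coordinate_smooth:
  assumes "(V, \<phi>) \<in> A" "b \<in> Basis" shows "smooth_fun A V (\<lambda>q. \<phi> q \<bullet> b)"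
  unfolding smooth_fun_def
  using transition_smooth[OF _ assms] chart(1)[OF assms(1)] by (auto simp: o_def)

context
  fixes V \<phi> assumes c: "(V, \<phi>) \<in> A"
begin

lemma inv_chart: "p \<in> V \<Longrightarrow> inv_into V \<phi> (\<phi> p) = p"
  using chart(4)[OF c] by simp

lemma chart_has_derivative:
  assumes "p \<in> V" "smooth_near A p k"
  shows "((k \<circ> inv_into V \<phi>) has_derivative frechet_derivative (k \<circ> inv_into V \<phi>) (at (\<phi> p))) (at (\<phi> p))"
proof -
  obtain W where W: "p \<in> W" "smooth_fun A W k" using assms(2) unfolding smooth_near_def by blast
  then have "smooth (\<phi> ` (V \<inter> W)) (k \<circ> inv_into V \<phi>)" using c unfolding smooth_fun_def by blast
  then show ?thesis
    using smooth_differentiable[of _ _ "\<phi> p"] W assms(1) by (auto simp: frechet_derivative_works[symmetric])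
qed

lemma coord_field_tangent:
  assumes p: "p \<in> V" shows "coord_field V \<phi> b p \<in> tangent A p"
  unfolding tangent_def
proof (safe)
  fix f h c d assume s: "smooth_near A p f" "smooth_near A p h"
  note F = chart_has_derivative[OF p s(1)] and H = chart_has_derivative[OF p s(2)]
  have "smooth_near A p (\<lambda>x. c * f x + d * h x)"
    by (intro smooth_near_add smooth_near_mult smooth_near_const s)
  moreover have "((\<lambda>x. c * f x + d * h x) \<circ> inv_into V \<phi> has_derivative
      (\<lambda>v. c * frechet_derivative (f \<circ> inv_into V \<phi>) (at (\<phi> p)) v + d * frechet_derivative (h \<circ> inv_into V \<phi>) (at (\<phi> p)) v)) (at (\<phi> p))"
    using has_derivative_add[OF has_derivative_mult_right[OF F, of c] has_derivative_mult_right[OF H, of d]]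
    by (simp add: o_def)
  ultimately show "coord_field V \<phi> b p (\<lambda>x. c * f x + d * h x) = c * coord_field V \<phi> b p f + d * coord_field V \<phi> b p h"
    using frechet_derivative_apply s unfolding coord_field_def by fastforce
  have "smooth_near A p (\<lambda>x. f x * h x)" by (intro smooth_near_mult s)
  moreover have "((\<lambda>x. f x * h x) \<circ> inv_into V \<phi> has_derivative
      (\<lambda>v. f p * frechet_derivative (h \<circ> inv_into V \<phi>) (at (\<phi> p)) v + frechet_derivative (f \<circ> inv_into V \<phi>) (at (\<phi> p)) v * h p)) (at (\<phi> p))"
    using has_derivative_mult[OF F H] p by (simp add: o_def inv_chart)
  ultimately show "coord_field V \<phi> b p (\<lambda>x. f x * h x) = f p * coord_field V \<phi> b p h + h p * coord_field V \<phi> b p f"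
    using frechet_derivative_apply s unfolding coord_field_def by (fastforce simp: mult.commute)
qed (simp add: coord_field_def)

text \<open>Smoothness has to be checked in every chart. In another chart the derivative is the one
  taken in \<open>\<phi>\<close> composed with the change of coordinates, so
  \<open>cont_diff_compose\<close> applies.\<close>

lemma coord_field_VF: "vector_field A V (coord_field V \<phi> b)"
  unfolding vector_field_def
proof (intro conjI ballI allI impI)
  fix W f assume W: "W \<subseteq> V" "smooth_fun A W f"
  have oW: "open W" using W(2) by (rule smooth_fun_open)
  let ?F = "\<lambda>y. frechet_derivative (f \<circ> inv_into V \<phi>) (at y) b"
  have F: "smooth (\<phi> ` (V \<inter> W)) ?F"
    using W(2) c unfolding smooth_fun_def by (intro smooth_frechet_derivative) blast
  have "smooth_fun A W (\<lambda>p. ?F (\<phi> p))"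
    unfolding smooth_fun_def
  proof (intro conjI oW ballI, clarify)
    fix V' \<phi>' assume c': "(V', \<phi>') \<in> A"
    let ?G = "\<lambda>x. \<phi> (inv_into V' \<phi>' x)"
    have inv': "inv_into V' \<phi>' (\<phi>' q) = q" if "q \<in> V'" for q
      using chart(4)[OF c'] that by simp
    have "cont_diff k (\<phi>' ` (V' \<inter> W)) (\<lambda>x. ?F (?G x))" for k
    proof (rule cont_diff_compose[OF open_chart_image[OF c' oW] open_chart_image[OF c oW]])
      show "?G ` \<phi>' ` (V' \<inter> W) \<subseteq> \<phi> ` (V \<inter> W)" using W(1) inv' by fastforce
      show "cont_diff k (\<phi> ` (V \<inter> W)) ?F" using F unfolding smooth_def by blast
      fix b' :: 'e assume "b' \<in> Basis"
      then have "smooth (\<phi>' ` (V' \<inter> V)) (\<lambda>x. ?G x \<bullet> b')" by (rule transition_smooth[OF c' c])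
      moreover have "\<phi>' ` (V' \<inter> W) \<subseteq> \<phi>' ` (V' \<inter> V)" using W(1) by blast
      ultimately show "cont_diff k (\<phi>' ` (V' \<inter> W)) (\<lambda>x. ?G x \<bullet> b')"
        unfolding smooth_def using cont_diff_subset by blast
    qed
    then show "smooth (\<phi>' ` (V' \<inter> W)) ((\<lambda>p. ?F (\<phi> p)) \<circ> inv_into V' \<phi>')"
      unfolding smooth_def o_def by blast
  qed
  then show "smooth_fun A W (\<lambda>p. coord_field V \<phi> b p f)"
    by (rule smooth_fun_cong) (simp add: coord_field_def smooth_nearI[OF W(2)])
qed (rule coord_field_tangent)

lemma coord_field_coordinate:
  assumes p: "p \<in> V" and b': "b' \<in> Basis"
  shows "coord_field V \<phi> b p (\<lambda>q. \<phi> q \<bullet> b') = b \<bullet> b'"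
proof -
  have "((\<lambda>x. x \<bullet> b') has_derivative (\<lambda>v. v \<bullet> b')) (at (\<phi> p))"
    by (intro has_derivative_inner_left has_derivative_ident)
  then have "((\<lambda>q. \<phi> q \<bullet> b') \<circ> inv_into V \<phi> has_derivative (\<lambda>v. v \<bullet> b')) (at (\<phi> p))"
    by (rule has_derivative_transform_within_open[OF _ chart(2)[OF c]])
      (use p in \<open>auto simp: inv_chart f_inv_into_f\<close>)
  then show ?thesis
    using frechet_derivative_apply[of _ "\<lambda>v. v \<bullet> b'" "\<phi> p" b] smooth_nearI[OF coordinate_smooth[OF c b'] p]
    by (simp add: coord_field_def)
qed

end

end

context framed_foliation
begin

context
  fixes V \<phi> p
  assumes c: "(V, \<phi>) \<in> A" and B: "B \<subseteq> Basis" "card B = n" and p: "p \<in> U" "p \<in> V"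
begin

text \<open>Vertical vectors annihilate the transverse coordinates, so the projected coordinate
  vectors remain dual to them.\<close>

lemma projected_coord_field_coordinate:
  assumes "b \<in> B" "b' \<in> B"
  shows "hproj p (coord_field V \<phi> b p) (\<lambda>q. \<phi> q \<bullet> b') = (if b = b' then 1 else 0)"
proof -
  have "vproj p (coord_field V \<phi> b p) (\<lambda>q. \<phi> q \<bullet> b') = 0"
    using vproj_vert[OF p(1)] c p(2) assms(2) unfolding vert_def by blast
  moreover have "coord_field V \<phi> b p (\<lambda>q. \<phi> q \<bullet> b') = (if b = b' then 1 else 0)"
    using coord_field_coordinate[OF c p(2)] assms B(1) inner_Basis by (metis subsetD)
  ultimately show ?thesis
    using proj_split[OF p(1) coord_field_tangent[OF c p(2), of b], of "\<lambda>q. \<phi> q \<bullet> b'"] by simp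
qed

text \<open>The \<open>n\<close> projected transverse coordinate vectors are independent, so they span the
  \<open>n\<close>-dimensional horizontal space.\<close>

lemma horiz_span_coord:
  assumes v: "v \<in> horiz A B g p"
  shows "\<exists>x. v = (\<lambda>k. \<Sum>b\<in>B. x b * hproj p (coord_field V \<phi> b p) k)"
proof -
  let ?y = "\<lambda>b. hproj p (coord_field V \<phi> b p)"
  have finB: "finite B" using B(1) finite_Basis finite_subset by blast
  define w where "w o' = (case o' of None \<Rightarrow> v | Some b \<Rightarrow> ?y b)" for o'
  have w: "w o' \<in> horiz A B g p" for o'
    unfolding w_def using v hproj_horiz[OF p(1)] by (cases o') auto
  let ?S = "insert None (Some ` B)"
  have finS: "finite ?S" and cardS: "card ?S = Suc n"
    using finB B(2) by (auto simp: card_image)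
  \<comment> \<open>The index \<open>None\<close> stands for \<open>v\<close>. These
    \<open>Suc n\<close> vectors have \<open>n\<close> horizontal frame components each, so they
    satisfy a nontrivial relation.\<close>
  obtain x where x: "\<exists>s\<in>?S. x s \<noteq> 0" "\<forall>i\<in>{..<n}. (\<Sum>s\<in>?S. g p (w s) (X i p) * x s) = 0"
    using underdetermined_system[of "{..<n}" ?S "\<lambda>i s. g p (w s) (X i p)"] finS cardS by auto
  let ?c = "\<lambda>k. \<Sum>s\<in>?S. x s * w s k"
  have "?c \<in> horiz A B g p" by (rule horiz_sum[OF finS w])
  moreover have "g p ?c (X i p) = 0" if i: "i < n" for i
    using g_sum_left[OF finS horiz_tangent[OF w] X_tangent[OF i p(1)], of x] x(2) i
    by (simp add: mult.commute)
  ultimately have "?c = (\<lambda>_. 0)" using hproj_id[OF p(1)] unfolding hproj_def by fastforce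
  then have z: "x None * v k + (\<Sum>b\<in>B. x (Some b) * ?y b k) = 0" for k
    using finB by (auto simp: w_def sum.reindex fun_eq_iff)
  \<comment> \<open>Otherwise the relation would involve the coordinate vectors alone, and
    evaluating it on the transverse coordinates would make every coefficient zero.\<close>
  have "x None \<noteq> 0"
  proof
    assume 0: "x None = 0"
    have "x (Some b) = 0" if b: "b \<in> B" for b
    proof -
      have "(\<Sum>b'\<in>B. x (Some b') * ?y b' (\<lambda>q. \<phi> q \<bullet> b)) = (\<Sum>b'\<in>B. if b' = b then x (Some b') else 0)"
        using b by (intro sum.cong refl) (simp add: projected_coord_field_coordinate)
      then show ?thesis using z[of "\<lambda>q. \<phi> q \<bullet> b"] 0 b finB by simp
    qed
    then show False using x(1) 0 by auto
  qed
  then have "v k = (\<Sum>b\<in>B. - x (Some b) / x None * ?y b k)" for k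
    using z[of k] by (simp add: sum_divide_distrib[symmetric] sum_negf field_simps)
  then show ?thesis by (intro exI[of _ "\<lambda>b. - x (Some b) / x None"] ext)
qed

text \<open>\<open>vert\<close> quantifies over all charts around the point, and this reduces the
  test to one of them. The horizontal part is a combination of projected coordinate vectors whose
  coefficients are read off by the transverse coordinates.\<close>

lemma vert_of_coordinates:
  assumes u: "u \<in> tangent A p" and z: "\<And>b. b \<in> B \<Longrightarrow> u (\<lambda>q. \<phi> q \<bullet> b) = 0"
  shows "u \<in> vert A B p"
proof -
  have finB: "finite B" using B(1) finite_Basis finite_subset by blast
  obtain x where x: "hproj p u = (\<lambda>k. \<Sum>b\<in>B. x b * hproj p (coord_field V \<phi> b p) k)"
    using horiz_span_coord[OF hproj_horiz[OF p(1)]] by blast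
  have "x b = 0" if b: "b \<in> B" for b
  proof -
    have "vproj p u (\<lambda>q. \<phi> q \<bullet> b) = 0"
      using vproj_vert[OF p(1)] c p(2) b unfolding vert_def by blast
    then have "hproj p u (\<lambda>q. \<phi> q \<bullet> b) = 0" using proj_split[OF p(1) u] z[OF b] by simp
    moreover have "hproj p u (\<lambda>q. \<phi> q \<bullet> b) = (\<Sum>b'\<in>B. if b' = b then x b' else 0)"
      unfolding x using b by (intro sum.cong refl) (simp add: projected_coord_field_coordinate)
    ultimately show ?thesis using b finB by simp
  qed
  then have "hproj p u = (\<lambda>_. 0)" unfolding x by simp
  then have "u = vproj p u" using proj_split[OF p(1) u] by (auto simp: fun_eq_iff)
  then show ?thesis using vproj_vert[OF p(1), of u] by simp
qed

end

text \<open>Vertical fields annihilate the transverse coordinates and the projected field maps them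
  to constants, so the bracket annihilates them too; \<open>vert_of_coordinates\<close> then gives
  verticality.\<close>

lemma projected_coord_field_foliate:
  assumes c: "(V, \<phi>) \<in> A" and B: "B \<subseteq> Basis" "card B = n" and UV: "U \<subseteq> V" and b: "b \<in> B"
  shows "HF (hpart (coord_field V \<phi> b))" "foliate_field A B U (hpart (coord_field V \<phi> b))"
proof -
  let ?Y = "hpart (coord_field V \<phi> b)"
  have C: "VF (coord_field V \<phi> b)" by (rule field_subset[OF coord_field_VF[OF c] UV])
  show Y: "HF ?Y" by (rule hpart_HF[OF C])
  show "foliate_field A B U ?Y"
    unfolding foliate_field_def
  proof (intro conjI allI impI HF_VF[OF Y])
    fix W assume W: "VertF W"
    note L = lie_field[OF U HF_VF[OF Y] VertF_VF[OF W]]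
    show "VertF (lie A ?Y W)"
      unfolding vertical_field_def
    proof (intro conjI ballI L)
      fix q assume q: "q \<in> U"
      show "lie A ?Y W q \<in> vert A B q"
      proof (rule vert_of_coordinates[OF c B q _ VF_tangent[OF L q]])
        fix b' assume b': "b' \<in> B"
        let ?k = "\<lambda>q. \<phi> q \<bullet> b'"
        have k: "smooth_near A q ?k"
          using smooth_nearI[OF coordinate_smooth[OF c]] b' B(1) q UV by blast
        have "W r ?k = 0" if "r \<in> U" for r
          using VertF_at[OF W that] c b' UV that unfolding vert_def by blast
        then have "?Y q (\<lambda>r. W r ?k) = 0"
          using deriv_cong[OF HF_VF[OF Y] q, of "\<lambda>r. W r ?k" "\<lambda>_. 0"] deriv_const[OF HF_VF[OF Y] q] by simp
        moreover have "?Y r ?k = (if b = b' then 1 else 0)" if "r \<in> U" for r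
          using projected_coord_field_coordinate[OF c B that _ b b'] hpart_at[OF C that] that UV by auto
        then have "W q (\<lambda>r. ?Y r ?k) = 0"
          using deriv_cong[OF VertF_VF[OF W] q, of "\<lambda>r. ?Y r ?k" "\<lambda>_. if b = b' then 1 else 0"]
            deriv_const[OF VertF_VF[OF W] q] by simp
        ultimately show "lie A ?Y W q ?k = 0" by (simp add: lie_eq[OF k])
      qed (use q UV in blast)
    qed
  qed
qed

subsection \<open>Bundle-like metrics are holonomy invariant\<close>

text \<open>The Lie derivative of the horizontal metric along \<open>V\<close>. Projecting both
  arguments makes it meaningful for all fields, so that it can be treated as a tensor.\<close>

definition hor_lie_derivative :: "'a vfield \<Rightarrow> 'a \<Rightarrow> 'a vfield \<Rightarrow> 'a vfield \<Rightarrow> real" where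
  "hor_lie_derivative V p Y W = V p (\<lambda>q. g q (hpart Y q) (hpart W q))
     - g p (lie A V (hpart Y) p) (hpart W p) - g p (hpart Y p) (lie A V (hpart W) p)"

lemma hor_lie_derivative_sym:
  assumes "VF V" "VF Y" "VF W" "p \<in> U"
  shows "hor_lie_derivative V p Y W = hor_lie_derivative V p W Y"
proof -
  note h = hpart_VF[OF assms(2)] hpart_VF[OF assms(3)]
  have "V p (\<lambda>q. g q (hpart Y q) (hpart W q)) = V p (\<lambda>q. g q (hpart W q) (hpart Y q))"
    by (rule deriv_cong[OF assms(1,4)]) (intro g_sym VF_tangent h)
  then show ?thesis
    unfolding hor_lie_derivative_def
    using g_sym[OF VF_tangent[OF lie_field[OF U assms(1) h(1)] assms(4)] VF_tangent[OF h(2) assms(4)]]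
      g_sym[OF VF_tangent[OF lie_field[OF U assms(1) h(2)] assms(4)] VF_tangent[OF h(1) assms(4)]] by simp
qed

text \<open>The derivative of \<open>u\<close> along \<open>V\<close> arises from the metric term
  and from the bracket, with opposite signs.\<close>

lemma tensorial_hor_lie_derivative:
  assumes V: "VF V" and W: "VF W" and p: "p \<in> U"
  shows "tensorial_at p (\<lambda>Y. hor_lie_derivative V p Y W)"
proof (rule tensorial_atI)
  fix u Y Y' assume u: "SF u" and Y: "VF Y" and Y': "VF Y'"
  let ?S = "\<lambda>q k. u q * Y q k + Y' q k"
  have S: "VF ?S" by (rule field_lin[OF u Y Y'])
  note hY = hpart_VF[OF Y] and hY' = hpart_VF[OF Y'] and hW = hpart_VF[OF W]
  note t = VF_tangent[OF _ p]
  have lin: "g q (\<lambda>k. u q * hpart Y q k + hpart Y' q k) w = u q * g q (hpart Y q) w + g q (hpart Y' q) w"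
    if "q \<in> U" "w \<in> tangent A q" for q w
    using g_lin_left[OF VF_tangent[OF hY that(1)] VF_tangent[OF hY' that(1)] that(2), of "u q" 1] by simp
  have gs: "SF (\<lambda>q. g q (hpart Y q) (hpart W q))" "SF (\<lambda>q. g q (hpart Y' q) (hpart W q))"
    by (intro g_smooth hY hY' hW)+
  have "V p (\<lambda>q. g q (hpart ?S q) (hpart W q))
      = V p (\<lambda>q. u q * g q (hpart Y q) (hpart W q) + g q (hpart Y' q) (hpart W q))"
    by (rule deriv_cong[OF V p]) (simp add: hpart_lin[OF u Y Y'] lin VF_tangent[OF hW])
  then have 1: "V p (\<lambda>q. g q (hpart ?S q) (hpart W q))
      = u p * V p (\<lambda>q. g q (hpart Y q) (hpart W q)) + g p (hpart Y p) (hpart W p) * V p u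
        + V p (\<lambda>q. g q (hpart Y' q) (hpart W q))"
    using deriv_add[OF V p smooth_fun_mult[OF u gs(1)] gs(2)] deriv_mult[OF V p u gs(1)] by simp
  have "lie A V (hpart ?S) p = (\<lambda>k. u p * lie A V (hpart Y) p k + 1 * (V p u * hpart Y p k + 1 * lie A V (hpart Y') p k))"
    using lie_cong[OF U V hpart_VF[OF S] p refl hpart_lin[OF u Y Y']] lie_lin_right[OF U V hY hY' u p]
    by (auto simp: fun_eq_iff)
  then have 2: "g p (lie A V (hpart ?S) p) (hpart W p)
      = u p * g p (lie A V (hpart Y) p) (hpart W p) + V p u * g p (hpart Y p) (hpart W p)
        + g p (lie A V (hpart Y') p) (hpart W p)"
    by (simp only: g_lin_left[OF _ _ t[OF hW]] tangent_combine t[OF hY] t[OF lie_field[OF U V hY]]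
        t[OF lie_field[OF U V hY']]) simp
  have 3: "g p (hpart ?S p) (lie A V (hpart W) p) = u p * g p (hpart Y p) (lie A V (hpart W) p)
      + g p (hpart Y' p) (lie A V (hpart W) p)"
    using lin[OF p t[OF lie_field[OF U V hW]]] by (simp add: hpart_lin[OF u Y Y' p])
  show "hor_lie_derivative V p ?S W = u p * hor_lie_derivative V p Y W + hor_lie_derivative V p Y' W"
    unfolding hor_lie_derivative_def 1 2 3 by (simp add: algebra_simps)
qed

text \<open>The frame fields need not be foliate, so \<open>bundle_like\<close> says nothing about
  them. It applies to the projected coordinate fields, which span the horizontal space, and their
  brackets with \<open>V\<close> are vertical; tensoriality and symmetry extend the vanishing to all
  arguments.\<close>

lemma hor_lie_derivative_zero:
  assumes c: "(V', \<phi>) \<in> A" and B: "B \<subseteq> Basis" "card B = n" and UV: "U \<subseteq> V'"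
    and bl: "bundle_like A B g" and V: "VertF V" and p: "p \<in> U" and Y: "VF Y" and W: "VF W"
  shows "hor_lie_derivative V p Y W = 0"
proof -
  note VV = VertF_VF[OF V]
  let ?C = "\<lambda>b. coord_field V' \<phi> b"
  have C: "VF (?C b)" for b by (rule field_subset[OF coord_field_VF[OF c] UV])
  have pV: "p \<in> V'" using p UV by blast
  have lv: "g p (lie A V (hpart (?C b)) p) w = 0" "g p w (lie A V (hpart (?C b)) p) = 0"
    if "b \<in> B" "w \<in> horiz A B g p" for b w
  proof -
    have "VertF (lie A (hpart (?C b)) V)"
      using projected_coord_field_foliate(2)[OF c B UV that(1)] V unfolding foliate_field_def by blast
    then have "(\<lambda>k. \<Sum>i\<in>{0::nat}. -1 * lie A (hpart (?C b)) V p k) \<in> vert A B p"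
      by (intro vert_sum) (auto intro: VertF_at p)
    moreover have "lie A V (hpart (?C b)) p = (\<lambda>k. \<Sum>i\<in>{0::nat}. -1 * lie A (hpart (?C b)) V p k)"
      using lie_antisym[of V "hpart (?C b)" p] by auto
    ultimately have "lie A V (hpart (?C b)) p \<in> vert A B p" by simp
    then show "g p (lie A V (hpart (?C b)) p) w = 0" "g p w (lie A V (hpart (?C b)) p) = 0"
      using vert_horiz horiz_vert that(2) by blast+
  qed
  have base: "hor_lie_derivative V p (?C b) (?C b') = 0" if b: "b \<in> B" and b': "b' \<in> B" for b b'
  proof -
    have "V p (\<lambda>q. g q (hpart (?C b) q) (hpart (?C b') q)) = 0"
      using bl U projected_coord_field_foliate[OF c B UV] b b' V p unfolding bundle_like_def by blast
    then show ?thesis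
      using lv[OF b HF_at[OF hpart_HF[OF C] p]] lv[OF b' HF_at[OF hpart_HF[OF C] p]]
      by (simp add: hor_lie_derivative_def)
  qed
  \<comment> \<open>The coefficients in terms of projected coordinate vectors are only obtained at
    \<open>p\<close>, not as smooth functions. Hence \<open>\<tau>\<close> is expanded in the frame
    and the two finite sums are exchanged.\<close>
  have reduce: "\<tau> (hpart Y) = 0" if \<tau>: "tensorial_at p \<tau>" and z: "\<And>b. b \<in> B \<Longrightarrow> \<tau> (hpart (?C b)) = 0"
    and Y: "VF Y" for \<tau> Y
  proof -
    have finB: "finite B" using B(1) finite_Basis finite_subset by blast
    obtain x where x: "hpart Y p = (\<lambda>k. \<Sum>b\<in>B. x b * hproj p (?C b p) k)"
      using horiz_span_coord[OF c B p pV HF_at[OF hpart_HF[OF Y] p]] by blast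
    have coeff: "g p (hpart Y p) (X i p) = (\<Sum>b\<in>B. x b * g p (hproj p (?C b p)) (X i p))" if "i < n" for i
      unfolding x by (rule g_sum_left[OF finB hproj_tangent[OF p] X_tangent[OF that p]])
    have "\<tau> (hpart Y) = (\<Sum>i<n. g p (hpart Y p) (X i p) * \<tau> (X i))"
      using tensorial_expand_horizontal[OF \<tau> Y p] g_hproj_sym[OF p VF_tangent[OF Y p] X_tangent[OF _ p]]
        hproj_id[OF p X_at[OF _ p]] hpart_at[OF Y p] by simp
    also have "\<dots> = (\<Sum>i<n. \<Sum>b\<in>B. x b * (g p (hproj p (?C b p)) (X i p) * \<tau> (X i)))"
      by (intro sum.cong refl) (simp add: coeff sum_distrib_left sum_distrib_right mult.assoc)
    also have "\<dots> = (\<Sum>b\<in>B. \<Sum>i<n. x b * (g p (hproj p (?C b p)) (X i p) * \<tau> (X i)))" by (rule sum.swap)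
    also have "\<dots> = (\<Sum>b\<in>B. x b * \<tau> (hpart (?C b)))"
    proof (intro sum.cong refl)
      fix b
      have "\<tau> (hpart (?C b)) = (\<Sum>i<n. g p (hproj p (?C b p)) (X i p) * \<tau> (X i))"
        using tensorial_expand_horizontal[OF \<tau> C p] g_hproj_sym[OF p VF_tangent[OF C p] X_tangent[OF _ p]]
          hproj_id[OF p X_at[OF _ p]] by simp
      then show "(\<Sum>i<n. x b * (g p (hproj p (?C b p)) (X i p) * \<tau> (X i))) = x b * \<tau> (hpart (?C b))"
        by (simp add: sum_distrib_left)
    qed
    finally show ?thesis using z by simp
  qed
  have hh: "hor_lie_derivative V p Y W = hor_lie_derivative V p (hpart Y) W" if "VF Y" "VF W" for Y W
  proof -
    note t = tensorial_hor_lie_derivative[OF VV that(2) p]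
    have "hor_lie_derivative V p (vpart Y) W = (\<Sum>j<m. g p (Y p) (Z j p) * hor_lie_derivative V p (Z j) W)"
      by (rule tensorial_expand_vertical[OF t that(1) p])
    moreover have "hor_lie_derivative V p (Z j) W = 0" if j: "j < m" for j
    proof -
      note hZ = hpart_of_VertF[OF Z_VertF[OF j]]
      note hW = hpart_VF[OF \<open>VF W\<close>]
      have "lie A V (hpart (Z j)) p = (\<lambda>_. 0)"
        using lie_cong[OF U VV hpart_VF[OF Z_VF[OF j]] p refl hZ] lie_zero[OF U VV p] by (auto simp: fun_eq_iff)
      moreover have "V p (\<lambda>q. g q (hpart (Z j) q) (hpart W q)) = V p (\<lambda>_. 0)"
        by (rule deriv_cong[OF VV p]) (simp add: hZ g_zero_left VF_tangent[OF hW])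
      ultimately show ?thesis
        using hZ[OF p] deriv_const[OF VV p]
        by (simp add: hor_lie_derivative_def g_zero_left VF_tangent[OF hW p] VF_tangent[OF lie_field[OF U VV hW] p])
    qed
    ultimately show ?thesis using tensorial_parts[OF t that(1) p] by simp
  qed
  note sym = hor_lie_derivative_sym[OF VV _ _ p]
  have 1: "hor_lie_derivative V p (hpart Y) (?C b') = 0" if "b' \<in> B" and Y: "VF Y" for b' Y
    by (rule reduce[OF tensorial_hor_lie_derivative[OF VV C p] _ Y])
      (use base that hh[OF C C] in auto)
  have "hor_lie_derivative V p (hpart Y) W = 0" if Y: "VF Y" and W: "VF W" for Y W
  proof (rule reduce[OF tensorial_hor_lie_derivative[OF VV W p] _ Y])
    fix b assume "b \<in> B"
    then show "hor_lie_derivative V p (hpart (?C b)) W = 0"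
      using 1[OF _ W] hh[OF W C, of b] hh[OF C W, of b] sym[OF W C, of b] by simp
  qed
  then show ?thesis using hh[OF Y W] Y W by simp
qed

text \<open>The patch need not lie in one chart. The identity is local, so it is proved on the
  intersection of the patch with a chart domain around \<open>p\<close>.\<close>

lemma bundle_like_invariant:
  assumes B: "B \<subseteq> Basis" "card B = n" and bl: "bundle_like A B g"
    and V: "VertF V" and Y: "HF Y" and W: "HF W" and p: "p \<in> U"
  shows "V p (\<lambda>q. g q (Y q) (W q)) = g p (lie A V Y p) (W p) + g p (Y p) (lie A V W p)"
proof -
  obtain V' \<phi> where c: "(V', \<phi>) \<in> A" "p \<in> V'" by (rule chart_at)
  interpret P: framed_foliation A B g D n m X Z "U \<inter> V'"
    by (rule restrict_frame) (use U chart(1)[OF c(1)] in auto)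
  have pP: "p \<in> U \<inter> V'" using p c(2) by simp
  have VP: "P.VertF V" and YP: "P.HF Y" and WP: "P.HF W"
    using V Y W field_subset unfolding vertical_field_def horizontal_field_def by blast+
  note VV = P.VertF_VF[OF VP] and YV = P.HF_VF[OF YP] and WV = P.HF_VF[OF WP]
  note hY = P.hpart_of_HF[OF YP] and hW = P.hpart_of_HF[OF WP]
  have "P.hor_lie_derivative V p Y W = 0"
    by (rule P.hor_lie_derivative_zero[OF c(1) B _ bl VP pP YV WV]) simp
  moreover have "V p (\<lambda>q. g q (hpart Y q) (hpart W q)) = V p (\<lambda>q. g q (Y q) (W q))"
    by (rule P.deriv_cong[OF VV pP]) (simp add: hY hW)
  moreover have "lie A V (hpart Y) p = lie A V Y p" "lie A V (hpart W) p = lie A V W p"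
    using lie_cong[OF P.U VV P.hpart_VF[OF YV] pP refl hY] lie_cong[OF P.U VV P.hpart_VF[OF WV] pP refl hW]
    by auto
  ultimately show ?thesis using hY[OF pP] hW[OF pP] by (simp add: P.hor_lie_derivative_def)
qed

end

section \<open>The transverse flow\<close>

lemma transverse_flow_vert:
  assumes flow: "transverse_flow A B I g0 h g" and I: "is_interval I" "0 \<in> I" "t \<in> I"
    and uv: "u \<in> vert A B p" "v \<in> vert A B p"
  shows "g t p u v = g0 p u v"
proof -
  have "\<exists>c. \<forall>s\<in>I. g s p u v = c"
  proof (rule has_field_derivative_zero_constant)
    show "convex I" using I(1) is_interval_convex_1 by blast
    show "((\<lambda>s. g s p u v) has_real_derivative 0) (at s within I)" if "s \<in> I" for s
      using flow that uv unfolding transverse_flow_def by blast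
  qed
  then have "g t p u v = g 0 p u v" using I by metis
  then show ?thesis using flow unfolding transverse_flow_def by simp
qed

text \<open>The bracket equals \<open>D V W - D W V\<close>, and both terms are vertical. As the
  conclusion does not mention the metric, it may be obtained from any metric with totally geodesic
  leaves.\<close>

lemma (in foliated_metric) totally_geodesic_involutive:
  assumes lc: "levi_civita A g D" and geo: "totally_geodesic_leaves A B D" and U: "open U"
    and V: "vertical_field A B U V" and W: "vertical_field A B U W"
  shows "vertical_field A B U (lie A V W)"
proof -
  have f: "vector_field A U V" "vector_field A U W" using V W by (simp_all add: vertical_field_def)
  have "lie A V W p \<in> vert A B p" if p: "p \<in> U" for p
  proof -
    have d: "D V W p \<in> vert A B p" "D W V p \<in> vert A B p"
      using geo U V W p unfolding totally_geodesic_leaves_def vertical_field_def by blast+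
    then have "(\<lambda>k. \<Sum>i\<in>{0,1::nat}. (if i = 0 then 1 else -1) * (if i = 0 then D V W p else D W V p) k) \<in> vert A B p"
      by (intro vert_sum) auto
    then show ?thesis
      using levi_civita_torsion_free[OF lc U f p] by simp
  qed
  then show ?thesis using lie_field[OF U f] by (simp add: vertical_field_def)
qed

text \<open>Differentiating \<open>g(V, W) = 0\<close> along \<open>Y\<close> gives
  \<open>g(D_Y V, W) = - g(V, D_Y W) = 0\<close>. Hence \<open>D_V Y\<close> may be replaced by
  \<open>[V, Y]\<close> in the compatibility of \<open>D\<close> with the metric.\<close>

lemma (in foliated_metric) totally_geodesic_invariant:
  assumes lc: "levi_civita A g D" and geo: "totally_geodesic_leaves A B D" and U: "open U"
    and V: "horizontal_field A B g U V" and Y: "vertical_field A B U Y" and W: "vertical_field A B U W"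
    and p: "p \<in> U"
  shows "V p (\<lambda>q. g q (Y q) (W q)) = g p (lie A V Y p) (W p) + g p (Y p) (lie A V W p)"
proof -
  have f: "vector_field A U V" "vector_field A U Y" "vector_field A U W"
    using V Y W by (simp_all add: vertical_field_def horizontal_field_def)
  have *: "g p (D V Y p) (W p) = g p (lie A V Y p) (W p)"
    if Y: "vertical_field A B U Y" and W: "vertical_field A B U W" for Y W
  proof -
    have f': "vector_field A U Y" "vector_field A U W" using Y W by (simp_all add: vertical_field_def)
    note t = field_tangent[OF f(1) p] field_tangent[OF f'(2) p]
      field_tangent[OF levi_civita_field[OF lc U f'(1) f(1)] p]
    have "g q (V q) (W q) = 0" if "q \<in> U" for q
      using V W that by (intro horiz_vert) (auto simp: vertical_field_def horizontal_field_def)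
    then have "Y p (\<lambda>q. g q (V q) (W q)) = 0"
      using tangent_cong[OF field_tangent[OF f'(1) p] U p, of "\<lambda>q. g q (V q) (W q)" "\<lambda>_. 0"]
        tangent_const[OF field_tangent[OF f'(1) p]] by simp
    moreover have "g p (V p) (D Y W p) = 0"
    proof (rule horiz_vert)
      show "V p \<in> horiz A B g p" using V p unfolding horizontal_field_def by blast
      show "D Y W p \<in> vert A B p" using geo U Y W p unfolding totally_geodesic_leaves_def vertical_field_def by blast
    qed
    ultimately have z: "g p (D Y V p) (W p) = 0"
      using levi_civita_metric[OF lc U f'(1) f(1) f'(2) p] by simp
    have "D V Y p = (\<lambda>k. lie A V Y p k + D Y V p k)"
      using levi_civita_torsion_free[OF lc U f(1) f'(1) p] by (auto simp: fun_eq_iff algebra_simps)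
    then show ?thesis
      using z g_add_left[OF lie_tangent[OF U f(1) f'(1) p] t(3) t(2)] by simp
  qed
  have s: "g p (Y p) u = g p u (Y p)" if "u \<in> tangent A p" for u
    by (rule g_sym[OF field_tangent[OF f(2) p] that])
  show ?thesis
    using levi_civita_metric[OF lc U f p] *[OF Y W] *[OF W Y]
      s[OF field_tangent[OF levi_civita_field[OF lc U f(1,3)] p]] s[OF lie_tangent[OF U f(1,3) p]] by simp
qed

section \<open>Comparison of two metrics with the same vertical part and the same orthogonal
  splitting\<close>

context framed_foliation
begin

context
  fixes g0 p
  assumes metric0: "riemannian_metric A g0"
    and same: "\<And>u v. u \<in> vert A B p \<Longrightarrow> v \<in> vert A B p \<Longrightarrow> g p u v = g0 p u v"
    and orth: "\<And>u v. u \<in> horiz A B g0 p \<Longrightarrow> v \<in> vert A B p \<Longrightarrow> g p u v = 0"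
    and p: "p \<in> U"
begin

interpretation M0: foliated_metric A B g0
  by unfold_locales (rule metric0)

text \<open>No orthonormal frame for \<open>g0\<close> is given. Since the vertical metrics agree,
  \<open>Z\<close> is orthonormal for \<open>g0\<close> as well and yields the
  \<open>g0\<close>-orthogonal projection.\<close>

lemma split0:
  assumes v: "v \<in> tangent A p"
  obtains u w where "u \<in> horiz A B g0 p" "w \<in> vert A B p" "v = (\<lambda>k. u k + w k)"
proof
  let ?w = "\<lambda>k. \<Sum>j<m. g0 p v (Z j p) * Z j p k"
  let ?u = "\<lambda>k. v k - ?w k"
  note Zt = Z_tangent[OF _ p]
  show w: "?w \<in> vert A B p" by (rule vert_sum) (auto intro: Z_at p)
  have u: "?u \<in> tangent A p"
    using tangent_combine[OF v vert_tangent[OF w], of 1 "-1"] by simp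
  have uZ: "g0 p ?u (Z l p) = 0" if l: "l < m" for l
  proof -
    have "g0 p ?w (Z l p) = (\<Sum>j<m. g0 p v (Z j p) * g0 p (Z j p) (Z l p))"
      by (rule M0.g_sum_left) (use Zt l in auto)
    also have "\<dots> = g0 p v (Z l p)"
      using l by (simp add: same[OF Z_at[OF _ p] Z_at[OF l p], symmetric] g_frame[OF p] if_distrib cong: if_cong)
    finally show ?thesis using M0.g_diff_left[OF v vert_tangent[OF w] Zt[OF l]] by simp
  qed
  show "?u \<in> horiz A B g0 p"
    unfolding horiz_def mem_Collect_eq
  proof (intro conjI ballI u)
    fix z assume z: "z \<in> vert A B p"
    obtain c where c: "z = (\<lambda>k. \<Sum>j<m. c j * Z j p k)"
      using vproj_id[OF p z] unfolding vproj_def by metis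
    have "g0 p u' z = (\<Sum>j<m. c j * g0 p u' (Z j p))" if "u' \<in> tangent A p" for u'
      unfolding c by (rule M0.g_sum_right) (use Zt that in auto)
    then show "g0 p ?u z = 0" using uZ u by simp
  qed
  show "v = (\<lambda>k. ?u k + ?w k)" by simp
qed

text \<open>If \<open>v\<close> is horizontal for \<open>g\<close>, then its vertical component
  \<open>w\<close> in the splitting by \<open>g0\<close> satisfies \<open>g p w w = 0\<close> and
  therefore vanishes.\<close>

lemma horiz_same: "horiz A B g p = horiz A B g0 p"
proof (intro equalityI subsetI)
  fix v assume v: "v \<in> horiz A B g p"
  obtain u w where uw: "u \<in> horiz A B g0 p" "w \<in> vert A B p" "v = (\<lambda>k. u k + w k)"
    using split0[OF horiz_tangent[OF v]] by blast
  have "g p v w = g p u w + g p w w"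
    unfolding uw(3) by (intro g_add_left M0.horiz_tangent uw vert_tangent)
  then have "g p w w = 0" using horiz_vert[OF v uw(2)] orth[OF uw(1,2)] by simp
  then have "w = (\<lambda>_. 0)"
    using metric vert_tangent[OF uw(2)] unfolding riemannian_metric_def by fastforce
  then show "v \<in> horiz A B g0 p" using uw(1,3) by simp
next
  fix v assume "v \<in> horiz A B g0 p"
  then show "v \<in> horiz A B g p" using orth unfolding horiz_def by blast
qed

text \<open>One argument may be any tangent vector, because it will be a bracket that is not known
  to be vertical. Its horizontal component pairs to zero with \<open>y\<close> in both
  metrics.\<close>

lemma g_vert_same:
  assumes a: "a \<in> tangent A p" and y: "y \<in> vert A B p" shows "g p a y = g0 p a y"
proof -
  obtain u w where uw: "u \<in> horiz A B g0 p" "w \<in> vert A B p" "a = (\<lambda>k. u k + w k)"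
    using split0[OF a] by blast
  note t = M0.horiz_tangent[OF uw(1)] vert_tangent[OF uw(2)] vert_tangent[OF y]
  show ?thesis
    unfolding uw(3) g_add_left[OF t] M0.g_add_left[OF t]
    using orth[OF uw(1) y] M0.horiz_vert[OF uw(1) y] same[OF uw(2) y] by simp
qed

end

text \<open>Every metric term has a vertical argument, where \<open>g\<close> and \<open>g0\<close>
  agree, so this is the identity of \<open>totally_geodesic_invariant\<close> for
  \<open>g0\<close>.\<close>

lemma leafwise_invariant_transfer:
  assumes metric0: "riemannian_metric A g0"
    and same: "\<And>p u v. u \<in> vert A B p \<Longrightarrow> v \<in> vert A B p \<Longrightarrow> g p u v = g0 p u v"
    and orth: "\<And>p u v. u \<in> horiz A B g0 p \<Longrightarrow> v \<in> vert A B p \<Longrightarrow> g p u v = 0"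
    and lc: "levi_civita A g0 D0" and geo: "totally_geodesic_leaves A B D0"
    and V: "HF V" and Y: "VertF Y" and W: "VertF W" and p: "p \<in> U"
  shows "V p (\<lambda>q. g q (Y q) (W q)) = g p (lie A V Y p) (W p) + g p (Y p) (lie A V W p)"
proof -
  interpret M0: foliated_metric A B g0 by unfold_locales (rule metric0)
  have V0: "horizontal_field A B g0 U V"
    using V horiz_same[OF metric0 same orth] unfolding horizontal_field_def by blast
  note f = HF_VF[OF V] VertF_VF[OF Y] VertF_VF[OF W]
  have "V p (\<lambda>q. g q (Y q) (W q)) = V p (\<lambda>q. g0 q (Y q) (W q))"
    by (rule deriv_cong[OF f(1) p]) (intro same VertF_at Y W)
  moreover have "g p (lie A V Y p) (W p) = g0 p (lie A V Y p) (W p)"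
    by (rule g_vert_same[OF metric0 same orth p lie_tangent[OF U f(1,2) p] VertF_at[OF W p]])
  moreover have "g p (Y p) (lie A V W p) = g0 p (Y p) (lie A V W p)"
    using g_vert_same[OF metric0 same orth p lie_tangent[OF U f(1,3) p] VertF_at[OF Y p]]
      g_sym[OF VF_tangent[OF f(2) p] lie_tangent[OF U f(1,3) p]]
      M0.g_sym[OF VF_tangent[OF f(2) p] lie_tangent[OF U f(1,3) p]] by linarith
  ultimately show ?thesis
    using M0.totally_geodesic_invariant[OF lc geo U V0 Y W p] by linarith
qed

end

theorem theorem3p1:
  fixes A :: "('a::{t2_space, second_countable_topology}, 'e::euclidean_space) chart set"
    and B :: "'e set"
    and n m :: nat
    and I :: "real set"
    and g0 :: "'a tensor2"
    and g h :: "real \<Rightarrow> 'a tensor2"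
    and D :: "real \<Rightarrow> 'a vfield \<Rightarrow> 'a vfield \<Rightarrow> 'a vfield"
    and \<epsilon> t :: real
    and f :: "'a \<Rightarrow> real"
    and U :: "'a set"
    and X Z :: "nat \<Rightarrow> 'a vfield"
  assumes foliation: "foliated_atlas A B" "card B = n" "DIM('e) = n + m"
    and connected: "connected (UNIV :: 'a set)"
    and metric: "riemannian_metric A g0"
    and complete: "complete_riemannian A g0"
    and bundle_like_g0: "bundle_like A B g0"
    and generating: "bracket_generating A B g0"
    and interval: "is_interval I" "0 \<in> I"
    and flow: "transverse_flow A B I g0 h g"
    and h_tensor: "\<And>s. s \<in> I \<Longrightarrow> symmetric_tensor A (h s)"
    and h_horizontal: "\<And>s p u v. s \<in> I \<Longrightarrow> u \<in> vert A B p \<Longrightarrow> v \<in> tangent A p \<Longrightarrow>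
            h s p u v = 0 \<and> h s p v u = 0"
    and transverse: "\<And>s. s \<in> I \<Longrightarrow> bundle_like A B (g s)"
    and connection: "\<And>s. s \<in> I \<Longrightarrow> levi_civita A (g s) (D s)"
    and geodesic: "totally_geodesic_leaves A B (D 0)"
    and eps: "0 < \<epsilon>"
    and f: "smooth_fun A UNIV f"
    and t: "t \<in> I"
    and frame: "local_orthonormal_frame A B (g t) U n m X Z"
  defines "L \<equiv> bott_calculus.hor_laplacian A B (g t) (D t) n X"
    and "box_form \<equiv> bott_calculus.box_eps A B (g t) (D t) n m X Z \<epsilon>"
    and "\<eta> \<equiv> differential f"
    and "inner_e \<equiv> bott_calculus.inner_eps n m X Z \<epsilon>"
    and "inner_h \<equiv> bott_calculus.inner_H n X"
    and "inner_v \<equiv> bott_calculus.inner_V m Z"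
    and "Ric_form \<equiv> bott_calculus.Ric_H_form A B (g t) (D t) n m X Z"
    and "delta_form \<equiv> bott_calculus.delta_T_form A B (g t) (D t) n m X Z"
    and "J_sq_form \<equiv> bott_calculus.J_sq_form A B (g t) (D t) n m X Z"
    and "Tr_nabla \<equiv> bott_calculus.trace_nabla_sym A B (g t) (D t) n X"
    and "Tr_J \<equiv> bott_calculus.trace_J_sq A B (g t) (D t) n m X Z"
  shows "\<forall>p\<in>U.
     (\<forall>Y. vector_field A U Y \<longrightarrow> differential (L f) Y p = box_form (differential f) Y p) \<and>
     1 / 2 * L (inner_e \<eta> \<eta>) p - inner_e (box_form \<eta>) \<eta> p
       \<ge> 1 / real n * (Tr_nabla \<eta> p)\<^sup>2 - 1 / 4 * Tr_J \<eta> p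
         + inner_h (Ric_form \<eta>) \<eta> p - inner_v (delta_form \<eta>) \<eta> p
         + 1 / \<epsilon> * inner_h (J_sq_form \<eta>) \<eta> p"
proof -
  have atlas: "smooth_atlas A" and B: "B \<subseteq> Basis"
    using foliation(1) unfolding foliated_atlas_def by blast+
  have orth: "g t p u v = 0" if "u \<in> horiz A B g0 p" "v \<in> vert A B p" for p u v
    using flow t that unfolding transverse_flow_def by blast+
  have metric_t: "riemannian_metric A (g t)" and lc0: "levi_civita A g0 (D 0)"
    using flow t connection[OF interval(2)] unfolding transverse_flow_def by auto
  note same = transverse_flow_vert[OF flow interval t]
  interpret M0: foliated_metric A B g0 by unfold_locales (use atlas metric in auto)
  have F: "framed_foliation A B (g t) n m X Z U"
    by unfold_locales (use atlas metric_t frame in auto)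
  \<comment> \<open>Involutivity is taken from time zero, holonomy invariance from the bundle-like
    metric at time \<open>t\<close>; the leafwise condition is carried over from time zero, where
    the leaves are assumed totally geodesic.\<close>
  interpret P: foliated_patch A B "g t" "D t" n m X Z U
  proof (intro foliated_patch.intro foliated_patch_axioms.intro F)
    show "levi_civita A (g t) (D t)" by (rule connection[OF t])
    fix U' V W assume U': "open U'" "U' \<subseteq> U"
    interpret F': framed_foliation A B "g t" "D t" n m X Z U'
      by (rule framed_foliation.restrict_frame[OF F U'])
    show "vertical_field A B U' (lie A V W)" if "vertical_field A B U' V" "vertical_field A B U' W"
      by (rule M0.totally_geodesic_involutive[OF lc0 geodesic U'(1) that])
    fix Y p assume p: "p \<in> U'"
    show "V p (\<lambda>q. g t q (Y q) (W q)) = g t p (lie A V Y p) (W p) + g t p (Y p) (lie A V W p)"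
      if "vertical_field A B U' V" "horizontal_field A B (g t) U' Y" "horizontal_field A B (g t) U' W"
      by (rule F'.bundle_like_invariant[OF B foliation(2) transverse[OF t] that p])
    show "V p (\<lambda>q. g t q (Y q) (W q)) = g t p (lie A V Y p) (W p) + g t p (Y p) (lie A V W p)"
      if "horizontal_field A B (g t) U' V" "vertical_field A B U' Y" "vertical_field A B U' W"
      by (rule F'.leafwise_invariant_transfer[OF metric same orth lc0 geodesic that p])
  qed
  interpret P: foliated_patch_function A B "g t" "D t" n m X Z U f
    by unfold_locales (rule M0.smooth_fun_subset[OF f P.U], simp)
  show ?thesis
    unfolding L_def box_form_def \<eta>_def inner_e_def inner_h_def inner_v_def Ric_form_def delta_form_def
      J_sq_form_def Tr_nabla_def Tr_J_def
  proof (intro ballI conjI allI impI)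
    fix p assume p: "p \<in> U"
    show "differential (P.hor_laplacian f) Y p = P.box_eps \<epsilon> (differential f) Y p" if "vector_field A U Y" for Y
      using P.hor_laplacian_commutes[OF p that, of \<epsilon>] by (simp add: differential_def)
    show "1 / real n * (P.trace_nabla_sym (differential f) p)\<^sup>2 - 1 / 4 * P.trace_J_sq (differential f) p
        + P.inner_H (P.Ric_H_form (differential f)) (differential f) p
        - P.inner_V (P.delta_T_form (differential f)) (differential f) p
        + 1 / \<epsilon> * P.inner_H (P.J_sq_form (differential f)) (differential f) p
      \<le> 1 / 2 * P.hor_laplacian (P.inner_eps \<epsilon> (differential f) (differential f)) p
        - P.inner_eps \<epsilon> (P.box_eps \<epsilon> (differential f)) (differential f) p"
      by (rule P.bochner_inequality[OF p eps])
  qed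
qed

end
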